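(* Let $d\ge 2$ and let $B\subset\mathbb{R}^d$ be a bounded convex domain. Then there exists a constant $C>0$, independent of $R$ (it may depend on $B$ and $d$), such that for all $R>0$ $$\int_{S^{d-1}} \left|\widehat{\chi}_B(R\omega)\right|^2\, d\omega \;\le\; C\, R^{-(d+1)}.$$
   Context: A bounded convex domain is a bounded open convex subset of $\mathbb{R}^d$. $\chi_B$ denotes the characteristic (indicator) function of $B$. The Fourier transform is $\hat f(\xi)=\int_{\mathbb{R}^d} e^{-i x\cdot \xi} f(x)\,dx$. $S^{d-1}$ is the unit sphere in $\mathbb{R}^d$ and $d\omega$ is its surface measure. *)

theory Defs
  imports "HOL-Analysis.Analysis"
begin

definition fourier_transform :: "('a::euclidean_space \<Rightarrow> complex) \<Rightarrow> 'a \<Rightarrow> complex" where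
  "fourier_transform f \<xi> = (LINT x|lborel. exp (- \<i> * complex_of_real (x \<bullet> \<xi>)) * f x)"

text \<open>
  The (unnormalised) surface measure on the unit sphere, defined as in the integration formula
  in polar coordinates: the measure of a Borel set \<open>A\<close> of unit vectors is the dimension times
  the Lebesgue measure of the cone \<open>{t x | 0 < t < 1, x \<in> A}\<close> over it
  (lemma \<open>emeasure_sphere_measure\<close>). The map \<^term>\<open>sgn\<close> is the radial projection
  sending \<open>x\<close> to \<open>x / norm x\<close>.
\<close>
definition sphere_measure :: "'a::euclidean_space measure" where
  "sphere_measure =
     scale_measure (of_nat DIM('a))
       (distr (restrict_space lborel (ball 0 1 - {0})) (restrict_space borel (sphere 0 1)) sgn)"

lemma space_sphere_measure [simp]: "space (sphere_measure :: 'a::euclidean_space measure) = sphere 0 1"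
  by (simp add: sphere_measure_def space_scale_measure space_restrict_space)

lemma sets_sphere_measure [simp, measurable_cong]:
  "sets (sphere_measure :: 'a::euclidean_space measure) = sets (restrict_space borel (sphere 0 1))"
  by (simp add: sphere_measure_def)

lemma measurable_sgn_sphere:
  "sgn \<in> restrict_space lborel (ball 0 1 - {0 :: 'a::euclidean_space}) \<rightarrow>\<^sub>M restrict_space borel (sphere 0 1)"
proof (rule measurable_restrict_space2)
  show "sgn \<in> space (restrict_space lborel (ball 0 1 - {0 :: 'a})) \<rightarrow> sphere 0 1"
    by (auto simp: space_restrict_space norm_sgn)
  have "sgn \<in> borel_measurable (borel :: 'a measure)"
    unfolding sgn_div_norm by measurable
  then show "sgn \<in> restrict_space lborel (ball 0 1 - {0 :: 'a}) \<rightarrow>\<^sub>M borel"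
    by (intro measurable_restrict_space1) simp
qed

lemma emeasure_sphere_measure:
  fixes A :: "'a::euclidean_space set"
  assumes "A \<in> sets borel" "A \<subseteq> sphere 0 1"
  shows "emeasure sphere_measure A =
           of_nat DIM('a) * emeasure lborel {t *\<^sub>R x | t x. 0 < t \<and> t < 1 \<and> x \<in> A}"
proof -
  have A: "A \<in> sets (restrict_space borel (sphere 0 1))"
    using assms by (subst sets_restrict_space_iff) auto
  have eq: "sgn -` A \<inter> (ball 0 1 - {0}) = {t *\<^sub>R x | t x. 0 < t \<and> t < 1 \<and> x \<in> A}"
  proof (intro equalityI subsetI)
    fix y assume y: "y \<in> sgn -` A \<inter> (ball 0 1 - {0})"
    then have "y = norm y *\<^sub>R sgn y" "0 < norm y" "norm y < 1" "sgn y \<in> A"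
      by (auto simp: sgn_div_norm)
    then show "y \<in> {t *\<^sub>R x | t x. 0 < t \<and> t < 1 \<and> x \<in> A}" by blast
  next
    fix y assume "y \<in> {t *\<^sub>R x | t x. 0 < t \<and> t < 1 \<and> x \<in> A}"
    then obtain t x where tx: "y = t *\<^sub>R x" "0 < t" "t < 1" "x \<in> A" by blast
    moreover have "norm x = 1" using tx assms by auto
    ultimately show "y \<in> sgn -` A \<inter> (ball 0 1 - {0})"
      by (auto simp: sgn_div_norm)
  qed
  have "emeasure (distr (restrict_space lborel (ball 0 1 - {0 :: 'a})) (restrict_space borel (sphere 0 1)) sgn) A
        = emeasure (restrict_space lborel (ball 0 1 - {0})) (sgn -` A \<inter> (ball 0 1 - {0}))"
    by (subst emeasure_distr[OF measurable_sgn_sphere A]) (simp add: space_restrict_space)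
  also have "\<dots> = emeasure lborel (sgn -` A \<inter> (ball 0 1 - {0}))"
    by (rule emeasure_restrict_space) auto
  finally show ?thesis
    by (simp add: sphere_measure_def eq)
qed

end

theory Submission
  imports Defs "HOL-Complex_Analysis.Complex_Analysis" "HOL-Real_Asymp.Real_Asymp"
begin

text \<open>
  Approximate \<open>B\<close> by the convex bodies \<open>S \<le> 1\<close>, where \<open>S\<close> is a finite sum of exponentials
  \<open>exp (\<kappa> (a \<bullet> x - 1))\<close> over functionals \<open>a\<close> from the polar of \<open>B\<close>, smoothed over the layer \<open>1 \<le> S \<le> 2\<close>;
  the constants below depend only on an inner and an outer radius of \<open>B\<close>, so they survive the limit. Integrating by
  parts once turns the Fourier transform into \<open>1/R\<close> times an oscillatory integral over the layer.
  For frequencies in a small cap around \<open>\<tau>\<close> this integral is split by the slope \<open>\<tau> \<bullet> N\<close> of the unit normal \<open>N\<close>.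
  Where \<open>N\<close> is not orthogonal to \<open>\<tau>\<close>, two points of the layer are never aligned along \<open>\<tau>\<close>, so a \<open>T T\<^sup>*\<close>
  argument applies: expanding the square, the kernel obtained by integrating the
  frequencies against a cutoff decays in \<open>R |x - x'|\<close> by a shift of contour.
  Where \<open>N\<close> is almost orthogonal to \<open>\<tau>\<close>, a second integration by parts, along the level sets of \<open>S\<close>,
  gains another factor \<open>1/R\<close> at the cost of one curvature of the level sets. By convexity
  curvature is controlled by its trace, whose mass in a ball the first variation formula bounds by surface area, so no
  regularity of \<open>B\<close> enters.
\<close>

section \<open>Oscillatory integrals by contour shift\<close>

text \<open>The obstacle is that in the limit curvature is no better than a measure:
  \<open>H\<close> is not bounded as \<open>\<kappa>\<close> grows, so pointwise stationary phase is
  useless and only integrals of \<open>\<Theta>\<close> are available. Up to constants, with d the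
  dimension, the exponents balance as follows. At scale 1/R the layer carries surface mass R^(1-d)
  and curvature mass R^(2-d), since a test function of that scale loses one factor R in each
  integral identity. After squaring, the flat part has R^(-2) from one integration by parts and
  R^(1-d) from the kernel. The steep part has R^(-4) from two integrations by parts, R^(2-d) from
  curvature, and a loss of R from cutting the layer into slabs. Both products are R^(-d-1). The
  contour shift needs frequencies that run along straight lines. Hence a spherical integral is
  replaced by one over solid \<open>y\<close> with direction \<open>sgn y\<close>, and the lines are
  those orthogonal to \<open>\<tau>\<close>. The requirement \<open>8 * R \<le> norm (G x)\<close>
  keeps the layer thinner than 1/R, so that the ordering of its points along \<open>\<tau>\<close>
  is disturbed by at most 1/R.\<close>

lemma Im_le_of_Re_deriv_ge:
  fixes f :: "complex \<Rightarrow> complex"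
  assumes f: "f holomorphic_on ball 0 \<rho>"
    and real: "\<And>s. \<bar>s\<bar> < \<rho> \<Longrightarrow> Im (f (of_real s)) = 0"
    and der: "\<And>s. s \<in> ball 0 \<rho> \<Longrightarrow> \<mu> \<le> Re (deriv f s)"
    and s: "s \<in> ball 0 \<rho>" "Im s \<le> 0"
  shows "Im (f s) \<le> \<mu> * Im s"
proof (cases "Im s = 0")
  case True
  then have "s = of_real (Re s)" by (simp add: complex_eq_iff)
  moreover have "\<bar>Re s\<bar> < \<rho>" using s abs_Re_le_cmod[of s] by auto
  ultimately have "Im (f s) = 0" using real by metis
  then show ?thesis using True by simp
next
  case False
  then have neg: "Im s < 0" using s by simp
  \<comment> \<open>Cauchy-Riemann: along a vertical line the derivative of \<open>Im f\<close> is
    \<open>Re f'\<close>. Since \<open>Im f\<close> vanishes on the real axis, the mean value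
    theorem from there down to \<open>s\<close> gives the bound. It makes
    \<open>exp (- \<i> * f s)\<close> decay like \<open>exp (\<mu> * Im s)\<close> below the
    axis.\<close>
  define h where "h t = Im (f (Complex (Re s) t))" for t
  have inb: "Complex (Re s) t \<in> ball 0 \<rho>" if "Im s \<le> t" "t \<le> 0" for t
  proof -
    have "t\<^sup>2 \<le> (Im s)\<^sup>2" using that by (simp add: abs_le_square_iff[symmetric])
    then have "cmod (Complex (Re s) t) \<le> cmod s" by (simp add: cmod_def)
    then show ?thesis using s by simp
  qed
  have dh: "(h has_real_derivative Re (deriv f (Complex (Re s) t))) (at t)" if "Im s \<le> t" "t \<le> 0" for t
  proof -
    have "(f has_field_derivative deriv f (Complex (Re s) t)) (at (Complex (Re s) t))"
      using f inb[OF that] holomorphic_derivI open_ball by blast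
    moreover have "((\<lambda>t. Complex (Re s) t) has_vector_derivative \<i>) (at t)"
      unfolding Complex_eq by (auto intro!: derivative_eq_intros simp: has_vector_derivative_def scaleR_conv_of_real)
    ultimately have "((\<lambda>t. f (Complex (Re s) t)) has_vector_derivative \<i> * deriv f (Complex (Re s) t)) (at t)"
      using field_vector_diff_chain_at[of "\<lambda>t. Complex (Re s) t" \<i> t f] by (simp add: o_def)
    then have "(h has_vector_derivative Im (\<i> * deriv f (Complex (Re s) t))) (at t)"
      unfolding h_def by (rule bounded_linear.has_vector_derivative[OF bounded_linear_Im])
    then show ?thesis by (simp add: has_real_derivative_iff_has_vector_derivative)
  qed
  obtain \<xi> where \<xi>: "Im s < \<xi>" "\<xi> < 0" "h 0 - h (Im s) = (0 - Im s) * Re (deriv f (Complex (Re s) \<xi>))"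
    using MVT2[OF neg, of h "\<lambda>t. Re (deriv f (Complex (Re s) t))"] dh by auto
  have "h 0 = 0" unfolding h_def using real[of "Re s"] s abs_Re_le_cmod[of s]
    by (simp add: complex_of_real_def)
  moreover have "h (Im s) = Im (f s)" by (simp add: h_def)
  moreover have "(- Im s) * Re (deriv f (Complex (Re s) \<xi>)) \<ge> (- Im s) * \<mu>"
    using der[OF inb[of \<xi>]] \<xi> neg by (intro mult_left_mono) auto
  ultimately show ?thesis using \<xi> by (simp add: algebra_simps)
qed

text \<open>One term of the exponential series suffices:
  \<open>(\<mu> * v) ^ m / fact m \<le> exp (\<mu> * v)\<close>.\<close>

lemma power_times_exp_le:
  fixes v \<mu> :: real
  assumes "0 \<le> v" "0 < \<mu>"
  shows "v ^ m * exp (- (\<mu> * v)) \<le> fact m / \<mu> ^ m"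
proof -
  have "(\<mu> * v) ^ m / fact m \<le> exp (\<mu> * v)"
  proof -
    have "(\<mu> * v) ^ m / fact m = (\<Sum>n\<in>{m}. (\<mu> * v) ^ n /\<^sub>R fact n)" by (simp add: field_simps)
    also have "\<dots> \<le> (\<Sum>n. (\<mu> * v) ^ n /\<^sub>R fact n)"
      using assms by (intro sum_le_suminf summable_exp_generic) auto
    finally show ?thesis by (simp add: exp_def)
  qed
  then show ?thesis using assms
    by (simp add: exp_minus field_simps power_mult_distrib)
qed

text \<open>Pushing the contour from \<open>[-r, r]\<close> to the two segments through \<open>-\<i> r\<close> makes the
  oscillating factor decay, and the zeros of the weight at the end points turn this decay
  into a power of \<open>\<mu>\<close>.\<close>
lemma oscillatory_integral_bound:
  fixes f q :: "complex \<Rightarrow> complex"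
  assumes f: "f holomorphic_on ball 0 \<rho>" and q: "q holomorphic_on ball 0 \<rho>"
    and real: "\<And>s. \<bar>s\<bar> < \<rho> \<Longrightarrow> Im (f (of_real s)) = 0"
    and der: "\<And>s. s \<in> ball 0 \<rho> \<Longrightarrow> \<mu> \<le> Re (deriv f s)"
    and Q: "\<And>s. s \<in> ball 0 \<rho> \<Longrightarrow> cmod (q s) \<le> Q"
    and r: "0 < r" "r < \<rho>" "r \<le> 1/2" and \<mu>: "0 < \<mu>"
  shows "cmod (integral {-r..r} (\<lambda>s. of_real ((r\<^sup>2 - s\<^sup>2) ^ m) * q (of_real s) * exp (- \<i> * f (of_real s))))
          \<le> 2 * (Q * (2 ^ m * fact m / \<mu> ^ m))"
proof -
  define F where "F s = (of_real r ^ 2 - s ^ 2) ^ m * q s * exp (- \<i> * f s)" for s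
  have F: "F holomorphic_on ball 0 \<rho>"
    unfolding F_def by (intro holomorphic_intros f q)
  define a b c :: complex where "a = - of_real r" and "b = of_real r" and "c = - \<i> * of_real r"
  have hull: "convex hull {a, c, b} \<subseteq> ball 0 \<rho>"
    using r by (intro hull_minimal) (auto simp: a_def b_def c_def norm_mult)
  have cont: "continuous_on (closed_segment x y) F" if "x \<in> {a,b,c}" "y \<in> {a,b,c}" for x y
  proof -
    have "closed_segment x y \<subseteq> ball 0 \<rho>"
      using that r by (intro closed_segment_subset) (auto simp: a_def b_def c_def norm_mult)
    then show ?thesis using F holomorphic_on_imp_continuous_on continuous_on_subset by blast
  qed
  have tri: "(F has_contour_integral 0) (linepath a c +++ linepath c b +++ linepath b a)"
    using Cauchy_theorem_triangle[of F a c b] F hull holomorphic_on_subset by blast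
  have ci: "F contour_integrable_on linepath x y" if "x \<in> {a,b,c}" "y \<in> {a,b,c}" for x y
    using cont[OF that] by (rule contour_integrable_continuous_linepath)
  have sum0: "contour_integral (linepath a c) F + contour_integral (linepath c b) F
       + contour_integral (linepath b a) F = 0"
    using contour_integral_unique[OF tri] ci by (simp add: add.assoc)
  have rev: "contour_integral (linepath b a) F = - contour_integral (linepath a b) F"
    by (rule contour_integral_reverse_linepath) (rule cont, auto)
  have main: "contour_integral (linepath a b) F
        = integral {-r..r} (\<lambda>s. F (of_real s))"
    using contour_integral_linepath_Reals_eq[of a b F] r by (simp add: a_def b_def)
  have Q0: "0 \<le> Q" using order_trans[OF norm_ge_zero Q[of 0]] r by simp
  define E where "E = Q * (2 ^ m * fact m / \<mu> ^ m)"
  have E0: "0 \<le> E" unfolding E_def using Q0 \<mu> by simp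
  \<comment> \<open>At depth \<open>- Im s\<close> below the axis the weight is at most
    \<open>(2 * (- Im s)) ^ m\<close> and the exponential at most \<open>exp (\<mu> * Im s)\<close>;
    their product is bounded by \<open>E\<close> uniformly in the depth.\<close>
  have bnd: "cmod (F s) \<le> E" if s: "s \<in> ball 0 \<rho>" "Im s \<le> 0" 
      and w: "cmod (of_real r ^ 2 - s ^ 2) \<le> 2 * (- Im s)" for s
  proof -
    have "Im (f s) \<le> \<mu> * Im s" using Im_le_of_Re_deriv_ge[OF f real der s] by simp
    then have e: "cmod (exp (- \<i> * f s)) \<le> exp (- (\<mu> * (- Im s)))" by simp
    have "cmod (F s) \<le> (2 * (- Im s)) ^ m * Q * exp (- (\<mu> * (- Im s)))"
      unfolding F_def norm_mult norm_power
      using s w e Q[OF s(1)] Q0 by (intro mult_mono power_mono) auto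
    also have "\<dots> = Q * 2 ^ m * ((- Im s) ^ m * exp (- (\<mu> * (- Im s))))"
      unfolding power_mult_distrib by simp
    also have "\<dots> \<le> Q * 2 ^ m * (fact m / \<mu> ^ m)"
      using power_times_exp_le[of "- Im s" \<mu> m] s \<mu> Q0 by (intro mult_left_mono) auto
    finally show ?thesis by (simp add: E_def)
  qed
  \<comment> \<open>\<open>\<sigma>\<close> selects the side and \<open>v\<close> is the depth. The
    nearer end point is at distance \<open>sqrt 2 * v\<close>, the other one at distance at most
    \<open>2 * r \<le> 1\<close>.\<close>
  have w: "cmod (of_real r ^ 2 - s ^ 2) \<le> 2 * (- Im s)"
    if "s = of_real \<sigma> * (of_real (-r + v)) - \<i> * of_real v" "0 \<le> v" "v \<le> r" "\<sigma> = 1 \<or> \<sigma> = -1" for s \<sigma> v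
  proof -
    have "of_real r ^ 2 - s ^ 2 = (of_real r - s) * (of_real r + s)" by (simp add: algebra_simps power2_eq_square)
    also have "(of_real r - s) * (of_real r + s) = 
        (of_real (2 * r - v) + of_real \<sigma> * \<i> * of_real v) * (of_real v - of_real \<sigma> * \<i> * of_real v)"
      using that(4) unfolding that(1) by (elim disjE) (simp_all add: algebra_simps)
    finally have eq: "cmod (of_real r ^ 2 - s ^ 2) =
        cmod (of_real (2 * r - v) + of_real \<sigma> * \<i> * of_real v) * cmod (of_real v - of_real \<sigma> * \<i> * of_real v)"
      by (simp only: norm_mult)
    have "cmod (of_real v - of_real \<sigma> * \<i> * of_real v) = sqrt 2 * v"
    proof -
      have "of_real v - of_real \<sigma> * \<i> * of_real v = Complex v (- \<sigma> * v)" by (simp add: complex_eq_iff)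
      then have "cmod (of_real v - of_real \<sigma> * \<i> * of_real v) = sqrt (v\<^sup>2 + (- \<sigma> * v)\<^sup>2)" 
        by (simp add: complex_norm)
      also have "v\<^sup>2 + (- \<sigma> * v)\<^sup>2 = 2 * v\<^sup>2" using that by auto
      finally show ?thesis using that by (simp add: real_sqrt_mult)
    qed
    moreover have "cmod (of_real (2 * r - v) + of_real \<sigma> * \<i> * of_real v) \<le> 2 * r"
    proof -
      have "of_real (2*r - v) + of_real \<sigma> * \<i> * of_real v = Complex (2 * r - v) (\<sigma> * v)" by (simp add: complex_eq_iff)
      then have eq: "cmod (of_real (2 * r - v) + of_real \<sigma> * \<i> * of_real v) = sqrt ((2 * r - v)\<^sup>2 + (\<sigma> * v)\<^sup>2)" 
        by (simp only: complex_norm)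
      have "(2 * r - v)\<^sup>2 + (\<sigma> * v)\<^sup>2 = (2*r)\<^sup>2 - 2 * v * (2 * r - v)" using that by (auto simp: power2_eq_square algebra_simps)
      also have "\<dots> \<le> (2 * r)\<^sup>2" using that by (simp add: mult_nonneg_nonneg)
      finally show ?thesis unfolding eq using r by (intro real_le_lsqrt) auto
    qed
    ultimately have "cmod (of_real r ^ 2 - s ^ 2) \<le> (2 * r) * (sqrt 2 * v)"
      unfolding eq using that r by (intro mult_mono) auto
    also have "\<dots> \<le> 1 * (2 * v)"
      using that r sqrt2_less_2 by (intro mult_mono) auto
    also have "v = - Im s" using that by auto
    finally show ?thesis by simp
  qed
  have seg1: "cmod (F s) \<le> E" if s: "s \<in> closed_segment a c" for s
  proof -
    from s obtain u where u: "0 \<le> u" "u \<le> 1" "s = (1 - u) *\<^sub>R a + u *\<^sub>R c" by (auto simp: closed_segment_def)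
    have eq: "s = of_real 1 * (of_real (-r + u * r)) - \<i> * of_real (u * r)"
      using u by (simp add: a_def c_def scaleR_conv_of_real algebra_simps)
    have "s \<in> ball 0 \<rho>" using s hull segments_subset_convex_hull(1) 
      by (metis closed_segment_subset_convex_hull convex_convex_hull hull_inc insertCI subset_iff closed_segment_subset)
    moreover have "Im s = - (u * r)" by (subst eq) simp
    then have "Im s \<le> 0" using u r by simp
    ultimately show ?thesis using bnd w[OF eq] u r by (simp add: mult_left_le_one_le)
  qed
  have seg2: "cmod (F s) \<le> E" if s: "s \<in> closed_segment c b" for s
  proof -
    from s obtain u where u: "0 \<le> u" "u \<le> 1" "s = (1 - u) *\<^sub>R c + u *\<^sub>R b" by (auto simp: closed_segment_def)
    have eq: "s = of_real (-1) * (of_real (-r + (1-u) * r)) - \<i> * of_real ((1-u) * r)"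
      using u by (simp add: b_def c_def scaleR_conv_of_real algebra_simps)
    have "s \<in> ball 0 \<rho>" using s hull 
      by (metis convex_convex_hull hull_inc insertCI subset_iff closed_segment_subset)
    moreover have "Im s = - ((1 - u) * r)" by (subst eq) simp
    then have "Im s \<le> 0" using u r by simp
    ultimately show ?thesis using bnd w[OF eq] u r by (simp add: mult_left_le_one_le)
  qed
  have len: "cmod (c - a) \<le> 1" "cmod (b - c) \<le> 1"
  proof -
    have "c - a = Complex r (-r)" "b - c = Complex r r" by (auto simp: a_def b_def c_def complex_eq_iff)
    moreover have "sqrt (r\<^sup>2 + r\<^sup>2) \<le> 1" using r power_mono[of r "1/2" 2] by (simp add: power2_eq_square)
    ultimately show "cmod (c - a) \<le> 1" "cmod (b - c) \<le> 1" by (simp_all add: complex_norm)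
  qed
  have "cmod (contour_integral (linepath a c) F) \<le> E * cmod (c - a)"
    by (rule contour_integral_bound_linepath[OF ci E0 seg1]) auto
  also have "\<dots> \<le> E" using len E0 by (simp add: mult_left_le)
  finally have 1: "cmod (contour_integral (linepath a c) F) \<le> E" .
  have "cmod (contour_integral (linepath c b) F) \<le> E * cmod (b - c)"
    by (rule contour_integral_bound_linepath[OF ci E0 seg2]) auto
  also have "\<dots> \<le> E" using len E0 by (simp add: mult_left_le)
  finally have 2: "cmod (contour_integral (linepath c b) F) \<le> E" .
  have "integral {-r..r} (\<lambda>s. F (of_real s)) = contour_integral (linepath a c) F + contour_integral (linepath c b) F"
    using sum0 rev main by (simp add: algebra_simps)
  then have "cmod (integral {-r..r} (\<lambda>s. F (of_real s))) \<le> E + E"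
    using 1 2 norm_triangle_ineq by (metis add_mono order_trans)
  then show ?thesis unfolding F_def E_def by (simp add: mult_ac)
qed

section \<open>Square integrals and kernels\<close>

lemma integrable_bounded_support:
  fixes h :: "'a::euclidean_space \<Rightarrow> 'b::{banach,second_countable_topology}"
  assumes [measurable]: "h \<in> borel_measurable borel"
    and "\<And>x. norm (h x) \<le> C" and "\<And>x. L < norm x \<Longrightarrow> h x = 0"
  shows "integrable lborel h"
proof (rule integrableI_bounded_set[where A = "cball 0 L" and B = C])
  show "emeasure lborel (cball (0::'a) L) < \<infinity>"
    using emeasure_bounded_finite[OF bounded_cball] .
qed (use assms in auto)

lemma integrable_bounded_support_pair:
  fixes h :: "'a::euclidean_space \<Rightarrow> 'c::euclidean_space \<Rightarrow> 'b::{banach,second_countable_topology}"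
  assumes "case_prod h \<in> borel_measurable borel"
    and "\<And>x y. norm (h x y) \<le> C" and "\<And>x y. L < norm x \<Longrightarrow> h x y = 0" and "\<And>x y. M < norm y \<Longrightarrow> h x y = 0"
  shows "integrable (lborel \<Otimes>\<^sub>M lborel) (case_prod h)"
  unfolding lborel_prod
proof (rule integrable_bounded_support[where C = C and L = "\<bar>L\<bar> + \<bar>M\<bar>"])
  fix p :: "'a \<times> 'c" assume "\<bar>L\<bar> + \<bar>M\<bar> < norm p"
  then have "\<bar>L\<bar> + \<bar>M\<bar> < norm (fst p) + norm (snd p)"
    using norm_Pair_le[of "fst p" "snd p"] by simp
  then have "L < norm (fst p) \<or> M < norm (snd p)" by linarith
  then show "case_prod h p = 0" using assms(3,4) by (auto simp: case_prod_beta)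
qed (use assms in \<open>auto simp: case_prod_beta\<close>)

lemma integral_lborel_translation:
  fixes f :: "'a::euclidean_space \<Rightarrow> 'b::{banach,second_countable_topology}"
  assumes [measurable]: "f \<in> borel_measurable borel"
  shows "(LINT x|lborel. f (x + a)) = (LINT x|lborel. f x)"
proof -
  have eq: "lborel = distr lborel borel (\<lambda>x. a + x)"
    using lborel_affine[of 1 a] by (simp add: density_1)
  show ?thesis
    by (subst (2) eq, subst integral_distr) (simp_all add: add.commute)
qed

text \<open>The window \<open>0 \<le> x \<bullet> e \<le> 1\<close> meets every line in direction \<open>e\<close> in unit length, which
  makes this a coordinate-free form of integration along the lines in direction \<open>e\<close>.\<close>
lemma norm_integral_le_lines:
  fixes h :: "'a::euclidean_space \<Rightarrow> complex"
  assumes h[measurable]: "h \<in> borel_measurable borel"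
    and C: "\<And>x. norm (h x) \<le> C" and L: "\<And>x. L < norm x \<Longrightarrow> h x = 0"
    and e: "norm e = 1"
    and inner: "\<And>x. x \<bullet> e = 0 \<Longrightarrow> norm (LINT s|lborel. h (x + s *\<^sub>R e)) \<le> B"
  shows "norm (LINT x|lborel. h x) \<le> B * measure lborel (cball (0::'a) (\<bar>L\<bar> + 1))"
proof -
  define \<theta> :: "real \<Rightarrow> complex" where "\<theta> t = indicator {0..1} t" for t
  have [measurable]: "\<theta> \<in> borel_measurable borel" unfolding \<theta>_def by measurable
  have ee: "e \<bullet> e = 1" using e by (simp add: norm_eq_1)
  have ip: "\<bar>x \<bullet> e\<bar> \<le> norm x" for x using Cauchy_Schwarz_ineq2[of x e] e by simp
  have B0: "0 \<le> B" using inner[of 0] norm_ge_zero order_trans by (metis inner_zero_left)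
  have "case_prod (\<lambda>s x. h x * \<theta> (x \<bullet> e - s)) \<in> borel_measurable borel"
    unfolding borel_prod[symmetric] by measurable
  then have int1: "integrable (lborel \<Otimes>\<^sub>M lborel) (case_prod (\<lambda>s x. h x * \<theta> (x \<bullet> e - s)))"
  proof (rule integrable_bounded_support_pair[where C = "\<bar>C\<bar>" and L = "\<bar>L\<bar> + 1" and M = L])
    fix s x
    show "norm (h x * \<theta> (x \<bullet> e - s)) \<le> \<bar>C\<bar>" using C[of x] by (auto simp: \<theta>_def norm_mult split: split_indicator)
    show "h x * \<theta> (x \<bullet> e - s) = 0" if "\<bar>L\<bar> + 1 < norm s"
    proof (cases "L < norm x")
      case False
      then have "\<not> (0 \<le> x \<bullet> e - s \<and> x \<bullet> e - s \<le> 1)" using that ip[of x] by auto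
      then show ?thesis by (auto simp: \<theta>_def)
    qed (simp add: L)
  qed (simp add: L)
  have "case_prod (\<lambda>s x. h (x + s *\<^sub>R e) * \<theta> (x \<bullet> e)) \<in> borel_measurable borel"
    unfolding borel_prod[symmetric] by measurable
  then have int2: "integrable (lborel \<Otimes>\<^sub>M lborel) (case_prod (\<lambda>s x. h (x + s *\<^sub>R e) * \<theta> (x \<bullet> e)))"
  proof (rule integrable_bounded_support_pair[where C = "\<bar>C\<bar>" and L = "\<bar>L\<bar> + 1" and M = "\<bar>L\<bar> + (\<bar>L\<bar> + 1)"])
    fix s x
    show "norm (h (x + s *\<^sub>R e) * \<theta> (x \<bullet> e)) \<le> \<bar>C\<bar>" using C[of "x + s *\<^sub>R e"] by (auto simp: \<theta>_def norm_mult split: split_indicator)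
    show z: "h (x + s *\<^sub>R e) * \<theta> (x \<bullet> e) = 0" if "\<bar>L\<bar> + 1 < norm s" for s
    proof (cases "L < norm (x + s *\<^sub>R e)")
      case False
      then have "\<bar>x \<bullet> e + s\<bar> \<le> L" using ip[of "x + s *\<^sub>R e"] by (simp add: inner_add_left ee)
      then have "\<not> (0 \<le> x \<bullet> e \<and> x \<bullet> e \<le> 1)" using that by auto
      then show ?thesis by (auto simp: \<theta>_def)
    qed (simp add: L)
    show "h (x + s *\<^sub>R e) * \<theta> (x \<bullet> e) = 0" if "\<bar>L\<bar> + (\<bar>L\<bar> + 1) < norm x"
    proof (cases "\<bar>L\<bar> + 1 < norm s")
      case False
      have "norm x \<le> norm (x + s *\<^sub>R e) + norm (s *\<^sub>R e)" by (metis add_diff_cancel norm_triangle_ineq4)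
      then have "L < norm (x + s *\<^sub>R e)" using that False e by simp
      then show ?thesis by (simp add: L)
    qed (rule z)
  qed
  have th: "(LINT s|lborel. \<theta> (c - s)) = 1" for c
  proof -
    have "(LINT s|lborel. \<theta> (c - s)) = (LINT s|lborel. of_real (indicator {c - 1..c} s))"
      by (intro Bochner_Integration.integral_cong) (auto simp: \<theta>_def split: split_indicator)
    also have "\<dots> = of_real (LINT s|lborel. indicator {c - 1..c} s)" by (rule integral_complex_of_real)
    finally show ?thesis by simp
  qed
  have "(LINT x|lborel. h x) = (LINT x|lborel. (LINT s|lborel. h x * \<theta> (x \<bullet> e - s)))"
    by (simp add: th)
  also have "\<dots> = (LINT s|lborel. (LINT x|lborel. h x * \<theta> (x \<bullet> e - s)))"
    using lborel_pair.Fubini_integral[OF int1] by simp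
  also have "\<dots> = (LINT s|lborel. (LINT x|lborel. h (x + s *\<^sub>R e) * \<theta> (x \<bullet> e)))"
  proof (rule Bochner_Integration.integral_cong[OF refl])
    fix s :: real
    have "(LINT x|lborel. h x * \<theta> (x \<bullet> e - s)) = (LINT x|lborel. h (x + s *\<^sub>R e) * \<theta> ((x + s *\<^sub>R e) \<bullet> e - s))"
      by (rule integral_lborel_translation[symmetric]) measurable
    then show "(LINT x|lborel. h x * \<theta> (x \<bullet> e - s)) = (LINT x|lborel. h (x + s *\<^sub>R e) * \<theta> (x \<bullet> e))"
      by (simp add: inner_add_left ee)
  qed
  also have "\<dots> = (LINT x|lborel. (LINT s|lborel. h (x + s *\<^sub>R e) * \<theta> (x \<bullet> e)))"
    using lborel_pair.Fubini_integral[OF int2] by simp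
  finally have eq: "(LINT x|lborel. h x) = (LINT x|lborel. (LINT s|lborel. h (x + s *\<^sub>R e)) * \<theta> (x \<bullet> e))"
    by simp
  have line: "(LINT s|lborel. h (x + s *\<^sub>R e)) = (LINT s|lborel. h ((x - (x \<bullet> e) *\<^sub>R e) + s *\<^sub>R e))" for x
    using integral_lborel_translation[of "\<lambda>s. h ((x - (x \<bullet> e) *\<^sub>R e) + s *\<^sub>R e)" "x \<bullet> e"]
    by (simp add: algebra_simps)
  \<comment> \<open>The bound is only charged on a ball: a window point of norm above
    \<open>\<bar>L\<bar> + 1\<close> lies on a line whose foot
    \<open>x - (x \<bullet> e) *\<^sub>R e\<close> has norm above \<open>\<bar>L\<bar>\<close>, and
    by Pythagoras this whole line misses the support of \<open>h\<close>.\<close>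
  have innerB: "norm ((LINT s|lborel. h (x + s *\<^sub>R e)) * \<theta> (x \<bullet> e)) \<le> B * indicator (cball 0 (\<bar>L\<bar> + 1)) x" for x
  proof (cases "\<bar>L\<bar> + 1 < norm x \<and> \<theta> (x \<bullet> e) \<noteq> 0")
    case True
    then have xe: "0 \<le> x \<bullet> e" "x \<bullet> e \<le> 1" by (auto simp: \<theta>_def split: split_indicator_asm)
    have "h ((x - (x \<bullet> e) *\<^sub>R e) + s *\<^sub>R e) = 0" for s
    proof (rule L)
      let ?p = "x - (x \<bullet> e) *\<^sub>R e"
      have "norm x \<le> norm ?p + norm ((x \<bullet> e) *\<^sub>R e)" by (metis diff_add_cancel norm_triangle_ineq)
      then have p: "norm ?p > \<bar>L\<bar>" using True xe e by simp
      have "?p \<bullet> e = 0" by (simp add: inner_diff_left ee)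
      then have "norm (?p + s *\<^sub>R e) ^ 2 = norm ?p ^ 2 + s ^ 2"
        using e by (subst norm_add_Pythagorean) (simp_all add: orthogonal_def)
      then have "norm ?p ^ 2 \<le> norm (?p + s *\<^sub>R e) ^ 2" by simp
      then have "norm ?p \<le> norm (?p + s *\<^sub>R e)" by (rule power2_le_imp_le) simp
      then show "L < norm (?p + s *\<^sub>R e)" using p by simp
    qed
    then show ?thesis using line[of x] B0 by (simp split: split_indicator)
  next
    case False
    have "norm (LINT s|lborel. h (x + s *\<^sub>R e)) \<le> B"
      using inner[of "x - (x \<bullet> e) *\<^sub>R e"] line[of x] by (simp add: inner_diff_left ee)
    moreover have "norm (\<theta> (x \<bullet> e)) \<le> 1" by (auto simp: \<theta>_def split: split_indicator)
    ultimately have "norm ((LINT s|lborel. h (x + s *\<^sub>R e)) * \<theta> (x \<bullet> e)) \<le> B * 1"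
      unfolding norm_mult using B0 by (intro mult_mono) auto
    then show ?thesis using False by (auto split: split_indicator)
  qed
  have "norm (LINT x|lborel. h x) \<le> (LINT x|lborel. B * indicator (cball (0::'a) (\<bar>L\<bar> + 1)) x)"
    unfolding eq
  proof (rule Bochner_Integration.integral_norm_bound_integral)
    show "integrable lborel (\<lambda>x. (LINT s|lborel. h (x + s *\<^sub>R e)) * \<theta> (x \<bullet> e))"
      using lborel_pair.integrable_snd[OF int2] by simp
    have "(\<lambda>x. B * indicator (cball (0::'a) (\<bar>L\<bar> + 1)) x) \<in> borel_measurable borel"
      by (intro borel_measurable_times borel_measurable_const borel_measurable_indicator) simp
    then show "integrable lborel (\<lambda>x. B * indicator (cball (0::'a) (\<bar>L\<bar> + 1)) x)"
      by (rule integrable_bounded_support[where C = B and L = "\<bar>L\<bar> + 1"])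
         (auto simp: B0 split: split_indicator)
  qed (rule innerB)
  then show ?thesis by simp
qed

text \<open>The \<open>T T\<^sup>*\<close> expansion: the squared modulus of an integral over
  \<open>x\<close> is a double integral over \<open>x\<close> and \<open>x'\<close>, and Fubini
  brings the integral over \<open>y\<close> inside, where only its modulus is used.\<close>

lemma integral_squared_norm_le_kernel:
  fixes u :: "'a::euclidean_space \<Rightarrow> 'b::euclidean_space \<Rightarrow> complex" and w :: "'b \<Rightarrow> real"
  assumes u: "case_prod u \<in> borel_measurable borel"
    and C: "\<And>x y. norm (u x y) \<le> C" and L: "\<And>x y. L < norm x \<Longrightarrow> u x y = 0"
    and w[measurable]: "w \<in> borel_measurable borel"
    and D: "\<And>y. \<bar>w y\<bar> \<le> D" and M: "\<And>y. M < norm y \<Longrightarrow> w y = 0"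
    and k: "integrable (lborel \<Otimes>\<^sub>M lborel) (case_prod k)"
    and le: "\<And>x x'. norm (LINT y|lborel. of_real (w y) * (u x y * cnj (u x' y))) \<le> k x x'"
  shows "(LINT y|lborel. w y * (cmod (LINT x|lborel. u x y))\<^sup>2) \<le> (LINT x|lborel. LINT x'|lborel. k x x')"
proof -
  have [measurable]: "case_prod u \<in> borel_measurable (borel \<Otimes>\<^sub>M borel)"
    using u by (simp add: borel_prod)
  have C0: "0 \<le> C" using C[of 0 0] norm_ge_zero order_trans by blast
  have D0: "0 \<le> D" using D[of 0] abs_ge_zero order_trans by blast
  have [measurable]: "cnj \<in> borel_measurable borel"
    by (intro borel_measurable_continuous_onI continuous_intros)
  \<comment> \<open>The pair of \<open>x\<close> and \<open>x'\<close> is one point \<open>p\<close>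
    of the product space, so that a single application of Fubini between \<open>p\<close> and
    \<open>y\<close> is enough.\<close>
  define v where "v p y = of_real (w y) * (u (fst p) y * cnj (u (snd p) y))" for p y
  have pm: "fst \<in> borel \<rightarrow>\<^sub>M (borel::'a measure)" "snd \<in> borel \<rightarrow>\<^sub>M (borel::'a measure)"
    by (auto intro!: borel_measurable_continuous_onI continuous_intros)
  have vm: "case_prod v \<in> borel_measurable borel"
    unfolding v_def borel_prod[symmetric] by measurable
  have vint: "integrable (lborel \<Otimes>\<^sub>M lborel) (case_prod v)"
  proof (rule integrable_bounded_support_pair[OF vm, where C = "D * (C * C)" and L = "\<bar>L\<bar> + \<bar>L\<bar>" and M = M])
    fix p :: "'a \<times> 'a" and y :: 'b
    show "norm (v p y) \<le> D * (C * C)"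
      unfolding v_def norm_mult using C D C0 D0 by (intro mult_mono) auto
    show "v p y = 0" if "M < norm y" using M[OF that] by (simp add: v_def)
    show "v p y = 0" if "\<bar>L\<bar> + \<bar>L\<bar> < norm p"
    proof -
      have "\<bar>L\<bar> + \<bar>L\<bar> < norm (fst p) + norm (snd p)"
        using norm_Pair_le[of "fst p" "snd p"] that by simp
      then have "L < norm (fst p) \<or> L < norm (snd p)" by linarith
      then show ?thesis using L by (auto simp: v_def)
    qed
  qed
  have sq: "(LINT p|(lborel \<Otimes>\<^sub>M lborel). v p y) = of_real (w y * (cmod (LINT x|lborel. u x y))\<^sup>2)" for y
  proof -
    have "case_prod (\<lambda>x x'. v (x, x') y) \<in> borel_measurable borel"
      unfolding v_def borel_prod[symmetric] by measurable
    then have i: "integrable (lborel \<Otimes>\<^sub>M lborel) (case_prod (\<lambda>x x'. v (x, x') y))"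
    proof (rule integrable_bounded_support_pair[where C = "D * (C * C)" and L = L and M = L])
      fix x x'
      show "norm (v (x, x') y) \<le> D * (C * C)"
        unfolding v_def norm_mult using C D C0 D0 by (intro mult_mono) auto
    qed (auto simp: v_def L)
    have "case_prod (\<lambda>x x'. v (x, x') y) = (\<lambda>p. v p y)" by (simp add: fun_eq_iff)
    then have "(LINT p|(lborel \<Otimes>\<^sub>M lborel). v p y) = (LINT x|lborel. LINT x'|lborel. v (x, x') y)"
      using lborel_pair.integral_fst'[OF i] by simp
    also have "\<dots> = (LINT x|lborel. of_real (w y) * u x y * cnj (LINT x'|lborel. u x' y))"
      by (simp add: v_def mult.assoc integral_cnj)
    also have "\<dots> = of_real (w y) * ((LINT x|lborel. u x y) * cnj (LINT x'|lborel. u x' y))"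
      by (simp add: mult.assoc)
    finally show ?thesis by (simp add: complex_norm_square del: of_real_power)
  qed
  have "complex_of_real (LINT y|lborel. w y * (cmod (LINT x|lborel. u x y))\<^sup>2)
      = (LINT y|lborel. complex_of_real (w y * (cmod (LINT x|lborel. u x y))\<^sup>2))"
    by (rule integral_complex_of_real[symmetric])
  also have "\<dots> = (LINT y|lborel. LINT p|lborel. v p y)"
    by (simp only: sq[symmetric] lborel_prod)
  also have "\<dots> = (LINT p|lborel. LINT y|lborel. v p y)"
    using lborel_pair.Fubini_integral[OF vint] by simp
  finally have eq: "of_real (LINT y|lborel. w y * (cmod (LINT x|lborel. u x y))\<^sup>2)
      = (LINT p|lborel. LINT y|lborel. v p y)" .
  have "(LINT y|lborel. w y * (cmod (LINT x|lborel. u x y))\<^sup>2)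
     \<le> norm (LINT p|lborel. LINT y|lborel. v p y)"
    unfolding eq[symmetric] by simp
  also have "\<dots> \<le> (LINT p|lborel. case_prod k p)"
  proof (rule Bochner_Integration.integral_norm_bound_integral)
    show "integrable lborel (\<lambda>p. LINT y|lborel. v p y)"
      using lborel_pair.integrable_fst'[OF vint] by simp
    show "integrable lborel (case_prod k)" using k by (simp add: lborel_prod)
    show "norm (LINT y|lborel. v p y) \<le> case_prod k p" for p
      using le[of "fst p" "snd p"] by (simp add: v_def case_prod_beta)
  qed
  also have "\<dots> = (LINT x|lborel. LINT x'|lborel. k x x')"
    using lborel_pair.integral_fst'[OF k] by (simp add: lborel_prod)
  finally show ?thesis .
qed

section \<open>The kernel of a spherical cap\<close>

definition perp :: "'a::euclidean_space \<Rightarrow> 'a \<Rightarrow> 'a" where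
  "perp \<tau> x = x - (x \<bullet> \<tau>) *\<^sub>R \<tau>"

text \<open>The weight is a polynomial along every line orthogonal to \<open>\<tau>\<close>, between two zeros of order \<open>2 n\<close>;
  this is what the contour shift needs, and a smooth bump function would not do.\<close>
definition cap_weight :: "nat \<Rightarrow> 'a::euclidean_space \<Rightarrow> 'a \<Rightarrow> real" where
  "cap_weight n \<tau> y = (if 1/2 \<le> y \<bullet> \<tau> \<and> y \<bullet> \<tau> \<le> 1 then (max 0 ((1/1000)\<^sup>2 - (norm (perp \<tau> y))\<^sup>2)) ^ (2 * n) else 0)"

text \<open>A rational weight with two uses. It is what the zeros of order \<open>2 * n\<close> of
  \<open>cap_weight\<close> yield after the contour shift, and its gradient is at most
  \<open>n * R\<close> times itself, so that it can serve as a test function in the mass bounds. The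
  later choice \<open>n = DIM('a) + 1\<close> makes it integrable.\<close>

definition decay :: "nat \<Rightarrow> real \<Rightarrow> 'a::euclidean_space \<Rightarrow> real" where
  "decay n R z = 1 / (1 + (R * norm z)\<^sup>2) ^ n"

lemma norm_perp_Pythagoras:
  assumes "norm \<tau> = 1"
  shows "(norm x)\<^sup>2 = (x \<bullet> \<tau>)\<^sup>2 + (norm (perp \<tau> x))\<^sup>2" "perp \<tau> x \<bullet> \<tau> = 0"
proof -
  have t: "\<tau> \<bullet> \<tau> = 1" using assms by (simp add: norm_eq_1)
  show "perp \<tau> x \<bullet> \<tau> = 0" by (simp add: perp_def inner_diff_left t)
  show "(norm x)\<^sup>2 = (x \<bullet> \<tau>)\<^sup>2 + (norm (perp \<tau> x))\<^sup>2"
    unfolding power2_norm_eq_inner perp_def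
    by (simp add: inner_diff_left inner_diff_right t inner_commute power2_eq_square algebra_simps)
qed

lemma perp_measurable [measurable]: "perp \<tau> \<in> borel_measurable borel"
  unfolding perp_def by measurable

lemma cap_weight_measurable [measurable]: "cap_weight n \<tau> \<in> borel_measurable borel"
  unfolding cap_weight_def by measurable

lemma cap_weight_bounds: "0 \<le> cap_weight n \<tau> y" "cap_weight n \<tau> y \<le> 1"
proof -
  have "(1/1000)\<^sup>2 \<le> (1::real)" by (simp add: power2_eq_square)
  then have "max 0 ((1/1000)\<^sup>2 - (norm (perp \<tau> y))\<^sup>2) \<le> (1::real)"
    using zero_le_power2[of "norm (perp \<tau> y)"] by linarith
  then show "0 \<le> cap_weight n \<tau> y" "cap_weight n \<tau> y \<le> 1"
    by (auto simp: cap_weight_def intro!: power_le_one)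
qed

lemma cap_weight_support:
  assumes \<tau>: "norm \<tau> = 1" and n: "0 < n" and y: "cap_weight n \<tau> y \<noteq> 0"
  shows "1/2 \<le> y \<bullet> \<tau>" "y \<bullet> \<tau> \<le> 1" "norm (perp \<tau> y) < 1/1000" "norm y \<le> 2"
proof -
  have *: "1/2 \<le> y \<bullet> \<tau> \<and> y \<bullet> \<tau> \<le> 1"
    using y by (auto simp: cap_weight_def split: if_splits)
  have "(norm (perp \<tau> y))\<^sup>2 < (1/1000)\<^sup>2"
  proof (rule ccontr)
    assume "\<not> ?thesis"
    then have "max 0 ((1/1000)\<^sup>2 - (norm (perp \<tau> y))\<^sup>2) = 0" by linarith
    then show False using y n unfolding cap_weight_def by (simp split: if_splits)
  qed
  then show p: "norm (perp \<tau> y) < 1/1000" by (rule power2_less_imp_less) simp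
  show "1/2 \<le> y \<bullet> \<tau>" "y \<bullet> \<tau> \<le> 1" using * by auto
  have "y = (y \<bullet> \<tau>) *\<^sub>R \<tau> + perp \<tau> y" by (simp add: perp_def)
  then have "norm y \<le> norm ((y \<bullet> \<tau>) *\<^sub>R \<tau>) + norm (perp \<tau> y)" by (metis norm_triangle_ineq)
  then show "norm y \<le> 2" using p * \<tau> by simp
qed

lemma decay_bounds: "0 < decay n R z" "decay n R z \<le> 1"
proof -
  have *: "1 \<le> (1 + (R * norm z)\<^sup>2) ^ n" by (rule one_le_power) simp
  then show "0 < decay n R z" by (simp add: decay_def add_pos_nonneg)
  show "decay n R z \<le> 1" using * by (simp add: decay_def divide_le_eq)
qed

lemma decay_measurable [measurable]: "decay n R \<in> borel_measurable borel"
  unfolding decay_def by measurable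

text \<open>For \<open>e\<close> a unit vector orthogonal to \<open>p\<close> and
  \<open>\<rho>2 = (norm p)\<^sup>2\<close>, the number \<open>w\<close> continues
  \<open>(norm (p + s *\<^sub>R e))\<^sup>2\<close> to complex \<open>s\<close>. For
  \<open>cmod s < 1/500\<close> it stays so close to the positive axis that \<open>csqrt\<close> is
  holomorphic there and \<open>1 / csqrt w\<close> is nearly real. The half-angle formula for
  \<open>Re (csqrt w)\<close> gives the numbers, which are not sharp.\<close>

lemma Re_inverse_csqrt_ge:
  fixes s :: complex and \<rho>2 :: real
  assumes s: "cmod s < 1/500" and r: "1/4 \<le> \<rho>2" "\<rho>2 \<le> 1 + 1/1000"
  defines "w \<equiv> of_real \<rho>2 + s\<^sup>2"
  shows "0 < Re w" "9/10 \<le> Re (1 / csqrt w)" "12/100 \<le> cmod (csqrt w) ^ 3"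
proof -
  have "(cmod s)\<^sup>2 \<le> (1/500)\<^sup>2" using s by (intro power_mono) auto
  also have "(1/500)\<^sup>2 = (1/250000 :: real)" by (simp add: power2_eq_square)
  finally have s2: "cmod (s\<^sup>2) \<le> 1/250000" by (simp add: norm_power)
  have re: "\<rho>2 - 1/250000 \<le> Re w" "\<bar>Im w\<bar> \<le> 1/250000"
    using s2 abs_Re_le_cmod[of "s\<^sup>2"] abs_Im_le_cmod[of "s\<^sup>2"] unfolding w_def by auto
  show "0 < Re w" using re r by linarith
  have W1: "cmod w \<le> 101/100"
    unfolding w_def using norm_triangle_ineq[of "of_real \<rho>2" "s\<^sup>2"] s2 r by simp
  have W2: "cmod w \<le> Re w + 1/250000" using cmod_le[of w] re r by simp
  have W3: "24999/100000 \<le> cmod w" using abs_Re_le_cmod[of w] re r by simp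
  define x where "x = Re (csqrt w)"
  have x0: "0 \<le> x" unfolding x_def by (rule Re_csqrt)
  have "x\<^sup>2 = (cmod w + Re w) / 2"
    unfolding x_def using abs_Re_le_cmod[of w] by (simp add: abs_le_iff)
  then have x2: "99/100 * cmod w \<le> x\<^sup>2" using W2 W3 by simp
  have "(9/10 * cmod w)\<^sup>2 \<le> 81/100 * (101/100 * cmod w)"
  proof -
    have "cmod w * cmod w \<le> 101/100 * cmod w" by (intro mult_right_mono W1) simp
    then show ?thesis by (simp add: power2_eq_square)
  qed
  also have "\<dots> \<le> x\<^sup>2" using x2 norm_ge_zero[of w] by linarith
  finally have "9/10 * cmod w \<le> x" using x0 by (rule power2_le_imp_le)
  moreover have n2: "(cmod (csqrt w))\<^sup>2 = cmod w" by (metis norm_power power2_csqrt)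
  moreover have "Re (1 / u) = Re u / (cmod u)\<^sup>2" for u
    by (simp add: Re_divide cmod_power2)
  then have "Re (1 / csqrt w) = x / (cmod (csqrt w))\<^sup>2" unfolding x_def .
  moreover have "0 < cmod w" using W3 by linarith
  ultimately show "9/10 \<le> Re (1 / csqrt w)" by (simp add: pos_le_divide_eq)
  have c: "49/100 \<le> cmod (csqrt w)"
    by (rule power2_le_imp_le) (use W3 n2 in \<open>simp_all add: power2_eq_square\<close>)
  have "12/100 \<le> (24999/100000) * (49/100::real)" by simp
  also have "\<dots> \<le> cmod w * cmod (csqrt w)" using W3 c by (intro mult_mono) auto
  also have "\<dots> = cmod (csqrt w) ^ 3" unfolding n2[symmetric] by (simp add: power2_eq_square power3_eq_cube)
  finally show "12/100 \<le> cmod (csqrt w) ^ 3" .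
qed

text \<open>Amplitudes that continue holomorphically along the lines orthogonal to \<open>\<tau>\<close> near the cap, so that
  the contour can be shifted.\<close>
definition line_amplitude :: "'a::euclidean_space \<Rightarrow> real \<Rightarrow> ('a \<Rightarrow> complex) \<Rightarrow> bool" where
  "line_amplitude \<tau> Q A \<longleftrightarrow> (\<forall>e p. norm e = 1 \<longrightarrow> e \<bullet> \<tau> = 0 \<longrightarrow> p \<bullet> e = 0 \<longrightarrow> 1/2 \<le> p \<bullet> \<tau> \<longrightarrow> p \<bullet> \<tau> \<le> 1 \<longrightarrow>
     norm (perp \<tau> p) < 1/1000 \<longrightarrow>
     (\<exists>q. q holomorphic_on ball 0 (1/500) \<and> (\<forall>s. \<bar>s\<bar> < 1/500 \<longrightarrow> q (of_real s) = A (p + s *\<^sub>R e)) \<and>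
        (\<forall>s\<in>ball 0 (1/500). cmod (q s) \<le> Q)))"

text \<open>Along the line the phase is
  \<open>R * (b * s + \<kappa>) / sqrt ((norm p)\<^sup>2 + s\<^sup>2)\<close> with
  \<open>\<kappa> = (z \<bullet> \<tau>) * (p \<bullet> \<tau>)\<close>. Its derivative has a main
  term of size \<open>R * b\<close> and a correction with the small factor \<open>s\<close>, so its
  real part stays above \<open>R * b / 2\<close> and \<open>oscillatory_integral_bound\<close>
  applies. The radius 1/500 is twice the largest half chord of the cap.\<close>

lemma line_integral_bound:
  fixes \<tau> e p z :: "'a::euclidean_space"
  assumes A: "line_amplitude \<tau> Q A" and n: "0 < n" and \<tau>: "norm \<tau> = 1" and R: "0 < R"
    and e: "norm e = 1" "e \<bullet> \<tau> = 0" and z: "z = (z \<bullet> \<tau>) *\<^sub>R \<tau> + b *\<^sub>R e" "1 \<le> R * b" "\<bar>z \<bullet> \<tau>\<bar> \<le> 9 * b"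
    and p: "p \<bullet> e = 0" and Q: "0 \<le> Q"
  shows "cmod (LINT s|lborel. of_real (cap_weight n \<tau> (p + s *\<^sub>R e)) * A (p + s *\<^sub>R e)
            * exp (- \<i> * of_real (R * (z \<bullet> sgn (p + s *\<^sub>R e)))))
         \<le> 2 * (Q * (2 ^ (2*n) * fact (2*n) / (R * b / 2) ^ (2*n)))" (is "cmod (LINT s|lborel. ?h s) \<le> ?B")
proof (cases "1/2 \<le> p \<bullet> \<tau> \<and> p \<bullet> \<tau> \<le> 1 \<and> norm (perp \<tau> p) < 1/1000")
  case False
  have b: "0 < b" using z R by (metis less_le_trans mult_less_cancel_left_pos mult_zero_right zero_less_one zero_less_mult_pos)
  have "cap_weight n \<tau> (p + s *\<^sub>R e) = 0" for s
  proof (rule ccontr)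
    assume "cap_weight n \<tau> (p + s *\<^sub>R e) \<noteq> 0"
    note sp = cap_weight_support[OF \<tau> n this]
    have pt: "(p + s *\<^sub>R e) \<bullet> \<tau> = p \<bullet> \<tau>" using e by (simp add: inner_add_left)
    have pp: "perp \<tau> (p + s *\<^sub>R e) = perp \<tau> p + s *\<^sub>R e" using e by (simp add: perp_def inner_add_left)
    have "\<tau> \<bullet> e = 0" using e by (simp add: inner_commute)
    then have "perp \<tau> p \<bullet> e = 0" using p by (simp add: perp_def inner_diff_left)
    then have "(norm (perp \<tau> p + s *\<^sub>R e))\<^sup>2 = (norm (perp \<tau> p))\<^sup>2 + s\<^sup>2"
      using e by (subst norm_add_Pythagorean) (simp_all add: orthogonal_def)
    then have "(norm (perp \<tau> p))\<^sup>2 \<le> (norm (perp \<tau> (p + s *\<^sub>R e)))\<^sup>2" unfolding pp by simp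
    then have "norm (perp \<tau> p) \<le> norm (perp \<tau> (p + s *\<^sub>R e))" by (rule power2_le_imp_le) simp
    then show False using sp False unfolding pt by auto
  qed
  then show ?thesis using Q R b by simp
next
  case True
  have b: "0 < b" using z R by (metis less_le_trans mult_less_cancel_left_pos mult_zero_right zero_less_one zero_less_mult_pos)
  obtain q where q: "q holomorphic_on ball 0 (1/500)" "\<And>s. \<bar>s\<bar> < 1/500 \<Longrightarrow> q (of_real s) = A (p + s *\<^sub>R e)"
    "\<And>s. s \<in> ball 0 (1/500) \<Longrightarrow> cmod (q s) \<le> Q"
    using A True e p unfolding line_amplitude_def by blast
  have pt: "(p + s *\<^sub>R e) \<bullet> \<tau> = p \<bullet> \<tau>" for s using e by (simp add: inner_add_left)
  have pp: "perp \<tau> (p + s *\<^sub>R e) = perp \<tau> p + s *\<^sub>R e" for s using e by (simp add: perp_def inner_add_left)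
  have "\<tau> \<bullet> e = 0" using e by (simp add: inner_commute)
  then have pe: "perp \<tau> p \<bullet> e = 0" using p by (simp add: perp_def inner_diff_left)
  have Pyt: "(norm (perp \<tau> (p + s *\<^sub>R e)))\<^sup>2 = (norm (perp \<tau> p))\<^sup>2 + s\<^sup>2" for s
    unfolding pp using pe e by (subst norm_add_Pythagorean) (simp_all add: orthogonal_def)
  have np: "(norm (p + s *\<^sub>R e))\<^sup>2 = (norm p)\<^sup>2 + s\<^sup>2" for s
    using p e by (subst norm_add_Pythagorean) (simp_all add: orthogonal_def)
  \<comment> \<open>Half the length of the chord that the line cuts from the cap. On it the weight
    is exactly \<open>(r\<^sup>2 - s\<^sup>2) ^ (2 * n)\<close>.\<close>
  define r where "r = sqrt ((1/1000)\<^sup>2 - (norm (perp \<tau> p))\<^sup>2)"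
  have lt: "(norm (perp \<tau> p))\<^sup>2 < (1/1000)\<^sup>2" using True by (intro power_strict_mono) auto
  have r2: "r\<^sup>2 = (1/1000)\<^sup>2 - (norm (perp \<tau> p))\<^sup>2" unfolding r_def by (rule real_sqrt_pow2) (use lt in linarith)
  have r0: "0 < r" unfolding r_def using lt by simp
  have "r\<^sup>2 \<le> (1/1000)\<^sup>2" unfolding r2 by simp
  then have r1: "r \<le> 1/1000" by (rule power2_le_imp_le) simp
  define \<rho>2 where "\<rho>2 = (norm p)\<^sup>2"
  have sq: "(1/2)\<^sup>2 = (1/4 :: real)" "(1/1000)\<^sup>2 = (1/1000000 :: real)" by (simp_all add: power2_eq_square)
  have "(1/2)\<^sup>2 \<le> (p \<bullet> \<tau>)\<^sup>2" "(p \<bullet> \<tau>)\<^sup>2 \<le> 1\<^sup>2" using True by (intro power_mono; simp)+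
  then have \<rho>: "1/4 \<le> \<rho>2" "\<rho>2 \<le> 1 + 1/1000"
    using norm_perp_Pythagoras(1)[OF \<tau>, of p] lt zero_le_power2[of "norm (perp \<tau> p)"]
    unfolding \<rho>2_def power_one sq by linarith+
  define \<kappa> where "\<kappa> = (z \<bullet> \<tau>) * (p \<bullet> \<tau>)"
  have \<kappa>: "\<bar>\<kappa>\<bar> \<le> 9 * b"
  proof -
    have "\<bar>\<kappa>\<bar> \<le> (9 * b) * 1" unfolding \<kappa>_def abs_mult using True z b by (intro mult_mono) auto
    then show ?thesis by simp
  qed
  define f where "f s = of_real R * ((of_real b * s + of_real \<kappa>) / csqrt (of_real \<rho>2 + s\<^sup>2))" for s
  have fd: "(f has_field_derivative of_real R * (of_real b * (1 / csqrt (of_real \<rho>2 + s\<^sup>2))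
       - (of_real b * s + of_real \<kappa>) * s / csqrt (of_real \<rho>2 + s\<^sup>2) ^ 3)) (at s)" if "s \<in> ball 0 (1/500)" for s
  proof -
    have w: "0 < Re (of_real \<rho>2 + s\<^sup>2)" "12/100 \<le> cmod (csqrt (of_real \<rho>2 + s\<^sup>2)) ^ 3"
      using Re_inverse_csqrt_ge[of s \<rho>2] that \<rho> by auto
    have nz: "csqrt (of_real \<rho>2 + s\<^sup>2) \<noteq> 0" using w by auto
    have nn: "of_real \<rho>2 + s\<^sup>2 \<notin> \<real>\<^sub>\<le>\<^sub>0" using w(1) by (auto simp: complex_nonpos_Reals_iff)
    show ?thesis unfolding f_def
      by (rule derivative_eq_intros refl nn nz)+ (use nz in \<open>simp add: field_simps power2_eq_square power3_eq_cube\<close>)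
  qed
  have fh: "f holomorphic_on ball 0 (1/500)"
    unfolding holomorphic_on_open[OF open_ball] using fd by blast
  \<comment> \<open>The main term contributes at least \<open>9/10 * b\<close>, the correction at
    most \<open>10 * b * (1/500) / (12/100) \<le> b / 5\<close>. The bound on
    \<open>\<kappa>\<close> needed here is where near alignment of \<open>z\<close> with
    \<open>\<tau>\<close> is excluded.\<close>
  have der: "R * b / 2 \<le> Re (deriv f s)" if s: "s \<in> ball 0 (1/500)" for s
  proof -
    define c where "c = csqrt (of_real \<rho>2 + s\<^sup>2)"
    have c: "9/10 \<le> Re (1 / c)" "12/100 \<le> cmod c ^ 3"
      using Re_inverse_csqrt_ge[of s \<rho>2] that \<rho> unfolding c_def by auto
    have "cmod (of_real b * s + of_real \<kappa>) \<le> cmod (of_real b * s) + cmod (of_real \<kappa>)" by (rule norm_triangle_ineq)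
    also have "\<dots> \<le> b * (1/500) + 9 * b" using \<kappa> s b by (intro add_mono) (auto simp: norm_mult intro!: mult_left_mono)
    finally have num: "cmod (of_real b * s + of_real \<kappa>) \<le> 10 * b" using b by simp
    have "cmod ((of_real b * s + of_real \<kappa>) * s / c ^ 3) = cmod (of_real b * s + of_real \<kappa>) * cmod s / cmod c ^ 3"
      by (simp add: norm_mult norm_divide norm_power)
    also have "\<dots> \<le> (10 * b) * (1/500) / (12/100)"
      using num s c b by (intro frac_le mult_mono) auto
    finally have t2: "cmod ((of_real b * s + of_real \<kappa>) * s / c ^ 3) \<le> b / 5" using b by simp
    have "Re (of_real b * u) = b * Re u" for u by simp
    then have "Re (of_real b * (1/c)) = b * Re (1/c)" .
    moreover have "b * (9/10) \<le> b * Re (1/c)" using c b by (intro mult_left_mono) auto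
    ultimately have "b / 2 \<le> Re (of_real b * (1/c) - (of_real b * s + of_real \<kappa>) * s / c ^ 3)"
      using t2 complex_Re_le_cmod[of "(of_real b * s + of_real \<kappa>) * s / c ^ 3"] b by (simp only: minus_complex.sel)
    then have "R * (b / 2) \<le> R * Re (of_real b * (1/c) - (of_real b * s + of_real \<kappa>) * s / c ^ 3)"
      using R by (intro mult_left_mono) auto
    also have "\<dots> = Re (deriv f s)" unfolding DERIV_imp_deriv[OF fd[OF s]] c_def by (simp only: Re_complex_of_real times_complex.sel Im_complex_of_real)
    finally show ?thesis by simp
  qed
  have fr: "f (of_real s) = of_real (R * (z \<bullet> sgn (p + s *\<^sub>R e)))" for s
  proof -
    have "csqrt (of_real \<rho>2 + (of_real s)\<^sup>2) = csqrt (of_real ((norm (p + s *\<^sub>R e))\<^sup>2))"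
      unfolding np \<rho>2_def by simp
    also have "\<dots> = of_real (norm (p + s *\<^sub>R e))" by (subst csqrt_of_real_nonneg) auto
    finally have c: "csqrt (of_real \<rho>2 + (of_real s)\<^sup>2) = of_real (norm (p + s *\<^sub>R e))" .
    have "z \<bullet> (p + s *\<^sub>R e) = b * s + \<kappa>"
      using e p by (subst z(1)) (simp add: inner_add_left inner_add_right \<kappa>_def inner_commute norm_eq_1)
    then have "z \<bullet> sgn (p + s *\<^sub>R e) = (b * s + \<kappa>) / norm (p + s *\<^sub>R e)"
      by (simp add: sgn_div_norm divide_inverse mult.commute)
    then show ?thesis unfolding f_def c by simp
  qed
  have h: "?h s = indicator {-r..r} s *\<^sub>R (of_real ((r\<^sup>2 - s\<^sup>2) ^ (2*n)) * q (of_real s) * exp (- \<i> * f (of_real s)))" for s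
  proof (cases "\<bar>s\<bar> \<le> r")
    case T: True
    have "s\<^sup>2 \<le> r\<^sup>2" using T by (metis abs_le_square_iff abs_of_pos r0)
    then have "cap_weight n \<tau> (p + s *\<^sub>R e) = (r\<^sup>2 - s\<^sup>2) ^ (2*n)"
      unfolding cap_weight_def pt Pyt using True by (simp add: r2 max_def diff_diff_eq)
    moreover have "q (of_real s) = A (p + s *\<^sub>R e)" using q(2)[of s] T r1 by linarith
    ultimately show ?thesis using T by (simp add: fr abs_le_iff minus_le_iff)
  next
    case F: False
    have "r\<^sup>2 \<le> s\<^sup>2" using F r0 by (metis abs_le_square_iff abs_of_pos linear)
    then have "cap_weight n \<tau> (p + s *\<^sub>R e) = 0"
      unfolding cap_weight_def pt Pyt using n r2 by (simp add: max_def)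
    then show ?thesis using F by (auto simp: indicator_def)
  qed
  have sub: "of_real ` {-r..r} \<subseteq> ball (0::complex) (1/500)" using r1 by auto
  have cont: "continuous_on {-r..r} (\<lambda>s. of_real ((r\<^sup>2 - s\<^sup>2) ^ (2*n)) * q (of_real s) * exp (- \<i> * f (of_real s)))"
  proof -
    have "continuous_on {-r..r} (\<lambda>s. q (of_real s))" "continuous_on {-r..r} (\<lambda>s. f (of_real s))"
      using holomorphic_on_imp_continuous_on[OF q(1)] holomorphic_on_imp_continuous_on[OF fh] sub
      by (auto intro!: continuous_on_compose2[of "ball 0 (1/500)" _ "{-r..r}" of_real] continuous_intros)
    then show ?thesis by (intro continuous_intros)
  qed
  have "(LINT s|lborel. ?h s) = integral {-r..r} (\<lambda>s. of_real ((r\<^sup>2 - s\<^sup>2) ^ (2*n)) * q (of_real s) * exp (- \<i> * f (of_real s)))"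
    using set_borel_integral_eq_integral(2)[OF borel_integrable_atLeastAtMost'[OF cont]]
    unfolding h set_lebesgue_integral_def by simp
  also have "cmod \<dots> \<le> ?B"
    by (rule oscillatory_integral_bound[OF fh q(1) _ der q(3)]) (use r0 r1 fr b R in auto)
  finally show ?thesis .
qed

text \<open>The phase is stationary only where \<open>y\<close> is parallel to \<open>z\<close>; the
  assumption on \<open>z\<close> keeps it away from the direction \<open>\<tau>\<close> up to an
  error 1/R. With \<open>b = norm (perp \<tau> z)\<close> this gives
  \<open>R * norm z \<le> 9 * (R * b) + 1\<close>. For \<open>R * b < 1\<close> the trivial bound is
  good enough; otherwise the lines in direction \<open>perp \<tau> z\<close> yield the power
  \<open>2 * n\<close> of \<open>1 / (R * b)\<close>, which is comparable to
  \<open>decay\<close>.\<close>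

lemma cap_kernel_bound:
  fixes \<tau> z :: "'a::euclidean_space"
  assumes A: "line_amplitude \<tau> Q A" and n: "0 < n" and \<tau>: "norm \<tau> = 1" and R: "0 < R"
    and [measurable]: "A \<in> borel_measurable borel"
    and AQ: "\<And>y. cap_weight n \<tau> y \<noteq> 0 \<Longrightarrow> cmod (A y) \<le> Q"
    and z: "\<bar>z \<bullet> \<tau>\<bar> \<le> 8 * norm (perp \<tau> z) + 1 / R" and Q: "0 \<le> Q"
  shows "cmod (LINT y|lborel. of_real (cap_weight n \<tau> y) * A y * exp (- \<i> * of_real (R * (z \<bullet> sgn y))))
     \<le> (measure lborel (cball (0::'a) 3) * (101 ^ n + 2 * fact (2*n) * 3200 ^ n)) * Q * decay n R z"
    (is "cmod (LINT y|lborel. ?h y) \<le> (?V * (_ + ?F)) * Q * _")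
proof -
  have [measurable]: "sgn \<in> borel_measurable (borel :: 'a measure)" unfolding sgn_div_norm by measurable
  have hm: "?h \<in> borel_measurable borel" by measurable
  have hb: "cmod (?h y) \<le> Q" for y
  proof (cases "cap_weight n \<tau> y = 0")
    case False
    have "cmod (?h y) = cap_weight n \<tau> y * cmod (A y)"
      using cap_weight_bounds[of n \<tau> y] by (simp add: norm_mult)
    also have "\<dots> \<le> 1 * Q"
      using AQ[OF False] cap_weight_bounds[of n \<tau> y] Q by (intro mult_mono) auto
    finally show ?thesis by simp
  qed (simp add: Q)
  have hs: "?h y = 0" if "2 < norm y" for y
    using cap_weight_support(4)[OF \<tau> n, of y] that by force
  have V: "0 \<le> ?V" by simp
  define b where "b = norm (perp \<tau> z)"
  have b0: "0 \<le> b" by (simp add: b_def)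
  have nz: "norm z \<le> \<bar>z \<bullet> \<tau>\<bar> + b"
  proof -
    have "z = (z \<bullet> \<tau>) *\<^sub>R \<tau> + perp \<tau> z" by (simp add: perp_def)
    then have "norm z \<le> norm ((z \<bullet> \<tau>) *\<^sub>R \<tau>) + norm (perp \<tau> z)" by (metis norm_triangle_ineq)
    then show ?thesis using \<tau> by (simp add: b_def)
  qed
  have Rz: "R * norm z \<le> 9 * (R * b) + 1"
  proof -
    have "R * norm z \<le> R * (9 * b + 1 / R)" using nz z R unfolding b_def[symmetric] by (intro mult_left_mono) auto
    then show ?thesis using R by (simp add: algebra_simps)
  qed
  show ?thesis
  proof (cases "1 \<le> R * b")
    case False
    \<comment> \<open>Here \<open>R * norm z \<le> 10\<close>, whence 101 = 1 + 100.\<close>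
    then have "(R * norm z)\<^sup>2 \<le> 10\<^sup>2" using Rz R by (intro power_mono) auto
    then have "(1 + (R * norm z)\<^sup>2) ^ n \<le> 101 ^ n" by (intro power_mono) auto
    then have d: "1 \<le> 101 ^ n * decay n R z"
      by (simp add: decay_def divide_simps add_pos_nonneg)
    have "cmod (LINT y|lborel. ?h y) \<le> (LINT y|lborel. Q * indicator (cball (0::'a) 3) y)"
    proof (rule Bochner_Integration.integral_norm_bound_integral)
      show "integrable lborel ?h" using hm hb hs by (rule integrable_bounded_support)
      have "(\<lambda>x. Q * indicator (cball (0::'a) 3) x) \<in> borel_measurable borel"
        by (intro borel_measurable_times borel_measurable_const borel_measurable_indicator) simp
      then show "integrable lborel (\<lambda>x. Q * indicator (cball (0::'a) 3) x)"
        by (rule integrable_bounded_support[where C = Q and L = 3]) (auto simp: Q split: split_indicator)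
      show "cmod (?h y) \<le> Q * indicator (cball 0 3) y" for y
        using hb[of y] hs[of y] by (cases "2 < norm y") (auto split: split_indicator)
    qed
    also have "\<dots> = ?V * 1 * Q" by simp
    also have "\<dots> \<le> ?V * ((101 ^ n + ?F) * decay n R z) * Q"
    proof -
      have "1 \<le> (101 ^ n + ?F) * decay n R z" using d decay_bounds[of n R z] by (simp add: distrib_right add_increasing2)
      then show ?thesis by (intro mult_right_mono mult_left_mono) (auto simp: Q)
    qed
    finally show ?thesis by (simp add: mult_ac)
  next
    case True
    then have b: "0 < b" using b0 R by (cases "b = 0") auto
    define e where "e = (1/b) *\<^sub>R perp \<tau> z"
    have e: "norm e = 1" "e \<bullet> \<tau> = 0" using b norm_perp_Pythagoras(2)[OF \<tau>, of z] by (simp_all add: e_def b_def)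
    have ze: "z = (z \<bullet> \<tau>) *\<^sub>R \<tau> + b *\<^sub>R e" using b by (simp add: e_def perp_def)
    have pd: "x ^ (2*n) / y ^ (2*n) = (x\<^sup>2 / y\<^sup>2) ^ n" for x y :: real by (simp add: power_mult power_divide)
    have "1 / R \<le> b" using True R by (simp add: field_simps)
    then have zb: "\<bar>z \<bullet> \<tau>\<bar> \<le> 9 * b" using z unfolding b_def[symmetric] by linarith
    have "cmod (LINT y|lborel. ?h y) \<le> (2 * (Q * (2 ^ (2*n) * fact (2*n) / (R * b / 2) ^ (2*n)))) * measure lborel (cball (0::'a) (\<bar>2\<bar> + 1))"
      by (rule norm_integral_le_lines[OF hm hb hs e(1)])
         (use line_integral_bound[OF A n \<tau> R e ze True zb _ Q] in auto)
    also have "2 ^ (2*n) * fact (2*n) / (R * b / 2) ^ (2*n) = fact (2*n) * (2 ^ (2*n) / (R * b / 2) ^ (2*n))"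
      by (simp only: times_divide_eq_right mult.commute)
    also have "2 ^ (2*n) / (R * b / 2) ^ (2*n) = (2\<^sup>2 / (R * b / 2)\<^sup>2) ^ n" by (rule pd)
    also have "2\<^sup>2 / (R * b / 2)\<^sup>2 = 16 / (R * b)\<^sup>2" by (simp add: power_divide)
    also have "2 * (Q * (fact (2*n) * (16 / (R * b)\<^sup>2) ^ n)) * measure lborel (cball (0::'a) (\<bar>2\<bar> + 1))
        = ?V * Q * (2 * fact (2*n)) * (16 / (R * b)\<^sup>2) ^ n" by simp
    \<comment> \<open>3200 is 16 * 200, from
      \<open>1 + (R * norm z)\<^sup>2 \<le> 200 * (R * b)\<^sup>2\<close>.\<close>
    also have "\<dots> \<le> ?V * Q * (2 * fact (2*n)) * (3200 / (1 + (R * norm z)\<^sup>2)) ^ n"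
    proof -
      have "R * norm z \<le> 10 * (R * b)" using Rz True by linarith
      then have "(R * norm z)\<^sup>2 \<le> (10 * (R * b))\<^sup>2" using R by (intro power_mono) auto
      moreover have "1 \<le> (R * b)\<^sup>2" using True by (metis one_le_power)
      ultimately have "1 + (R * norm z)\<^sup>2 \<le> 200 * (R * b)\<^sup>2" by (simp add: power_mult_distrib)
      moreover have "0 < 1 + (R * norm z)\<^sup>2" by (simp add: add_pos_nonneg)
      moreover have "0 < (R * b)\<^sup>2" using True by (intro zero_less_power) linarith
      ultimately have "3200 / (200 * (R * b)\<^sup>2) \<le> 3200 / (1 + (R * norm z)\<^sup>2)"
        by (intro divide_left_mono) auto
      moreover have "3200 / (200 * (R * b)\<^sup>2) = 16 / (R * b)\<^sup>2" by simp
      ultimately have "16 / (R * b)\<^sup>2 \<le> 3200 / (1 + (R * norm z)\<^sup>2)" by linarith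
      then show ?thesis by (intro mult_left_mono power_mono) (auto simp: Q)
    qed
    also have "\<dots> = ?V * Q * ?F * decay n R z" by (simp add: decay_def power_divide)
    also have "\<dots> \<le> ?V * Q * (101 ^ n + ?F) * decay n R z"
      using decay_bounds[of n R z] by (intro mult_right_mono mult_left_mono) (auto simp: Q less_imp_le)
    finally show ?thesis by (simp add: mult_ac)
  qed
qed

section \<open>Divergence theorem for compactly supported fields\<close>

text \<open>By translation invariance the difference quotients of \<open>F\<close> integrate to
  zero; they converge to the directional derivative and are dominated, as the derivative is bounded
  and the support compact. The formula for the derivative is asked only on a neighbourhood
  \<open>U\<close> of the support because the fields below involve the unit normal \<open>N\<close>,
  which is singular where \<open>G\<close> vanishes.\<close>

lemma integral_directional_derivative_eq_0:
  fixes F :: "'a::euclidean_space \<Rightarrow> complex"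
  assumes U: "open U" and K: "compact K" "K \<subseteq> U" and zero: "\<And>x. x \<notin> K \<Longrightarrow> F x = 0"
    and der: "\<And>x. x \<in> U \<Longrightarrow> (F has_derivative F' x) (at x)"
    and cont: "continuous_on U (\<lambda>x. F' x v)"
  shows "integrable lborel (\<lambda>x. indicator K x *\<^sub>R F' x v)"
    and "(LINT x|lborel. indicator K x *\<^sub>R F' x v) = 0"
proof -
  define G where "G x = (if x \<in> K then F' x else (\<lambda>_. 0))" for x
  have G: "(F has_derivative G x) (at x)" for x
  proof (cases "x \<in> K")
    case False
    have "((\<lambda>_. 0) has_derivative (\<lambda>_. 0)) (at x)" by (rule has_derivative_const)
    then have "(F has_derivative (\<lambda>_. 0)) (at x)"
      by (rule has_derivative_transform_within_open[where s = "- K"])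
         (use False zero K compact_imp_closed in auto)
    then show ?thesis using False by (simp add: G_def)
  qed (use der K in \<open>auto simp: G_def\<close>)
  have Gv: "G x v = indicator K x *\<^sub>R F' x v" for x by (simp add: G_def)
  have contK: "continuous_on K (\<lambda>x. F' x v)" using cont K continuous_on_subset by blast
  show int: "integrable lborel (\<lambda>x. indicator K x *\<^sub>R F' x v)"
    by (rule borel_integrable_compact[OF K(1) contK])
  have "bounded ((\<lambda>x. F' x v) ` K)" using compact_imp_bounded compact_continuous_image[OF contK K(1)] by blast
  then obtain C where C: "\<And>x. x \<in> K \<Longrightarrow> norm (F' x v) \<le> C" by (auto simp: bounded_iff)
  have C': "norm (G x v) \<le> \<bar>C\<bar>" for x using C[of x] by (auto simp: Gv split: split_indicator)
  obtain L where L: "\<And>x. x \<in> K \<Longrightarrow> norm x \<le> L" using compact_imp_bounded[OF K(1)] by (auto simp: bounded_iff)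
  have contF: "continuous_on UNIV F"
    using G has_derivative_continuous by (blast intro: continuous_at_imp_continuous_on)
  have [measurable]: "F \<in> borel_measurable borel" by (rule borel_measurable_continuous_onI[OF contF])
  have path: "((\<lambda>t. F (x + t *\<^sub>R v)) has_derivative (\<lambda>s. s *\<^sub>R G (x + t *\<^sub>R v) v)) (at t)" for x and t :: real
  proof -
    have "((\<lambda>t. x + t *\<^sub>R v) has_derivative (\<lambda>s. s *\<^sub>R v)) (at t)"
      by (auto intro!: derivative_eq_intros)
    from has_derivative_compose[OF this G]
    have "((\<lambda>t. F (x + t *\<^sub>R v)) has_derivative (\<lambda>s. G (x + t *\<^sub>R v) (s *\<^sub>R v))) (at t)" .
    then show ?thesis using linear_cmul[OF has_derivative_linear[OF G]] by simp
  qed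
  define q where "q n x = real (Suc n) *\<^sub>R (F (x + (1 / real (Suc n)) *\<^sub>R v) - F x)" for n x
  have lim: "(\<lambda>n. q n x) \<longlonglongrightarrow> G x v" for x
  proof -
    have "((\<lambda>t. norm (F (x + t *\<^sub>R v) - F x - t *\<^sub>R G x v) / norm t) \<longlongrightarrow> 0) (at 0)"
      using path[of x 0] by (simp add: has_derivative_at)
    moreover have "filterlim (\<lambda>n. 1 / real (Suc n)) (at 0) sequentially"
      using LIMSEQ_inverse_real_of_nat by (simp add: filterlim_at inverse_eq_divide)
    ultimately have "(\<lambda>n. norm (F (x + (1 / real (Suc n)) *\<^sub>R v) - F x - (1 / real (Suc n)) *\<^sub>R G x v) / norm (1 / real (Suc n))) \<longlonglongrightarrow> 0"
      by (rule filterlim_compose)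
    moreover have "norm (F (x + (1 / real (Suc n)) *\<^sub>R v) - F x - (1 / real (Suc n)) *\<^sub>R G x v) / norm (1 / real (Suc n))
        = norm (q n x - G x v)" for n
    proof -
      have "q n x - G x v = real (Suc n) *\<^sub>R (F (x + (1 / real (Suc n)) *\<^sub>R v) - F x - (1 / real (Suc n)) *\<^sub>R G x v)"
        by (simp add: q_def scaleR_right_diff_distrib)
      then have "norm (q n x - G x v) = norm (real (Suc n)) * norm (F (x + (1 / real (Suc n)) *\<^sub>R v) - F x - (1 / real (Suc n)) *\<^sub>R G x v)"
        by (simp only: norm_scaleR real_norm_def)
      then show ?thesis by (simp add: divide_inverse mult.commute)
    qed
    ultimately have "(\<lambda>n. norm (q n x - G x v)) \<longlonglongrightarrow> 0" by simp
    then show ?thesis by (simp add: tendsto_norm_zero_iff LIM_zero_iff)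
  qed
  have bound: "norm (q n x) \<le> \<bar>C\<bar> * indicator (cball 0 (\<bar>L\<bar> + norm v)) x" for n x
  proof (cases "\<bar>L\<bar> + norm v < norm x")
    case True
    have "norm ((1 / real (Suc n)) *\<^sub>R v) = (1 / real (Suc n)) * norm v" by simp
    also have "\<dots> \<le> 1 * norm v" by (intro mult_right_mono) auto
    finally have "norm ((1 / real (Suc n)) *\<^sub>R v) \<le> norm v" by simp
    then have "L < norm (x + (1 / real (Suc n)) *\<^sub>R v)" 
      using True norm_diff_ineq[of x "(1 / real (Suc n)) *\<^sub>R v"] by linarith
    moreover have "L < norm x" using True norm_ge_zero[of v] by linarith
    ultimately have "x \<notin> K" "x + (1 / real (Suc n)) *\<^sub>R v \<notin> K" using L by fastforce+
    then show ?thesis using zero by (simp add: q_def)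
  next
    case False
    have "norm (F (x + (1 / real (Suc n)) *\<^sub>R v) - F (x + 0 *\<^sub>R v)) \<le> \<bar>C\<bar> * (1 / real (Suc n))"
    proof -
      have "continuous_on {0..1 / real (Suc n)} (\<lambda>t. F (x + t *\<^sub>R v))"
        by (intro continuous_on_compose2[OF contF] continuous_intros) auto
      then obtain t where "norm (F (x + (1 / real (Suc n)) *\<^sub>R v) - F (x + 0 *\<^sub>R v))
          \<le> norm ((1 / real (Suc n) - 0) *\<^sub>R G (x + t *\<^sub>R v) v)"
        using mvt_general[of 0 "1 / real (Suc n)" "\<lambda>t. F (x + t *\<^sub>R v)", OF _ _ path] by auto
      also have "\<dots> \<le> (1 / real (Suc n)) * \<bar>C\<bar>"
        using C'[of "x + t *\<^sub>R v"] by (simp add: divide_right_mono)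
      finally show ?thesis by (simp add: mult.commute)
    qed
    then have "real (Suc n) * norm (F (x + (1 / real (Suc n)) *\<^sub>R v) - F x) \<le> real (Suc n) * (\<bar>C\<bar> * (1 / real (Suc n)))"
      by (intro mult_left_mono) auto
    then have "norm (q n x) \<le> \<bar>C\<bar>" by (simp add: q_def)
    then show ?thesis using False by simp
  qed
  have ci: "integrable lborel (\<lambda>x. \<bar>C\<bar> * indicator (cball (0::'a) (\<bar>L\<bar> + norm v)) x)"
    by (intro integrable_mult_right integrable_real_indicator) (use emeasure_bounded_finite[OF bounded_cball] in auto)
  have "(\<lambda>n. LINT x|lborel. q n x) \<longlonglongrightarrow> (LINT x|lborel. G x v)"
    by (rule integral_dominated_convergence[OF _ _ ci])
       (use lim bound int in \<open>auto simp: q_def Gv[abs_def]\<close>)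
  moreover have "(LINT x|lborel. q n x) = 0" for n
  proof -
    have Fi: "integrable lborel F"
    proof -
      have "F = (\<lambda>x. indicator K x *\<^sub>R F x)" using zero by (auto simp: fun_eq_iff split: split_indicator)
      then show ?thesis using borel_integrable_compact[OF K(1) continuous_on_subset[OF contF subset_UNIV]] by simp
    qed
    have "integrable lborel (\<lambda>x. F (x + (1 / real (Suc n)) *\<^sub>R v))"
    proof -
      have "lborel = distr lborel borel (\<lambda>x. (1 / real (Suc n)) *\<^sub>R v + x)"
        using lborel_affine[of 1 "(1 / real (Suc n)) *\<^sub>R v"] by (simp add: density_1)
      then have "integrable (distr lborel borel (\<lambda>x. (1 / real (Suc n)) *\<^sub>R v + x)) F" using Fi by metis
      then show ?thesis by (subst (asm) integrable_distr_eq) (simp_all add: add.commute)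
    qed
    then show ?thesis unfolding q_def using Fi
      by (simp add: integral_lborel_translation)
  qed
  ultimately have "(LINT x|lborel. G x v) = 0" by (simp add: LIMSEQ_const_iff)
  then show "(LINT x|lborel. indicator K x *\<^sub>R F' x v) = 0" by (simp add: Gv)
qed

lemma linear_sum_Basis:
  fixes f :: "'a::euclidean_space \<Rightarrow> 'b::real_vector"
  assumes "linear f"
  shows "(\<Sum>b\<in>Basis. (u \<bullet> b) *\<^sub>R f b) = f u"
proof -
  have "f u = f (\<Sum>b\<in>Basis. (u \<bullet> b) *\<^sub>R b)" by (simp add: euclidean_representation)
  also have "\<dots> = (\<Sum>b\<in>Basis. (u \<bullet> b) *\<^sub>R f b)"
    using assms by (simp add: linear_sum linear_cmul)
  finally show ?thesis by simp
qed

text \<open>Product rule for \<open>e\<close> times \<open>Y\<close>, one coordinate at a time. The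
  factor \<open>e\<close> is kept apart because it is complex, a plane wave or the constant 1, while
  \<open>Y\<close> is a real field with compact support.\<close>

lemma integral_divergence_eq_0:
  fixes Y :: "'a::euclidean_space \<Rightarrow> 'a" and e :: "'a \<Rightarrow> complex"
  assumes U: "open U" and K: "compact K" "K \<subseteq> U" and zero: "\<And>x. x \<notin> K \<Longrightarrow> Y x = 0"
    and Y: "\<And>x. x \<in> U \<Longrightarrow> (Y has_derivative Y' x) (at x)" "\<And>v. continuous_on U (\<lambda>x. Y' x v)"
    and e: "\<And>x. (e has_derivative e' x) (at x)" "\<And>v. continuous_on UNIV (\<lambda>x. e' x v)"
  shows "(LINT x|lborel. indicator K x *\<^sub>R (e' x (Y x) + e x * of_real (\<Sum>b\<in>Basis. Y' x b \<bullet> b))) = 0"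
proof -
  have contY: "continuous_on U Y"
    using Y(1) has_derivative_continuous by (blast intro: continuous_at_imp_continuous_on)
  have conte: "continuous_on U e"
    using e(1) has_derivative_continuous by (blast intro: continuous_at_imp_continuous_on)
  define F' where "F' b x v = e x * of_real (Y' x v \<bullet> b) + e' x v * of_real (Y x \<bullet> b)" for b x v
  have F': "integrable lborel (\<lambda>x. indicator K x *\<^sub>R F' b x b) \<and> (LINT x|lborel. indicator K x *\<^sub>R F' b x b) = 0" for b
  proof -
    have der: "((\<lambda>x. e x * of_real (Y x \<bullet> b)) has_derivative F' b x) (at x)" if "x \<in> U" for x
      unfolding F'_def
      by (rule derivative_eq_intros e Y(1)[OF that] refl)+ auto
    have cont: "continuous_on U (\<lambda>x. F' b x v)" for v
      unfolding F'_def
      by (intro continuous_intros conte contY Y continuous_on_subset[OF e(2)]) auto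
    show ?thesis
      using integral_directional_derivative_eq_0[OF U K _ der cont] zero by simp
  qed
  have eq: "indicator K x *\<^sub>R (e' x (Y x) + e x * of_real (\<Sum>b\<in>Basis. Y' x b \<bullet> b)) = (\<Sum>b\<in>Basis. indicator K x *\<^sub>R F' b x b)" for x
  proof -
    have "e' x (Y x) = (\<Sum>b\<in>Basis. e' x b * of_real (Y x \<bullet> b))"
      using linear_sum_Basis[OF has_derivative_linear[OF e(1)], of "Y x" x]
      by (simp add: scaleR_conv_of_real mult.commute)
    then show ?thesis
      by (simp add: F'_def sum.distrib sum_distrib_left scaleR_sum_right[symmetric] add.commute)
  qed
  show ?thesis unfolding eq by (subst Bochner_Integration.integral_sum) (use F' in auto)
qed

section \<open>Cutoffs of finite smoothness\<close>

lemma DERIV_max_0_power: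
  assumes "0 < k"
  shows "((\<lambda>s::real. (max 0 s) ^ Suc k) has_real_derivative real (Suc k) * (max 0 s) ^ k) (at s)"
proof -
  consider "s < 0" | "s > 0" | "s = 0" by linarith
  then show ?thesis
  proof cases
    case 1
    have "((\<lambda>s::real. 0) has_real_derivative 0) (at s)" by simp
    then have "((\<lambda>s::real. (max 0 s) ^ Suc k) has_real_derivative 0) (at s)"
      by (rule has_field_derivative_transform_within_open[where S = "{..<0}"]) (use 1 in auto)
    then show ?thesis using 1 assms by (simp add: max_absorb1 zero_power)
  next
    case 2
    have "((\<lambda>s::real. s ^ Suc k) has_real_derivative real (Suc k) * s ^ k) (at s)"
      using DERIV_pow[of "Suc k" s] by simp
    then have "((\<lambda>s::real. (max 0 s) ^ Suc k) has_real_derivative real (Suc k) * s ^ k) (at s)"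
      by (rule has_field_derivative_transform_within_open[where S = "{0<..}"]) (use 2 in \<open>auto simp: max_def\<close>)
    then show ?thesis using 2 by (simp add: max_def)
  next
    case 3
    have "((\<lambda>h::real. (max 0 h) ^ Suc k / h) \<longlongrightarrow> 0) (at 0)"
    proof (rule Lim_null_comparison)
      show "\<forall>\<^sub>F h::real in at 0. norm ((max 0 h) ^ Suc k / h) \<le> \<bar>h\<bar> ^ k"
        by (rule always_eventually) (auto simp: max_def power_abs)
      have "((\<lambda>h::real. \<bar>h\<bar> ^ k) \<longlongrightarrow> \<bar>0\<bar> ^ k) (at 0)" by (intro tendsto_intros)
      then show "((\<lambda>h::real. \<bar>h\<bar> ^ k) \<longlongrightarrow> 0) (at 0)" using assms by (simp add: zero_power)
    qed
    then show ?thesis using 3 assms by (simp add: DERIV_def zero_power)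
  qed
qed

text \<open>The exponents are chosen such that \<open>step\<close> is twice continuously differentiable.\<close>
definition step :: "real \<Rightarrow> real" where
  "step s = (max 0 (1 - (max 0 s) ^ 3)) ^ 3"

text \<open>Minus the derivative of \<open>step\<close>, so that the smoothed body has gradient
  \<open>- bump (S x - 1)\<close> times \<open>G x\<close>, supported in the layer.\<close>

definition bump :: "real \<Rightarrow> real" where
  "bump s = 9 * (max 0 s) ^ 2 * (max 0 (1 - (max 0 s) ^ 3)) ^ 2"

definition bump_deriv :: "real \<Rightarrow> real" where
  "bump_deriv s = 18 * max 0 s * (max 0 (1 - (max 0 s) ^ 3)) ^ 2 - 54 * (max 0 s) ^ 4 * max 0 (1 - (max 0 s) ^ 3)"

lemma DERIV_step: "(step has_real_derivative - bump s) (at s)"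
proof -
  have 1: "((\<lambda>s. (max 0 s) ^ 3) has_real_derivative 3 * (max 0 s) ^ 2) (at s)" for s :: real
    using DERIV_max_0_power[of 2 s] by (simp add: eval_nat_numeral)
  have 2: "((\<lambda>s. 1 - (max 0 s) ^ 3) has_real_derivative - (3 * (max 0 s) ^ 2)) (at s)" for s :: real
    using DERIV_diff[OF DERIV_const 1] by simp
  show ?thesis
    unfolding step_def[abs_def] bump_def using DERIV_chain2[OF 1 2, of s] by (simp add: mult_ac)
qed

lemma DERIV_bump: "(bump has_real_derivative bump_deriv s) (at s)"
proof -
  have 1: "((\<lambda>s. (max 0 s) ^ 3) has_real_derivative 3 * (max 0 s) ^ 2) (at s)" for s :: real
    using DERIV_max_0_power[of 2 s] by (simp add: eval_nat_numeral)
  have 2: "((\<lambda>s. 1 - (max 0 s) ^ 3) has_real_derivative - (3 * (max 0 s) ^ 2)) (at s)" for s :: real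
    using DERIV_diff[OF DERIV_const 1] by simp
  have 3: "((\<lambda>s. (max 0 s) ^ 2) has_real_derivative 2 * max 0 s) (at s)" for s :: real
    using DERIV_max_0_power[of 1 s] by (simp add: eval_nat_numeral)
  have 4: "((\<lambda>s. (max 0 (1 - (max 0 s) ^ 3)) ^ 2) has_real_derivative 2 * max 0 (1 - (max 0 s) ^ 3) * - (3 * (max 0 s) ^ 2)) (at s)"
    by (rule DERIV_chain2[OF 3 2])
  show ?thesis
    unfolding bump_def[abs_def] bump_deriv_def
    by (rule derivative_eq_intros 3 4 refl)+ (simp add: algebra_simps power2_eq_square power4_eq_xxxx)
qed

lemma step_bounds: "0 \<le> step s" "step s \<le> 1" "s \<le> 0 \<Longrightarrow> step s = 1" "1 \<le> s \<Longrightarrow> step s = 0"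
proof -
  show "0 \<le> step s" by (simp add: step_def)
  show "step s \<le> 1" unfolding step_def by (rule power_le_one) auto
  show "step s = 1" if "s \<le> 0" using that by (simp add: step_def max_absorb1)
  show "step s = 0" if "1 \<le> s"
  proof -
    have "1 \<le> s ^ 3" using that by (rule one_le_power)
    then show ?thesis using that by (simp add: step_def max_absorb2 max_absorb1)
  qed
qed

lemma bump_bounds: "0 \<le> bump s" "bump s \<le> 9" "s \<le> 0 \<Longrightarrow> bump s = 0" "1 \<le> s \<Longrightarrow> bump s = 0"
proof -
  show "0 \<le> bump s" by (simp add: bump_def)
  show 0: "bump s = 0" if "s \<le> 0" using that by (simp add: bump_def max_absorb1)
  show 1: "bump s = 0" if "1 \<le> s"
  proof -
    have "1 \<le> s ^ 3" using that by (rule one_le_power)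
    then show ?thesis using that by (simp add: bump_def max_absorb2 max_absorb1)
  qed
  show "bump s \<le> 9"
  proof (cases "0 \<le> s \<and> s \<le> 1")
    case True
    have "(max 0 s)\<^sup>2 * (max 0 (1 - (max 0 s) ^ 3))\<^sup>2 \<le> 1 * 1"
      using True by (intro mult_mono power_le_one) auto
    then show ?thesis by (simp add: bump_def)
  qed (use 0 1 in force)
qed

lemma continuous_on_step [continuous_intros]: "continuous_on A f \<Longrightarrow> continuous_on A (\<lambda>x. step (f x))"
  unfolding step_def by (intro continuous_intros)

lemma continuous_on_bump [continuous_intros]: "continuous_on A f \<Longrightarrow> continuous_on A (\<lambda>x. bump (f x))"
  unfolding bump_def by (intro continuous_intros)

lemma continuous_on_bump_deriv [continuous_intros]: "continuous_on A f \<Longrightarrow> continuous_on A (\<lambda>x. bump_deriv (f x))"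
  unfolding bump_deriv_def by (intro continuous_intros)

text \<open>The identity, cut off between \<open>s\<^sup>2 = 1/50\<close> and
  \<open>s\<^sup>2 = 1/25\<close>. Where \<open>s - slope_cutoff s\<close> is nonzero,
  \<open>\<bar>s\<bar>\<close> exceeds 1/8, which serves the flat part; where
  \<open>slope_cutoff s\<close> is nonzero, \<open>\<bar>s\<bar>\<close> is below 1/5, which keeps
  \<open>\<tau>\<close> close enough to the tangent plane in the steep part.\<close>

definition slope_cutoff :: "real \<Rightarrow> real" where
  "slope_cutoff s = s * step (50 * s\<^sup>2 - 1)"

definition slope_cutoff_deriv :: "real \<Rightarrow> real" where
  "slope_cutoff_deriv s = step (50 * s\<^sup>2 - 1) - 100 * s\<^sup>2 * bump (50 * s\<^sup>2 - 1)"

lemma DERIV_slope_cutoff: "(slope_cutoff has_real_derivative slope_cutoff_deriv s) (at s)"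
proof -
  have "((\<lambda>s. 50 * s\<^sup>2 - 1) has_real_derivative 100 * s) (at s)"
    by (auto intro!: derivative_eq_intros)
  from DERIV_chain2[OF DERIV_step this]
  have "((\<lambda>s. step (50 * s\<^sup>2 - 1)) has_real_derivative - bump (50 * s\<^sup>2 - 1) * (100 * s)) (at s)" .
  then show ?thesis unfolding slope_cutoff_def[abs_def] slope_cutoff_deriv_def
    by (auto intro!: derivative_eq_intros simp: power2_eq_square)
qed

lemma continuous_on_slope_cutoff [continuous_intros]:
  "continuous_on A f \<Longrightarrow> continuous_on A (\<lambda>x. slope_cutoff (f x))"
  unfolding slope_cutoff_def by (intro continuous_intros)

lemma continuous_on_slope_cutoff_deriv [continuous_intros]:
  "continuous_on A f \<Longrightarrow> continuous_on A (\<lambda>x. slope_cutoff_deriv (f x))"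
  unfolding slope_cutoff_deriv_def by (intro continuous_intros)

lemma slope_cutoff_bounds:
  "\<bar>slope_cutoff s\<bar> \<le> \<bar>s\<bar>" "\<bar>s - slope_cutoff s\<bar> \<le> \<bar>s\<bar>" "\<bar>slope_cutoff_deriv s\<bar> \<le> 37"
  "1/25 \<le> s\<^sup>2 \<Longrightarrow> slope_cutoff s = 0" "1/25 \<le> s\<^sup>2 \<Longrightarrow> slope_cutoff_deriv s = 0"
  "s\<^sup>2 \<le> 1/50 \<Longrightarrow> slope_cutoff s = s"
proof -
  let ?b = "step (50 * s\<^sup>2 - 1)"
  have b: "0 \<le> ?b" "?b \<le> 1" using step_bounds by auto
  show "\<bar>slope_cutoff s\<bar> \<le> \<bar>s\<bar>" using b by (simp add: slope_cutoff_def abs_mult mult_left_le)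
  have "s - slope_cutoff s = s * (1 - ?b)" by (simp add: slope_cutoff_def algebra_simps)
  then show "\<bar>s - slope_cutoff s\<bar> \<le> \<bar>s\<bar>" using b by (simp add: abs_mult mult_left_le)
  show z: "slope_cutoff s = 0" "slope_cutoff_deriv s = 0" if "1/25 \<le> s\<^sup>2"
    using that step_bounds(4)[of "50 * s\<^sup>2 - 1"] bump_bounds(4)[of "50 * s\<^sup>2 - 1"]
    by (auto simp: slope_cutoff_def slope_cutoff_deriv_def)
  show "slope_cutoff s = s" if "s\<^sup>2 \<le> 1/50"
    using that step_bounds(3)[of "50 * s\<^sup>2 - 1"] by (simp add: slope_cutoff_def)
  show "\<bar>slope_cutoff_deriv s\<bar> \<le> 37"
  proof (cases "1/25 \<le> s\<^sup>2")
    case False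
    \<comment> \<open>37 is 1 from \<open>step\<close> plus 4 * 9, since
      \<open>s\<^sup>2 < 1/25\<close> and \<open>bump\<close> is at most 9.\<close>
    have "100 * s\<^sup>2 * bump (50 * s\<^sup>2 - 1) \<le> 4 * 9"
      using False bump_bounds[of "50 * s\<^sup>2 - 1"] by (intro mult_mono) auto
    moreover have "0 \<le> 100 * s\<^sup>2 * bump (50 * s\<^sup>2 - 1)" using bump_bounds[of "50 * s\<^sup>2 - 1"] by simp
    ultimately show ?thesis using b unfolding slope_cutoff_deriv_def by linarith
  qed (simp add: z)
qed

section \<open>Convex bodies defined by exponential sums\<close>

text \<open>\<open>G\<close> and \<open>H\<close> are the gradient and the Hessian of \<open>S\<close>, \<open>N\<close> is the unit normal of its level sets, and
  \<open>\<Theta>\<close> is their mean curvature times \<open>norm (G x)\<close>.\<close>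
locale exp_body =
  fixes J :: "'a::euclidean_space set" and \<kappa> :: real
  assumes finJ: "finite J"
begin

definition E :: "'a \<Rightarrow> 'a \<Rightarrow> real" where "E a x = exp (\<kappa> * (a \<bullet> x - 1))"
definition S :: "'a \<Rightarrow> real" where "S x = (\<Sum>a\<in>J. E a x)"
definition G :: "'a \<Rightarrow> 'a" where "G x = (\<Sum>a\<in>J. (\<kappa> * E a x) *\<^sub>R a)"
definition H :: "'a \<Rightarrow> 'a \<Rightarrow> 'a" where "H x v = (\<Sum>a\<in>J. (\<kappa>\<^sup>2 * E a x * (a \<bullet> v)) *\<^sub>R a)"
definition N :: "'a \<Rightarrow> 'a" where "N x = sgn (G x)"
definition dN :: "'a \<Rightarrow> 'a \<Rightarrow> 'a" where
  "dN x v = (1 / norm (G x)) *\<^sub>R (H x v - (N x \<bullet> H x v) *\<^sub>R N x)"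
definition \<Theta> :: "'a \<Rightarrow> real" where
  "\<Theta> x = (\<Sum>a\<in>J. \<kappa>\<^sup>2 * E a x * ((norm a)\<^sup>2 - (a \<bullet> N x)\<^sup>2))"

lemma E_pos: "0 < E a x" by (simp add: E_def)

lemma E_derivative: "(E a has_derivative (\<lambda>v. \<kappa> * E a x * (a \<bullet> v))) (at x)"
  unfolding E_def[abs_def] by (auto intro!: derivative_eq_intros simp: fun_eq_iff)

lemma S_derivative: "(S has_derivative (\<lambda>v. G x \<bullet> v)) (at x)"
  unfolding S_def[abs_def] G_def inner_sum_left inner_scaleR_left
  by (intro has_derivative_sum E_derivative)

lemma G_derivative: "(G has_derivative H x) (at x)"
proof -
  have "((\<lambda>x. (\<kappa> * E a x) *\<^sub>R a) has_derivative (\<lambda>v. (\<kappa>\<^sup>2 * E a x * (a \<bullet> v)) *\<^sub>R a)) (at x)" for a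
    by (rule derivative_eq_intros E_derivative refl)+ (simp add: fun_eq_iff power2_eq_square mult_ac)
  then show ?thesis unfolding G_def[abs_def] H_def[abs_def] by (intro has_derivative_sum)
qed

lemma continuous_on_E [continuous_intros]: "continuous_on A f \<Longrightarrow> continuous_on A (\<lambda>x. E a (f x))"
  unfolding E_def by (intro continuous_intros)

lemma continuous_on_S [continuous_intros]: "continuous_on A f \<Longrightarrow> continuous_on A (\<lambda>x. S (f x))"
  unfolding S_def by (intro continuous_intros)

lemma continuous_on_G [continuous_intros]: "continuous_on A f \<Longrightarrow> continuous_on A (\<lambda>x. G (f x))"
  unfolding G_def by (intro continuous_intros)

lemma continuous_on_H [continuous_intros]:
  "continuous_on A f \<Longrightarrow> continuous_on A g \<Longrightarrow> continuous_on A (\<lambda>x. H (f x) (g x))"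
  unfolding H_def by (intro continuous_intros)

lemma continuous_on_N [continuous_intros]:
  "continuous_on A f \<Longrightarrow> (\<And>x. x \<in> A \<Longrightarrow> G (f x) \<noteq> 0) \<Longrightarrow> continuous_on A (\<lambda>x. N (f x))"
  unfolding N_def sgn_div_norm by (intro continuous_intros) auto

lemma continuous_on_dN [continuous_intros]:
  "continuous_on A f \<Longrightarrow> continuous_on A g \<Longrightarrow> (\<And>x. x \<in> A \<Longrightarrow> G (f x) \<noteq> 0) \<Longrightarrow> continuous_on A (\<lambda>x. dN (f x) (g x))"
  unfolding dN_def by (intro continuous_intros) auto

lemma continuous_on_\<Theta> [continuous_intros]:
  "continuous_on A f \<Longrightarrow> (\<And>x. x \<in> A \<Longrightarrow> G (f x) \<noteq> 0) \<Longrightarrow> continuous_on A (\<lambda>x. \<Theta> (f x))"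
  unfolding \<Theta>_def by (intro continuous_intros) auto

lemma norm_N: "G x \<noteq> 0 \<Longrightarrow> norm (N x) = 1" "norm (N x) \<le> 1" "G x = norm (G x) *\<^sub>R N x"
  by (cases "G x = 0"; simp add: N_def norm_sgn; simp add: sgn_div_norm)+

lemma N_N: "G x \<noteq> 0 \<Longrightarrow> N x \<bullet> N x = 1" using norm_N(1) by (simp add: norm_eq_1)

lemma H_symmetric: "H x u \<bullet> v = H x v \<bullet> u"
  unfolding H_def inner_sum_left by (intro sum.cong refl) (simp add: inner_commute)

lemma norm_G_derivative:
  assumes "G x \<noteq> 0"
  shows "((\<lambda>x. norm (G x)) has_derivative (\<lambda>v. N x \<bullet> H x v)) (at x)"
proof -
  have "(norm has_derivative (\<lambda>h. h \<bullet> sgn (G x))) (at (G x))"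
    using GDERIV_norm[OF assms] by (simp add: gderiv_def)
  from has_derivative_compose[OF G_derivative this] show ?thesis
    by (simp add: N_def inner_commute)
qed

lemma N_derivative:
  assumes "G x \<noteq> 0"
  shows "(N has_derivative dN x) (at x)"
proof -
  have "((\<lambda>x. inverse (norm (G x)) *\<^sub>R G x) has_derivative
     (\<lambda>v. inverse (norm (G x)) *\<^sub>R H x v + (- (inverse (norm (G x)) * (N x \<bullet> H x v) * inverse (norm (G x)))) *\<^sub>R G x)) (at x)"
    by (rule has_derivative_scaleR[OF Deriv.has_derivative_inverse[OF _ norm_G_derivative[OF assms]] G_derivative])
       (use assms in simp)
  then show ?thesis unfolding N_def[abs_def] sgn_div_norm
    by (rule has_derivative_eq_rhs)
       (auto simp: fun_eq_iff dN_def N_def sgn_div_norm scaleR_diff_right divide_inverse)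
qed

lemma linear_H: "linear (H x)" using has_derivative_linear[OF G_derivative] .
lemma trace_rank_one:
  fixes g :: "'a \<Rightarrow> real"
  assumes "linear g"
  shows "(\<Sum>b\<in>Basis. g b * (u \<bullet> b)) = g u"
  using linear_sum_Basis[OF assms, of u] by (simp add: mult.commute)

lemma trace_dN:
  assumes "G x \<noteq> 0"
  shows "(\<Sum>b\<in>Basis. dN x b \<bullet> b) = \<Theta> x / norm (G x)"
proof -
  have l: "linear (\<lambda>v. N x \<bullet> H x v)"
    using linear_compose[OF linear_H, of "\<lambda>w. N x \<bullet> w"] by (simp add: o_def linear_iff inner_add_right)
  have "(\<Sum>b\<in>Basis. H x b \<bullet> b) = (\<Sum>a\<in>J. \<Sum>b\<in>Basis. \<kappa>\<^sup>2 * E a x * ((a \<bullet> b) * (a \<bullet> b)))"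
    unfolding H_def inner_sum_left by (subst sum.swap) (simp add: mult_ac)
  also have "\<dots> = (\<Sum>a\<in>J. \<kappa>\<^sup>2 * E a x * (norm a)\<^sup>2)"
    unfolding sum_distrib_left[symmetric] power2_norm_eq_inner by (simp add: euclidean_inner[symmetric])
  finally have 1: "(\<Sum>b\<in>Basis. H x b \<bullet> b) = (\<Sum>a\<in>J. \<kappa>\<^sup>2 * E a x * (norm a)\<^sup>2)" .
  have "(\<Sum>b\<in>Basis. (N x \<bullet> H x b) * (N x \<bullet> b)) = N x \<bullet> H x (N x)"
    by (rule trace_rank_one[OF l])
  also have "\<dots> = (\<Sum>a\<in>J. \<kappa>\<^sup>2 * E a x * (a \<bullet> N x)\<^sup>2)"
    unfolding H_def inner_sum_right by (simp add: power2_eq_square inner_commute mult_ac)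
  finally show ?thesis using 1
    by (simp add: dN_def inner_diff_left sum_subtractf sum_divide_distrib[symmetric] \<Theta>_def right_diff_distrib diff_divide_distrib)
qed

lemma \<Theta>_nonneg: "0 \<le> \<Theta> x"
proof -
  have "(a \<bullet> N x)\<^sup>2 \<le> (norm a)\<^sup>2" for a
  proof -
    have "\<bar>a \<bullet> N x\<bar> \<le> norm a * norm (N x)" by (rule Cauchy_Schwarz_ineq2)
    also have "\<dots> \<le> norm a" using norm_N(2)[of x] by (simp add: mult_left_le)
    finally show ?thesis by (simp add: abs_le_square_iff[symmetric])
  qed
  then show ?thesis unfolding \<Theta>_def using E_pos by (intro sum_nonneg mult_nonneg_nonneg) (auto simp: less_imp_le)
qed

text \<open>The tangential part of the Hessian is controlled by its trace \<open>\<Theta>\<close>, since the Hessian is a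
  sum of positive rank one maps.\<close>
lemma norm_tangential_Hessian_le:
  assumes x: "G x \<noteq> 0" and T: "T \<bullet> N x = 0" "norm T \<le> 1"
  shows "norm (H x T - (N x \<bullet> H x T) *\<^sub>R N x) \<le> \<Theta> x"
proof -
  define P where "P a = a - (a \<bullet> N x) *\<^sub>R N x" for a
  have nP: "(norm (P a))\<^sup>2 = (norm a)\<^sup>2 - (a \<bullet> N x)\<^sup>2" for a
    unfolding power2_norm_eq_inner P_def using N_N[OF x]
    by (simp add: inner_diff_left inner_diff_right inner_commute power2_eq_square)
  have "H x T - (N x \<bullet> H x T) *\<^sub>R N x = (\<Sum>a\<in>J. (\<kappa>\<^sup>2 * E a x * (a \<bullet> T)) *\<^sub>R P a)"
    unfolding H_def P_def inner_sum_right scaleR_diff_right sum_subtractf scaleR_sum_left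
    by (simp add: inner_commute mult_ac)
  also have "norm \<dots> \<le> (\<Sum>a\<in>J. \<kappa>\<^sup>2 * E a x * ((norm a)\<^sup>2 - (a \<bullet> N x)\<^sup>2))"
  proof (rule sum_norm_le)
    fix a assume "a \<in> J"
    have "N x \<bullet> T = 0" using T by (simp add: inner_commute)
    then have "a \<bullet> T = P a \<bullet> T" by (simp add: P_def inner_diff_left)
    also have "\<bar>\<dots>\<bar> \<le> norm (P a) * norm T" by (rule Cauchy_Schwarz_ineq2)
    also have "\<dots> \<le> norm (P a)" using T by (simp add: mult_left_le)
    finally have "\<bar>a \<bullet> T\<bar> * norm (P a) \<le> norm (P a) * norm (P a)" by (intro mult_right_mono) auto
    then have "\<kappa>\<^sup>2 * E a x * (\<bar>a \<bullet> T\<bar> * norm (P a)) \<le> \<kappa>\<^sup>2 * E a x * (norm (P a))\<^sup>2"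
      using E_pos[of a x] by (intro mult_left_mono) (auto simp: power2_eq_square less_imp_le)
    then show "norm ((\<kappa>\<^sup>2 * E a x * (a \<bullet> T)) *\<^sub>R P a) \<le> \<kappa>\<^sup>2 * E a x * ((norm a)\<^sup>2 - (a \<bullet> N x)\<^sup>2)"
      using E_pos[of a x] by (simp add: nP abs_mult less_imp_le mult.assoc)
  qed
  finally show ?thesis by (simp add: \<Theta>_def)
qed

text \<open>Each exponential lies above its tangent. In the layer, where values of \<open>S\<close>
  differ by at most 1, this turns a large gradient into thinness.\<close>

lemma S_convex: "S x + G x \<bullet> (y - x) \<le> S y"
proof -
  have "E a x + \<kappa> * E a x * (a \<bullet> (y - x)) \<le> E a y" for a
  proof -
    have "E a x * (1 + \<kappa> * (a \<bullet> (y - x))) \<le> E a x * exp (\<kappa> * (a \<bullet> (y - x)))"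
      using E_pos[of a x] by (intro mult_left_mono exp_ge_add_one_self) auto
    also have "\<dots> = E a y" unfolding E_def exp_add[symmetric] by (simp add: inner_diff_right algebra_simps)
    finally show ?thesis by (simp add: algebra_simps)
  qed
  then show ?thesis unfolding S_def G_def inner_sum_left inner_scaleR_left sum.distrib[symmetric]
    by (intro sum_mono) auto
qed

end

text \<open>\<open>transversal\<close> means \<open>c \<le> x \<bullet> N x\<close> on the layer:
  the tangent hyperplanes of the level sets keep distance \<open>c\<close> from the origin. The
  final bounds may involve the body only through \<open>c\<close> and \<open>L\<close>, because the
  approximation lets \<open>J\<close> and \<open>\<kappa>\<close> grow.\<close>

locale layered_body = exp_body J \<kappa> for J :: "'a::euclidean_space set" and \<kappa> +
  fixes c L :: real
  assumes c: "0 < c" and L: "1 \<le> L"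
    and bounded: "\<And>x. S x \<le> 2 \<Longrightarrow> norm x \<le> L"
    and transversal: "\<And>x. 1 \<le> S x \<Longrightarrow> S x \<le> 2 \<Longrightarrow> G x \<noteq> 0 \<and> c * norm (G x) \<le> x \<bullet> G x"
begin

definition \<phi> :: "'a \<Rightarrow> real" where "\<phi> x = step (S x - 1)"
definition \<beta> :: "'a \<Rightarrow> real" where "\<beta> x = bump (S x - 1)"
definition layer :: "'a set" where "layer = {x. 1 \<le> S x \<and> S x \<le> 2}"
definition body :: "'a set" where "body = {x. S x \<le> 2}"

lemma closed_body: "closed body" "closed layer"
proof -
  have "continuous_on UNIV S" using continuous_on_S[OF continuous_on_id] by simp
  then show "closed body" "closed layer" unfolding body_def layer_def
    by (auto intro!: closed_Collect_conj closed_Collect_le continuous_intros)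
qed

lemma compact_body: "compact body" "compact layer"
proof -
  have "bounded body" using bounded by (auto simp: body_def bounded_iff)
  moreover have "layer \<subseteq> body" by (auto simp: layer_def body_def)
  ultimately show "compact body" "compact layer"
    using closed_body by (auto simp: compact_eq_bounded_closed intro: bounded_subset)
qed

lemma layerD:
  assumes "x \<in> layer" shows "G x \<noteq> 0" "c * norm (G x) \<le> x \<bullet> G x" "norm x \<le> L" "c \<le> x \<bullet> N x" "x \<in> body"
proof -
  show g: "G x \<noteq> 0" "c * norm (G x) \<le> x \<bullet> G x" "norm x \<le> L" "x \<in> body"
    using assms transversal bounded by (auto simp: layer_def body_def)
  then show "c \<le> x \<bullet> N x"
    by (simp add: N_def sgn_div_norm field_simps)
qed

lemma \<beta>_outside: "x \<notin> layer \<Longrightarrow> \<beta> x = 0"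
  using bump_bounds(3,4) by (auto simp: layer_def \<beta>_def)

lemma \<phi>_outside: "x \<notin> body \<Longrightarrow> \<phi> x = 0"
  using step_bounds(4) by (auto simp: body_def \<phi>_def)

lemma \<beta>_bounds: "0 \<le> \<beta> x" "\<beta> x \<le> 9" using bump_bounds by (auto simp: \<beta>_def)
lemma \<phi>_bounds: "0 \<le> \<phi> x" "\<phi> x \<le> 1" using step_bounds by (auto simp: \<phi>_def)

lemma continuous_on_\<beta> [continuous_intros]: "continuous_on A f \<Longrightarrow> continuous_on A (\<lambda>x. \<beta> (f x))"
  unfolding \<beta>_def by (intro continuous_intros)

lemma continuous_on_\<phi> [continuous_intros]: "continuous_on A f \<Longrightarrow> continuous_on A (\<lambda>x. \<phi> (f x))"
  unfolding \<phi>_def by (intro continuous_intros)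

lemma \<phi>_derivative: "(\<phi> has_derivative (\<lambda>v. - \<beta> x * (G x \<bullet> v))) (at x)"
proof -
  have "((\<lambda>x. S x - 1) has_derivative (\<lambda>v. G x \<bullet> v)) (at x)"
    using has_derivative_diff[OF S_derivative has_derivative_const] by simp
  from has_derivative_compose[OF this DERIV_step[unfolded has_field_derivative_def]]
  show ?thesis by (simp add: \<phi>_def[abs_def] \<beta>_def)
qed

lemma \<beta>_derivative: "(\<beta> has_derivative (\<lambda>v. bump_deriv (S x - 1) * (G x \<bullet> v))) (at x)"
proof -
  have "((\<lambda>x. S x - 1) has_derivative (\<lambda>v. G x \<bullet> v)) (at x)"
    using has_derivative_diff[OF S_derivative has_derivative_const] by simp
  from has_derivative_compose[OF this DERIV_bump[unfolded has_field_derivative_def]]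
  show ?thesis by (simp add: \<beta>_def[abs_def])
qed

lemma open_G_nonzero: "open {x. G x \<noteq> 0}"
  using continuous_on_G[OF continuous_on_id, of UNIV] by (intro open_Collect_neq continuous_intros)

lemma indicator_\<beta>: "indicator layer x * (\<beta> x * f) = \<beta> x * (f :: real)"
  using \<beta>_outside[of x] by (auto split: split_indicator)

text \<open>Integrate the divergence of the field \<open>\<phi> \<gamma> x\<close>, which crosses the level sets of \<open>S\<close> transversally.\<close>
lemma surface_mass_bound:
  assumes \<gamma>: "\<And>x. (\<gamma> has_derivative (\<lambda>v. d\<gamma> x \<bullet> v)) (at x)" "continuous_on UNIV d\<gamma>"
    and pos: "\<And>x. 0 \<le> \<gamma> x" and \<Lambda>: "\<And>x. norm (d\<gamma> x) \<le> \<Lambda> * \<gamma> x"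
  shows "c * (LINT x|lborel. \<beta> x * norm (G x) * \<gamma> x) \<le> (real DIM('a) + L * \<Lambda>) * (LINT x|lborel. \<phi> x * \<gamma> x)"
proof -
  have cg: "continuous_on A \<gamma>" for A
    using \<gamma>(1) has_derivative_continuous by (blast intro: continuous_at_imp_continuous_on)
  have cd: "continuous_on A d\<gamma>" for A using \<gamma>(2) continuous_on_subset by blast
  define Y where "Y x = (\<phi> x * \<gamma> x) *\<^sub>R x" for x
  define Y' where "Y' x v = (\<phi> x * \<gamma> x) *\<^sub>R v + (\<phi> x * (d\<gamma> x \<bullet> v) + (- \<beta> x * (G x \<bullet> v)) * \<gamma> x) *\<^sub>R x" for x v
  have Y: "(Y has_derivative Y' x) (at x)" for x
    unfolding Y_def[abs_def] Y'_def by (rule derivative_eq_intros \<phi>_derivative \<gamma> refl)+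
  have Yc: "continuous_on UNIV (\<lambda>x. Y' x v)" for v
    unfolding Y'_def by (intro continuous_intros cg cd)
  have "(LINT x|lborel. indicator body x *\<^sub>R ((0::complex) + 1 * of_real (\<Sum>b\<in>Basis. Y' x b \<bullet> b))) = 0"
    by (rule integral_divergence_eq_0[OF open_UNIV compact_body(1) subset_UNIV _ Y Yc, where e = "\<lambda>_. 1" and e' = "\<lambda>_ _. 0"])
       (auto simp: Y_def \<phi>_outside)
  then have "complex_of_real (LINT x|lborel. indicator body x * (\<Sum>b\<in>Basis. Y' x b \<bullet> b)) = 0"
    unfolding integral_complex_of_real[symmetric] by (simp add: scaleR_conv_of_real)
  moreover have "(\<Sum>b\<in>Basis. Y' x b \<bullet> b) = \<phi> x * (real DIM('a) * \<gamma> x + d\<gamma> x \<bullet> x) - \<beta> x * \<gamma> x * (x \<bullet> G x)" for x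
  proof -
    have t: "(\<Sum>b\<in>Basis. (\<phi> x * (d\<gamma> x \<bullet> b) + (- \<beta> x * (G x \<bullet> b)) * \<gamma> x) * (x \<bullet> b)) = \<phi> x * (d\<gamma> x \<bullet> x) + (- \<beta> x * (G x \<bullet> x)) * \<gamma> x"
      by (rule trace_rank_one) (simp add: linear_iff inner_add_right algebra_simps)
    have "(\<Sum>b\<in>Basis. Y' x b \<bullet> b) = (\<phi> x * \<gamma> x) * real DIM('a) + (\<phi> x * (d\<gamma> x \<bullet> x) + (- \<beta> x * (G x \<bullet> x)) * \<gamma> x)"
      unfolding Y'_def inner_add_left inner_scaleR_left sum.distrib t by simp
    then show ?thesis by (simp add: inner_commute algebra_simps)
  qed
  ultimately have z: "(LINT x|lborel. indicator body x * (\<phi> x * (real DIM('a) * \<gamma> x + d\<gamma> x \<bullet> x) - \<beta> x * \<gamma> x * (x \<bullet> G x))) = 0"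
    by simp
  have i1: "integrable lborel (\<lambda>x. indicator body x *\<^sub>R (\<phi> x * (real DIM('a) * \<gamma> x + d\<gamma> x \<bullet> x)))"
    by (intro borel_integrable_compact compact_body continuous_intros cg cd)
  have i2: "integrable lborel (\<lambda>x. indicator body x *\<^sub>R (\<beta> x * \<gamma> x * (x \<bullet> G x)))"
    by (intro borel_integrable_compact compact_body continuous_intros cg cd)
  have i3: "integrable lborel (\<lambda>x. indicator body x *\<^sub>R (\<phi> x * \<gamma> x))"
    by (intro borel_integrable_compact compact_body continuous_intros cg cd)
  have i4: "integrable lborel (\<lambda>x. indicator body x *\<^sub>R (\<beta> x * norm (G x) * \<gamma> x))"
    by (intro borel_integrable_compact compact_body continuous_intros cg cd)
  have eq: "(LINT x|lborel. indicator body x *\<^sub>R (\<beta> x * \<gamma> x * (x \<bullet> G x))) = (LINT x|lborel. indicator body x *\<^sub>R (\<phi> x * (real DIM('a) * \<gamma> x + d\<gamma> x \<bullet> x)))"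
    using z Bochner_Integration.integral_diff[OF i1 i2] by (simp add: right_diff_distrib)
  have "(LINT x|lborel. \<beta> x * norm (G x) * \<gamma> x) = (LINT x|lborel. indicator body x *\<^sub>R (\<beta> x * norm (G x) * \<gamma> x))"
    by (intro Bochner_Integration.integral_cong refl) (use \<beta>_outside layerD in \<open>fastforce split: split_indicator\<close>)
  then have "c * (LINT x|lborel. \<beta> x * norm (G x) * \<gamma> x) = (LINT x|lborel. c * (indicator body x *\<^sub>R (\<beta> x * norm (G x) * \<gamma> x)))"
    by simp
  \<comment> \<open>Transversality turns the flux of the radial field into surface mass; the volume
    terms on the other side of the identity are controlled by \<open>norm x \<le> L\<close> and
    \<open>\<Lambda>\<close>.\<close>
  also have "\<dots> \<le> (LINT x|lborel. indicator body x *\<^sub>R (\<beta> x * \<gamma> x * (x \<bullet> G x)))"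
  proof (rule Bochner_Integration.integral_mono)
    fix x
    show "c * (indicator body x *\<^sub>R (\<beta> x * norm (G x) * \<gamma> x)) \<le> indicator body x *\<^sub>R (\<beta> x * \<gamma> x * (x \<bullet> G x))"
    proof (cases "x \<in> layer")
      case True
      have "(\<beta> x * \<gamma> x) * (c * norm (G x)) \<le> (\<beta> x * \<gamma> x) * (x \<bullet> G x)"
        using layerD[OF True] \<beta>_bounds pos by (intro mult_left_mono) auto
      then show ?thesis by (simp add: mult_ac split: split_indicator)
    qed (simp add: \<beta>_outside)
  qed (use i2 i4 in auto)
  also have "\<dots> \<le> (LINT x|lborel. (real DIM('a) + L * \<Lambda>) * (indicator body x *\<^sub>R (\<phi> x * \<gamma> x)))"
    unfolding eq
  proof (rule Bochner_Integration.integral_mono)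
    fix x
    show "indicator body x *\<^sub>R (\<phi> x * (real DIM('a) * \<gamma> x + d\<gamma> x \<bullet> x)) \<le> (real DIM('a) + L * \<Lambda>) * (indicator body x *\<^sub>R (\<phi> x * \<gamma> x))"
    proof (cases "x \<in> body")
      case True
      then have "norm x \<le> L" using bounded by (simp add: body_def)
      have "d\<gamma> x \<bullet> x \<le> norm (d\<gamma> x) * norm x" by (rule norm_cauchy_schwarz)
      also have "\<dots> \<le> (\<Lambda> * \<gamma> x) * L" using \<Lambda>[of x] \<open>norm x \<le> L\<close> L order_trans[OF norm_ge_zero \<Lambda>[of x]] by (intro mult_mono) auto
      finally have "\<phi> x * (real DIM('a) * \<gamma> x + d\<gamma> x \<bullet> x) \<le> \<phi> x * (real DIM('a) * \<gamma> x + \<Lambda> * \<gamma> x * L)"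
        using \<phi>_bounds by (intro mult_left_mono) auto
      then show ?thesis using True by (simp add: algebra_simps)
    qed simp
  qed (use i1 i3 in auto)
  also have "\<dots> = (real DIM('a) + L * \<Lambda>) * (LINT x|lborel. \<phi> x * \<gamma> x)"
  proof -
    have "(LINT x|lborel. indicator body x *\<^sub>R (\<phi> x * \<gamma> x)) = (LINT x|lborel. \<phi> x * \<gamma> x)"
      by (intro Bochner_Integration.integral_cong refl) (use \<phi>_outside in \<open>auto split: split_indicator\<close>)
    then show ?thesis by simp
  qed
  finally show ?thesis .
qed

text \<open>First variation of area: the field below is tangential to the level sets of \<open>S\<close> and its
  divergence contains the mean curvature term \<open>\<Theta>\<close>.\<close>
lemma curvature_mass_bound:
  assumes \<gamma>: "\<And>x. (\<gamma> has_derivative (\<lambda>v. d\<gamma> x \<bullet> v)) (at x)" "continuous_on UNIV d\<gamma>"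
    and pos: "\<And>x. 0 \<le> \<gamma> x" and \<Lambda>: "\<And>x. norm (d\<gamma> x) \<le> \<Lambda> * \<gamma> x"
  shows "c * (LINT x|lborel. \<beta> x * \<Theta> x * \<gamma> x) \<le> (1 + real DIM('a) + 2 * L * \<Lambda>) * (LINT x|lborel. \<beta> x * norm (G x) * \<gamma> x)"
proof -
  have cg: "continuous_on A \<gamma>" for A
    using \<gamma>(1) has_derivative_continuous by (blast intro: continuous_at_imp_continuous_on)
  have cd: "continuous_on A d\<gamma>" for A using \<gamma>(2) continuous_on_subset by blast
  \<comment> \<open>This is \<open>- (norm (G x) * \<gamma> x)\<close> times the tangential part of
    the position vector. As \<open>G x \<bullet> Z x = 0\<close>, the derivative of
    \<open>\<beta>\<close> drops out, and thanks to the factor \<open>norm (G x)\<close> the two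
    mixed Hessian terms cancel by symmetry of \<open>H\<close>. Such terms could not be bounded
    independently of \<open>\<kappa>\<close>.\<close>
  define Z where "Z x = (\<gamma> x * (G x \<bullet> x)) *\<^sub>R N x - (norm (G x) * \<gamma> x) *\<^sub>R x" for x
  define Z' where "Z' x v = ((\<gamma> x * (G x \<bullet> x)) *\<^sub>R dN x v + (\<gamma> x * (G x \<bullet> v + H x v \<bullet> x) + (d\<gamma> x \<bullet> v) * (G x \<bullet> x)) *\<^sub>R N x)
      - ((norm (G x) * \<gamma> x) *\<^sub>R v + (norm (G x) * (d\<gamma> x \<bullet> v) + (N x \<bullet> H x v) * \<gamma> x) *\<^sub>R x)" for x v
  define Y where "Y x = \<beta> x *\<^sub>R Z x" for x
  define Y' where "Y' x v = \<beta> x *\<^sub>R Z' x v + (bump_deriv (S x - 1) * (G x \<bullet> v)) *\<^sub>R Z x" for x v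
  define U where "U = {x. G x \<noteq> 0}"
  have Z: "(Z has_derivative Z' x) (at x)" if "x \<in> U" for x
    unfolding Z_def[abs_def] Z'_def
    by (rule has_derivative_eq_rhs[OF has_derivative_diff[OF
          has_derivative_scaleR[OF has_derivative_mult[OF \<gamma>(1) has_derivative_inner[OF G_derivative has_derivative_ident]] N_derivative]
          has_derivative_scaleR[OF has_derivative_mult[OF norm_G_derivative \<gamma>(1)] has_derivative_ident]]])
       (use that in \<open>auto simp: U_def\<close>)
  have Y: "(Y has_derivative Y' x) (at x)" if "x \<in> U" for x
    unfolding Y_def[abs_def] Y'_def
    by (rule derivative_eq_intros \<beta>_derivative Z[OF that] refl)+
  have Yc: "continuous_on U (\<lambda>x. Y' x v)" for v
    unfolding Y'_def Z'_def Z_def by (intro continuous_intros cg cd) (auto simp: U_def)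
  have U: "open U" "layer \<subseteq> U" using open_G_nonzero layerD by (auto simp: U_def)
  have "(LINT x|lborel. indicator layer x *\<^sub>R ((0::complex) + 1 * of_real (\<Sum>b\<in>Basis. Y' x b \<bullet> b))) = 0"
    by (rule integral_divergence_eq_0[OF U(1) compact_body(2) U(2) _ Y Yc, where e = "\<lambda>_. 1" and e' = "\<lambda>_ _. 0"])
       (auto simp: Y_def \<beta>_outside)
  then have "complex_of_real (LINT x|lborel. indicator layer x * (\<Sum>b\<in>Basis. Y' x b \<bullet> b)) = 0"
    unfolding integral_complex_of_real[symmetric] by (simp add: scaleR_conv_of_real)
  moreover have tr: "(\<Sum>b\<in>Basis. Y' x b \<bullet> b) = \<beta> x * (\<gamma> x * (x \<bullet> N x) * \<Theta> x)
      - \<beta> x * norm (G x) * (d\<gamma> x \<bullet> x + (real DIM('a) - 1) * \<gamma> x - (d\<gamma> x \<bullet> N x) * (N x \<bullet> x))" if "x \<in> layer" for x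
  proof -
    have g: "G x \<noteq> 0" using layerD[OF that] by simp
    have gg: "G x \<bullet> x = norm (G x) * (x \<bullet> N x)" for x by (subst norm_N(3)) (simp add: inner_commute)
    have gn: "G x \<bullet> N x = norm (G x)" by (subst norm_N(3)) (simp add: N_N[OF g])
    have lH: "linear (\<lambda>v. H x v \<bullet> u)" for u
      using linear_H[of x] by (simp add: linear_iff inner_add_left)
    have t1: "(\<Sum>b\<in>Basis. (\<gamma> x * (G x \<bullet> b + H x b \<bullet> x) + (d\<gamma> x \<bullet> b) * (G x \<bullet> x)) * (N x \<bullet> b))
        = \<gamma> x * (G x \<bullet> N x + H x (N x) \<bullet> x) + (d\<gamma> x \<bullet> N x) * (G x \<bullet> x)"
      by (rule trace_rank_one) (use lH[of x] in \<open>simp add: linear_iff inner_add_right algebra_simps\<close>)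
    have t2: "(\<Sum>b\<in>Basis. (norm (G x) * (d\<gamma> x \<bullet> b) + (N x \<bullet> H x b) * \<gamma> x) * (x \<bullet> b))
        = norm (G x) * (d\<gamma> x \<bullet> x) + (N x \<bullet> H x x) * \<gamma> x"
      by (rule trace_rank_one) (use lH[of "N x"] in \<open>simp add: linear_iff inner_add_right inner_commute algebra_simps\<close>)
    have t3: "(\<Sum>b\<in>Basis. (bump_deriv (S x - 1) * (G x \<bullet> b)) * (Z x \<bullet> b)) = bump_deriv (S x - 1) * (G x \<bullet> Z x)"
      by (rule trace_rank_one) (simp add: linear_iff inner_add_right algebra_simps)
    have t4: "G x \<bullet> Z x = 0"
      by (simp add: Z_def inner_diff_right gn)
    have sym: "N x \<bullet> H x x = H x (N x) \<bullet> x" by (metis H_symmetric inner_commute)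
    have t5: "(\<Sum>b\<in>Basis. (\<gamma> x * (G x \<bullet> x)) * (dN x b \<bullet> b)) = \<gamma> x * (x \<bullet> N x) * \<Theta> x"
      unfolding sum_distrib_left[symmetric] trace_dN[OF g] gg using g by simp
    have "(\<Sum>b\<in>Basis. Z' x b \<bullet> b) = (\<gamma> x * (x \<bullet> N x) * \<Theta> x + (\<gamma> x * (G x \<bullet> N x + H x (N x) \<bullet> x) + (d\<gamma> x \<bullet> N x) * (G x \<bullet> x)))
       - ((norm (G x) * \<gamma> x) * real DIM('a) + (norm (G x) * (d\<gamma> x \<bullet> x) + (N x \<bullet> H x x) * \<gamma> x))"
      unfolding Z'_def inner_diff_left inner_add_left inner_scaleR_left sum_subtractf sum.distrib t1 t2 t5
      by simp
    also have "\<dots> = \<gamma> x * (x \<bullet> N x) * \<Theta> x - norm (G x) * (d\<gamma> x \<bullet> x + (real DIM('a) - 1) * \<gamma> x - (d\<gamma> x \<bullet> N x) * (N x \<bullet> x))"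
      unfolding gn gg sym by (simp add: algebra_simps inner_commute)
    finally have trZ: "(\<Sum>b\<in>Basis. Z' x b \<bullet> b) = \<gamma> x * (x \<bullet> N x) * \<Theta> x
       - norm (G x) * (d\<gamma> x \<bullet> x + (real DIM('a) - 1) * \<gamma> x - (d\<gamma> x \<bullet> N x) * (N x \<bullet> x))" .
    have trY: "(\<Sum>b\<in>Basis. Y' x b \<bullet> b) = \<beta> x * (\<Sum>b\<in>Basis. Z' x b \<bullet> b)"
      unfolding Y'_def inner_add_left inner_scaleR_left sum.distrib t3 t4 by (simp add: sum_distrib_left)
    show ?thesis unfolding trY trZ by (simp add: algebra_simps)
  qed
  moreover have "indicator layer x * (\<Sum>b\<in>Basis. Y' x b \<bullet> b) = indicator layer x *\<^sub>R (\<beta> x * (\<gamma> x * (x \<bullet> N x) * \<Theta> x))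
      - indicator layer x *\<^sub>R (\<beta> x * norm (G x) * (d\<gamma> x \<bullet> x + (real DIM('a) - 1) * \<gamma> x - (d\<gamma> x \<bullet> N x) * (N x \<bullet> x)))" for x
    using tr[of x] by (auto split: split_indicator)
  ultimately have z: "(LINT x|lborel. indicator layer x *\<^sub>R (\<beta> x * (\<gamma> x * (x \<bullet> N x) * \<Theta> x))
      - indicator layer x *\<^sub>R (\<beta> x * norm (G x) * (d\<gamma> x \<bullet> x + (real DIM('a) - 1) * \<gamma> x - (d\<gamma> x \<bullet> N x) * (N x \<bullet> x)))) = 0"
    by simp
  have i1: "integrable lborel (\<lambda>x. indicator layer x *\<^sub>R (\<beta> x * (\<gamma> x * (x \<bullet> N x) * \<Theta> x)))"
    by (intro borel_integrable_compact compact_body continuous_intros cg cd) (auto simp: layerD)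
  have i2: "integrable lborel (\<lambda>x. indicator layer x *\<^sub>R (\<beta> x * norm (G x) * (d\<gamma> x \<bullet> x + (real DIM('a) - 1) * \<gamma> x - (d\<gamma> x \<bullet> N x) * (N x \<bullet> x))))"
    by (intro borel_integrable_compact compact_body continuous_intros cg cd) (auto simp: layerD)
  have i3: "integrable lborel (\<lambda>x. indicator layer x *\<^sub>R (\<beta> x * \<Theta> x * \<gamma> x))"
    by (intro borel_integrable_compact compact_body continuous_intros cg cd) (auto simp: layerD)
  have i4: "integrable lborel (\<lambda>x. indicator layer x *\<^sub>R (\<beta> x * norm (G x) * \<gamma> x))"
    by (intro borel_integrable_compact compact_body continuous_intros cg cd)
  have ind: "(LINT x|lborel. \<beta> x * f x) = (LINT x|lborel. indicator layer x *\<^sub>R (\<beta> x * f x))" for f :: "'a \<Rightarrow> real"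
    by (simp add: indicator_\<beta>)
  have "c * (LINT x|lborel. \<beta> x * \<Theta> x * \<gamma> x) = (LINT x|lborel. c * (indicator layer x *\<^sub>R (\<beta> x * \<Theta> x * \<gamma> x)))"
    using ind[of "\<lambda>x. \<Theta> x * \<gamma> x"] by (simp add: mult.assoc)
  \<comment> \<open>Besides \<open>c \<le> x \<bullet> N x\<close> this uses
    \<open>\<Theta>_nonneg\<close>, that is convexity: curvature of varying sign could cancel in the
    integral.\<close>
  also have "\<dots> \<le> (LINT x|lborel. indicator layer x *\<^sub>R (\<beta> x * (\<gamma> x * (x \<bullet> N x) * \<Theta> x)))"
  proof (rule Bochner_Integration.integral_mono)
    fix x
    show "c * (indicator layer x *\<^sub>R (\<beta> x * \<Theta> x * \<gamma> x)) \<le> indicator layer x *\<^sub>R (\<beta> x * (\<gamma> x * (x \<bullet> N x) * \<Theta> x))"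
    proof (cases "x \<in> layer")
      case True
      have "(\<beta> x * \<gamma> x * \<Theta> x) * c \<le> (\<beta> x * \<gamma> x * \<Theta> x) * (x \<bullet> N x)"
        using layerD[OF True] \<beta>_bounds pos \<Theta>_nonneg by (intro mult_left_mono) auto
      then show ?thesis using True by (simp add: mult_ac)
    qed simp
  qed (use i1 i3 in auto)
  also have "\<dots> = (LINT x|lborel. indicator layer x *\<^sub>R (\<beta> x * norm (G x) * (d\<gamma> x \<bullet> x + (real DIM('a) - 1) * \<gamma> x - (d\<gamma> x \<bullet> N x) * (N x \<bullet> x))))"
    using z Bochner_Integration.integral_diff[OF i1 i2] by simp
  also have "\<dots> \<le> (LINT x|lborel. (1 + real DIM('a) + 2 * L * \<Lambda>) * (indicator layer x *\<^sub>R (\<beta> x * norm (G x) * \<gamma> x)))"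
  proof (rule Bochner_Integration.integral_mono)
    fix x
    show "indicator layer x *\<^sub>R (\<beta> x * norm (G x) * (d\<gamma> x \<bullet> x + (real DIM('a) - 1) * \<gamma> x - (d\<gamma> x \<bullet> N x) * (N x \<bullet> x)))
       \<le> (1 + real DIM('a) + 2 * L * \<Lambda>) * (indicator layer x *\<^sub>R (\<beta> x * norm (G x) * \<gamma> x))"
    proof (cases "x \<in> layer")
      case True
      note l = layerD[OF True]
      have P: "0 \<le> \<Lambda> * \<gamma> x" using order_trans[OF norm_ge_zero \<Lambda>] .
      have "d\<gamma> x \<bullet> x \<le> norm (d\<gamma> x) * norm x" by (rule norm_cauchy_schwarz)
      also have "\<dots> \<le> (\<Lambda> * \<gamma> x) * L" using \<Lambda>[of x] l L P by (intro mult_mono) auto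
      finally have 1: "d\<gamma> x \<bullet> x \<le> \<Lambda> * \<gamma> x * L" .
      have "\<bar>d\<gamma> x \<bullet> N x\<bar> \<le> norm (d\<gamma> x) * norm (N x)" by (rule Cauchy_Schwarz_ineq2)
      also have "\<dots> \<le> \<Lambda> * \<gamma> x" using \<Lambda>[of x] norm_N(1)[OF l(1)] by simp
      finally have 2: "\<bar>d\<gamma> x \<bullet> N x\<bar> \<le> \<Lambda> * \<gamma> x" .
      have "\<bar>N x \<bullet> x\<bar> \<le> norm (N x) * norm x" by (rule Cauchy_Schwarz_ineq2)
      then have 3: "\<bar>N x \<bullet> x\<bar> \<le> L" using norm_N(1)[OF l(1)] l by simp
      have "\<bar>(d\<gamma> x \<bullet> N x) * (N x \<bullet> x)\<bar> \<le> (\<Lambda> * \<gamma> x) * L"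
        unfolding abs_mult using 2 3 P by (intro mult_mono) auto
      then have "d\<gamma> x \<bullet> x + (real DIM('a) - 1) * \<gamma> x - (d\<gamma> x \<bullet> N x) * (N x \<bullet> x) \<le> (1 + real DIM('a) + 2 * L * \<Lambda>) * \<gamma> x"
        using 1 pos[of x] by (simp add: algebra_simps)
      then have "(\<beta> x * norm (G x)) * (d\<gamma> x \<bullet> x + (real DIM('a) - 1) * \<gamma> x - (d\<gamma> x \<bullet> N x) * (N x \<bullet> x))
         \<le> (\<beta> x * norm (G x)) * ((1 + real DIM('a) + 2 * L * \<Lambda>) * \<gamma> x)"
        using \<beta>_bounds by (intro mult_left_mono) auto
      then show ?thesis using True by (simp add: mult_ac)
    qed simp
  qed (use i2 i4 in auto)
  also have "\<dots> = (1 + real DIM('a) + 2 * L * \<Lambda>) * (LINT x|lborel. \<beta> x * norm (G x) * \<gamma> x)"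
    using ind[of "\<lambda>x. norm (G x) * \<gamma> x"] by (simp add: mult.assoc)
  finally show ?thesis .
qed

end

section \<open>Fourier transform of a layered body\<close>

definition wave :: "real \<Rightarrow> 'a::euclidean_space \<Rightarrow> 'a \<Rightarrow> complex" where
  "wave R \<omega> x = exp (- \<i> * of_real (R * (x \<bullet> \<omega>)))"

lemma wave_derivative:
  "(wave R \<omega> has_derivative (\<lambda>v. - \<i> * of_real (R * (v \<bullet> \<omega>)) * wave R \<omega> x)) (at x)"
proof -
  have 1: "((\<lambda>x. - \<i> * of_real (R * (x \<bullet> \<omega>))) has_derivative (\<lambda>v. - \<i> * of_real (R * (v \<bullet> \<omega>)))) (at x)"
    by (intro derivative_intros)
  have 2: "(exp has_derivative (*) (exp z)) (at z)" for z :: complex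
    using DERIV_exp[of z] by (simp add: has_field_derivative_def)
  from has_derivative_compose[OF 1 2] show ?thesis
    unfolding wave_def[abs_def] by (simp add: mult_ac)
qed

lemma continuous_on_wave [continuous_intros]:
  "continuous_on A f \<Longrightarrow> continuous_on A g \<Longrightarrow> continuous_on A (\<lambda>x. wave R (f x) (g x))"
  unfolding wave_def by (intro continuous_intros)

lemma norm_wave [simp]: "norm (wave R \<omega> x) = 1"
  by (simp add: wave_def)

context layered_body
begin

text \<open>Divergence theorem for \<open>\<phi>\<close> times a constant direction. The direction
  is the centre \<open>\<tau>\<close> of the cap and not \<open>\<omega>\<close> itself, so that the
  amplitude on the right is independent of the frequency.\<close>

lemma fourier_body_flux:
  "\<i> * of_real (R * (\<omega> \<bullet> \<tau>)) * (LINT x|lborel. of_real (\<phi> x) * wave R \<omega> x)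
     = - (LINT x|lborel. of_real (\<beta> x * (G x \<bullet> \<tau>)) * wave R \<omega> x)"
proof -
  define Y where "Y x = \<phi> x *\<^sub>R \<tau>" for x
  define Y' where "Y' x v = (- \<beta> x * (G x \<bullet> v)) *\<^sub>R \<tau>" for x v
  have Y: "(Y has_derivative Y' x) (at x)" for x
    unfolding Y_def[abs_def] Y'_def by (intro has_derivative_scaleR_left \<phi>_derivative)
  have Yc: "continuous_on UNIV (\<lambda>x. Y' x v)" for v
    unfolding Y'_def by (intro continuous_intros)
  have tr: "(\<Sum>b\<in>Basis. Y' x b \<bullet> b) = - \<beta> x * (G x \<bullet> \<tau>)" for x
    unfolding Y'_def inner_scaleR_left
    by (rule trace_rank_one) (simp add: linear_iff inner_add_right algebra_simps)
  have z: "(LINT x|lborel. indicator body x *\<^sub>R (- \<i> * of_real (R * (Y x \<bullet> \<omega>)) * wave R \<omega> x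
      + wave R \<omega> x * of_real (- \<beta> x * (G x \<bullet> \<tau>)))) = 0"
    unfolding tr[symmetric]
    by (rule integral_divergence_eq_0[OF open_UNIV compact_body(1) subset_UNIV _ Y Yc wave_derivative])
       (auto simp: Y_def \<phi>_outside intro!: continuous_intros)
  have i1: "integrable lborel (\<lambda>x. indicator body x *\<^sub>R (of_real (\<phi> x) * wave R \<omega> x))"
    by (intro borel_integrable_compact compact_body continuous_intros)
  have i2: "integrable lborel (\<lambda>x. indicator body x *\<^sub>R (of_real (\<beta> x * (G x \<bullet> \<tau>)) * wave R \<omega> x))"
    by (intro borel_integrable_compact compact_body continuous_intros)
  have e1: "(LINT x|lborel. of_real (\<phi> x) * wave R \<omega> x) = (LINT x|lborel. indicator body x *\<^sub>R (of_real (\<phi> x) * wave R \<omega> x))"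
    by (intro Bochner_Integration.integral_cong refl) (use \<phi>_outside in \<open>auto split: split_indicator\<close>)
  have e2: "(LINT x|lborel. of_real (\<beta> x * (G x \<bullet> \<tau>)) * wave R \<omega> x) = (LINT x|lborel. indicator body x *\<^sub>R (of_real (\<beta> x * (G x \<bullet> \<tau>)) * wave R \<omega> x))"
  proof -
    have "\<beta> x = 0" if "x \<notin> body" for x using that \<beta>_outside layerD(5) by blast
    then show ?thesis by (intro Bochner_Integration.integral_cong refl) (auto split: split_indicator)
  qed
  have "(LINT x|lborel. indicator body x *\<^sub>R (- \<i> * of_real (R * (Y x \<bullet> \<omega>)) * wave R \<omega> x
      + wave R \<omega> x * of_real (- \<beta> x * (G x \<bullet> \<tau>))))
    = (LINT x|lborel. (- \<i> * of_real (R * (\<omega> \<bullet> \<tau>))) * (indicator body x *\<^sub>R (of_real (\<phi> x) * wave R \<omega> x))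
        - indicator body x *\<^sub>R (of_real (\<beta> x * (G x \<bullet> \<tau>)) * wave R \<omega> x))"
    by (intro Bochner_Integration.integral_cong refl) (simp add: Y_def inner_commute split: split_indicator)
  also have "\<dots> = (- \<i> * of_real (R * (\<omega> \<bullet> \<tau>))) * (LINT x|lborel. indicator body x *\<^sub>R (of_real (\<phi> x) * wave R \<omega> x))
        - (LINT x|lborel. indicator body x *\<^sub>R (of_real (\<beta> x * (G x \<bullet> \<tau>)) * wave R \<omega> x))"
    by (simp only: Bochner_Integration.integral_diff[OF integrable_mult_right[OF i1] i2] integral_mult_right_zero)
  finally show ?thesis using z unfolding e1 e2 by (simp add: algebra_simps eq_neg_iff_add_eq_0)
qed

definition tang :: "'a \<Rightarrow> 'a \<Rightarrow> 'a" where "tang \<tau> x = \<tau> - (\<tau> \<bullet> N x) *\<^sub>R N x"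
text \<open>\<open>norm (G x)\<close> times the derivative of the unit normal in the direction
  \<open>tang \<tau> x\<close>.\<close>

definition bend :: "'a \<Rightarrow> 'a \<Rightarrow> 'a" where
  "bend \<tau> x = H x (tang \<tau> x) - (N x \<bullet> H x (tang \<tau> x)) *\<^sub>R N x"
text \<open>Made such that \<open>(steep_density \<tau> x \<bullet> \<omega>) / (tang \<tau> x
  \<bullet> \<omega>)\<^sup>2\<close> is the divergence of \<open>tang \<tau> x\<close> scaled by
  \<open>norm (G x) * slope_cutoff (\<tau> \<bullet> N x) / (tang \<tau> x \<bullet>
  \<omega>)\<close>, apart from \<open>\<beta>\<close>. The frequency occurs only in two inner
  products, which later gives the continuation along complex lines.\<close>

definition steep_density :: "'a \<Rightarrow> 'a \<Rightarrow> 'a" where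
  "steep_density \<tau> x = (slope_cutoff_deriv (\<tau> \<bullet> N x) * (\<tau> \<bullet> bend \<tau> x) - slope_cutoff (\<tau> \<bullet> N x) * (\<tau> \<bullet> N x) * \<Theta> x) *\<^sub>R tang \<tau> x
     + slope_cutoff (\<tau> \<bullet> N x) *\<^sub>R ((\<tau> \<bullet> bend \<tau> x) *\<^sub>R N x + (\<tau> \<bullet> N x) *\<^sub>R bend \<tau> x)"

lemma tang_props:
  assumes "norm \<tau> = 1" "G x \<noteq> 0"
  shows "tang \<tau> x \<bullet> N x = 0" "norm (tang \<tau> x) \<le> 1" "\<bar>\<tau> \<bullet> N x\<bar> \<le> 1"
proof -
  show "tang \<tau> x \<bullet> N x = 0" using N_N[OF assms(2)] by (simp add: tang_def inner_diff_left)
  have "(norm (tang \<tau> x))\<^sup>2 = 1 - (\<tau> \<bullet> N x)\<^sup>2"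
    unfolding power2_norm_eq_inner tang_def using N_N[OF assms(2)] assms(1)
    by (simp add: inner_diff_left inner_diff_right inner_commute power2_eq_square norm_eq_1)
  then have "(norm (tang \<tau> x))\<^sup>2 \<le> 1\<^sup>2" by simp
  then show "norm (tang \<tau> x) \<le> 1" by (rule power2_le_imp_le) simp
  show "\<bar>\<tau> \<bullet> N x\<bar> \<le> 1" using Cauchy_Schwarz_ineq2[of \<tau> "N x"] assms norm_N(1) by simp
qed

lemma norm_bend: "norm \<tau> = 1 \<Longrightarrow> G x \<noteq> 0 \<Longrightarrow> norm (bend \<tau> x) \<le> \<Theta> x"
  unfolding bend_def using norm_tangential_Hessian_le tang_props by blast

text \<open>40 is 37 + 1 + 2: the derivative of the cutoff, the trace term, and the derivative of
  \<open>tang\<close>.\<close>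

lemma norm_steep_density:
  assumes \<tau>: "norm \<tau> = 1" and x: "G x \<noteq> 0"
  shows "norm (steep_density \<tau> x) \<le> 40 * \<Theta> x"
proof -
  note tp = tang_props[OF \<tau> x]
  let ?t = "\<tau> \<bullet> N x" and ?w = "\<tau> \<bullet> bend \<tau> x"
  have w: "\<bar>?w\<bar> \<le> \<Theta> x" using Cauchy_Schwarz_ineq2[of \<tau> "bend \<tau> x"] norm_bend[OF \<tau> x] \<tau> by simp
  have e: "\<bar>slope_cutoff ?t\<bar> \<le> 1" using slope_cutoff_bounds(1)[of ?t] tp by linarith
  have "\<bar>slope_cutoff_deriv ?t * ?w\<bar> \<le> 37 * \<Theta> x"
    unfolding abs_mult using w slope_cutoff_bounds(3)[of ?t] by (intro mult_mono) auto
  moreover have "\<bar>slope_cutoff ?t * ?t * \<Theta> x\<bar> \<le> 1 * 1 * \<Theta> x"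
    unfolding abs_mult using e tp \<Theta>_nonneg[of x] by (intro mult_mono) auto
  ultimately have "\<bar>slope_cutoff_deriv ?t * ?w - slope_cutoff ?t * ?t * \<Theta> x\<bar> \<le> 38 * \<Theta> x" by linarith
  then have 1: "norm ((slope_cutoff_deriv ?t * ?w - slope_cutoff ?t * ?t * \<Theta> x) *\<^sub>R tang \<tau> x) \<le> (38 * \<Theta> x) * 1"
    unfolding norm_scaleR using tp by (intro mult_mono) auto
  have "norm (?w *\<^sub>R N x) \<le> \<Theta> x" using w norm_N(1)[OF x] by simp
  moreover have "norm (?t *\<^sub>R bend \<tau> x) \<le> 1 * \<Theta> x" 
    unfolding norm_scaleR using tp norm_bend[OF \<tau> x] by (intro mult_mono) auto
  ultimately have "norm (?w *\<^sub>R N x + ?t *\<^sub>R bend \<tau> x) \<le> 2 * \<Theta> x"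
    using norm_triangle_ineq[of "?w *\<^sub>R N x" "?t *\<^sub>R bend \<tau> x"] by linarith
  then have "norm (slope_cutoff ?t *\<^sub>R (?w *\<^sub>R N x + ?t *\<^sub>R bend \<tau> x)) \<le> 1 * (2 * \<Theta> x)"
    unfolding norm_scaleR using e by (intro mult_mono) auto
  then show ?thesis unfolding steep_density_def using 1 
    norm_triangle_ineq[of "(slope_cutoff_deriv ?t * ?w - slope_cutoff ?t * ?t * \<Theta> x) *\<^sub>R tang \<tau> x" "slope_cutoff ?t *\<^sub>R (?w *\<^sub>R N x + ?t *\<^sub>R bend \<tau> x)"]
    by linarith
qed

lemma steep_density_support:
  "1/25 \<le> (\<tau> \<bullet> N x)\<^sup>2 \<Longrightarrow> steep_density \<tau> x = 0"
  using slope_cutoff_bounds(4,5)[of "\<tau> \<bullet> N x"] by (simp add: steep_density_def)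

text \<open>One integration by parts along the level sets of \<open>S\<close>, in the direction of the projection of
  \<open>\<tau>\<close>. Only the curvature of the level sets appears on the right.\<close>
lemma steep_flux:
  assumes \<tau>: "norm \<tau> = 1" and \<omega>: "norm \<omega> = 1" "1/5 < \<tau> \<bullet> \<omega>"
  shows "\<i> * of_real R * (LINT x|lborel. of_real (\<beta> x * norm (G x) * slope_cutoff (\<tau> \<bullet> N x)) * wave R \<omega> x)
    = (LINT x|lborel. of_real (\<beta> x * ((steep_density \<tau> x \<bullet> \<omega>) / (tang \<tau> x \<bullet> \<omega>)\<^sup>2)) * wave R \<omega> x)"
proof -
  let ?t = "\<lambda>x. \<tau> \<bullet> N x" and ?T = "tang \<tau>"
  define T' where "T' x v = - ((\<tau> \<bullet> dN x v) *\<^sub>R N x + ?t x *\<^sub>R dN x v)" for x v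
  define h where "h x = slope_cutoff (?t x) / (?T x \<bullet> \<omega>)" for x
  define h' where "h' x v = (slope_cutoff_deriv (?t x) * (\<tau> \<bullet> dN x v) * (?T x \<bullet> \<omega>) - slope_cutoff (?t x) * (T' x v \<bullet> \<omega>)) / ((?T x \<bullet> \<omega>) * (?T x \<bullet> \<omega>))" for x v
  define f where "f x = norm (G x) * h x" for x
  define f' where "f' x v = norm (G x) * h' x v + (N x \<bullet> H x v) * h x" for x v
  define Z where "Z x = f x *\<^sub>R ?T x" for x
  define Z' where "Z' x v = f x *\<^sub>R T' x v + f' x v *\<^sub>R ?T x" for x v
  define Y where "Y x = \<beta> x *\<^sub>R Z x" for x
  define Y' where "Y' x v = \<beta> x *\<^sub>R Z' x v + (bump_deriv (S x - 1) * (G x \<bullet> v)) *\<^sub>R Z x" for x v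
  define U where "U = {x. G x \<noteq> 0} \<inter> (\<lambda>x. ?T x \<bullet> \<omega>) -` {0<..}"
  \<comment> \<open>The part of the layer with
    \<open>\<bar>\<tau> \<bullet> N x\<bar> \<le> 1/5\<close>, written with \<open>G\<close> to be
    visibly closed. On it \<open>tang \<tau> x \<bullet> \<omega> = \<tau> \<bullet> \<omega> -
    (\<tau> \<bullet> N x) * (N x \<bullet> \<omega>)\<close> is positive because
    \<open>1/5 < \<tau> \<bullet> \<omega>\<close>.\<close>
  define K where "K = layer \<inter> {x. 25 * (\<tau> \<bullet> G x)\<^sup>2 \<le> (norm (G x))\<^sup>2}"
  have cT: "continuous_on {x. G x \<noteq> 0} ?T"
    unfolding tang_def[abs_def] by (intro continuous_intros) auto
  have U: "open U"
    unfolding U_def by (intro continuous_open_preimage open_G_nonzero continuous_intros cT)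
  have tG: "\<tau> \<bullet> G x = norm (G x) * ?t x" for x by (subst norm_N(3)) simp
  have Kt: "(?t x)\<^sup>2 \<le> 1/25" if "x \<in> K" for x
    using that layerD(1)[of x] by (auto simp: K_def tG power_mult_distrib)
  have Tpos: "0 < ?T x \<bullet> \<omega>" if "(?t x)\<^sup>2 \<le> 1/25" "G x \<noteq> 0" for x
  proof -
    have "(?t x)\<^sup>2 \<le> (1/5)\<^sup>2" using that by (simp add: power2_eq_square)
    then have "\<bar>?t x\<bar> \<le> 1/5" by (metis abs_le_square_iff abs_of_nonneg zero_le_divide_1_iff zero_le_numeral)
    moreover have "\<bar>N x \<bullet> \<omega>\<bar> \<le> 1" using Cauchy_Schwarz_ineq2[of "N x" \<omega>] norm_N(1)[OF that(2)] \<omega> by simp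
    ultimately have "\<bar>?t x * (N x \<bullet> \<omega>)\<bar> \<le> (1/5) * 1" unfolding abs_mult by (intro mult_mono) auto
    then show ?thesis using \<omega> by (simp add: tang_def inner_diff_left abs_le_iff)
  qed
  have KU: "K \<subseteq> U" using Kt Tpos layerD(1) by (auto simp: U_def K_def)
  have K: "compact K"
  proof -
    have "closed {x. 25 * (\<tau> \<bullet> G x)\<^sup>2 \<le> (norm (G x))\<^sup>2}"
      by (intro closed_Collect_le continuous_intros)
    then show ?thesis unfolding K_def using compact_body(2) by (intro compact_Int_closed)
  qed
  have Kout: "slope_cutoff (?t x) = 0 \<and> steep_density \<tau> x = 0" if "x \<in> layer" "x \<notin> K" for x
  proof -
    have "1 < 25 * (?t x)\<^sup>2"
      using that layerD(1)[of x] by (auto simp: K_def tG power_mult_distrib)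
    then show ?thesis using slope_cutoff_bounds(4)[of "?t x"] steep_density_support[of \<tau> x] by simp
  qed
  have Ud: "G x \<noteq> 0" "0 < ?T x \<bullet> \<omega>" if "x \<in> U" for x using that by (auto simp: U_def)
  have dt: "(?t has_derivative (\<lambda>v. \<tau> \<bullet> dN x v)) (at x)" if "x \<in> U" for x
    by (intro has_derivative_inner_right N_derivative Ud that)
  have dT: "(?T has_derivative T' x) (at x)" if "x \<in> U" for x
    unfolding tang_def[abs_def] T'_def
    using has_derivative_diff[OF has_derivative_const has_derivative_scaleR[OF dt[OF that] N_derivative[OF Ud(1)[OF that]]]]
    by (simp add: add.commute)
  have dh: "(h has_derivative h' x) (at x)" if "x \<in> U" for x
  proof -
    have "((\<lambda>x. slope_cutoff (?t x)) has_derivative (\<lambda>v. slope_cutoff_deriv (?t x) * (\<tau> \<bullet> dN x v))) (at x)"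
      using has_derivative_compose[OF dt[OF that] DERIV_slope_cutoff[unfolded has_field_derivative_def]] by simp
    from has_derivative_divide'[OF this has_derivative_inner_left[OF dT[OF that]]]
    show ?thesis unfolding h_def[abs_def] h'_def using Ud(2)[OF that] by simp
  qed
  have df: "(f has_derivative f' x) (at x)" if "x \<in> U" for x
    unfolding f_def[abs_def] f'_def
    by (rule has_derivative_mult[OF norm_G_derivative[OF Ud(1)[OF that]] dh[OF that]])
  have dZ: "(Z has_derivative Z' x) (at x)" if "x \<in> U" for x
    unfolding Z_def[abs_def] Z'_def by (rule has_derivative_scaleR[OF df[OF that] dT[OF that]])
  have dY: "(Y has_derivative Y' x) (at x)" if "x \<in> U" for x
    unfolding Y_def[abs_def] Y'_def by (rule has_derivative_scaleR[OF \<beta>_derivative dZ[OF that]])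
  have cY: "continuous_on U (\<lambda>x. Y' x v)" for v
    unfolding Y'_def Z'_def Z_def f'_def f_def h'_def h_def T'_def tang_def
    by (intro continuous_intros) (auto simp: U_def tang_def)
  have zero: "Y x = 0" if "x \<notin> K" for x
    using Kout[OF _ that] \<beta>_outside[of x] by (auto simp: Y_def Z_def f_def h_def)
  have tr: "(\<Sum>b\<in>Basis. Y' x b \<bullet> b) = \<beta> x * ((steep_density \<tau> x \<bullet> \<omega>) / (?T x \<bullet> \<omega>)\<^sup>2)" if "x \<in> K" for x
  proof -
    have xU: "x \<in> U" using that KU by auto
    note g = Ud(1)[OF xU] and p = Ud(2)[OF xU]
    note tp = tang_props[OF \<tau> g]
    \<comment> \<open>The field is tangential, so differentiating \<open>\<beta>\<close> contributes
      nothing to its divergence.\<close>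
    have GT: "G x \<bullet> ?T x = 0" using tp(1) by (subst norm_N(3)) (simp add: inner_commute)
    have t3: "(\<Sum>b\<in>Basis. (bump_deriv (S x - 1) * (G x \<bullet> b)) * (Z x \<bullet> b)) = bump_deriv (S x - 1) * (G x \<bullet> Z x)"
      by (rule trace_rank_one) (simp add: linear_iff inner_add_right algebra_simps)
    have t1: "(\<Sum>b\<in>Basis. f' x b * (?T x \<bullet> b)) = f' x (?T x)"
      by (rule trace_rank_one) (rule has_derivative_linear[OF df[OF xU]])
    have t2: "(\<Sum>b\<in>Basis. (\<tau> \<bullet> dN x b) * (N x \<bullet> b)) = \<tau> \<bullet> dN x (N x)"
      by (rule trace_rank_one) (rule has_derivative_linear[OF dt[OF xU]])
    have t4: "(\<Sum>b\<in>Basis. T' x b \<bullet> b) = - ((\<tau> \<bullet> dN x (N x)) + ?t x * (\<Theta> x / norm (G x)))"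
      unfolding T'_def inner_minus_left inner_add_left inner_scaleR_left sum_negf sum.distrib t2
      by (simp add: sum_distrib_left[symmetric] trace_dN[OF g])
    have ng: "norm (G x) \<noteq> 0" using g by simp
    have W: "norm (G x) *\<^sub>R dN x (?T x) = bend \<tau> x" using ng by (simp add: dN_def bend_def)
    have tW: "norm (G x) * (\<tau> \<bullet> dN x (?T x)) = \<tau> \<bullet> bend \<tau> x" unfolding W[symmetric] by simp
    \<comment> \<open>By symmetry of \<open>H\<close> the normal term in the trace of
      \<open>T'\<close> becomes \<open>N x \<bullet> H x (tang \<tau> x)\<close>, which is also the
      derivative of \<open>norm (G x)\<close> along \<open>tang \<tau> x\<close>; the two cancel.
      Only tangential curvature survives, and that is controlled by \<open>\<Theta>\<close>.\<close>
    have NHN: "norm (G x) * (\<tau> \<bullet> dN x (N x)) = N x \<bullet> H x (?T x)"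
    proof -
      have "norm (G x) * (\<tau> \<bullet> dN x (N x)) = \<tau> \<bullet> H x (N x) - (N x \<bullet> H x (N x)) * ?t x"
        using ng by (simp add: dN_def inner_diff_right)
      also have "\<dots> = H x (N x) \<bullet> ?T x" by (simp add: tang_def inner_diff_right inner_commute)
      also have "\<dots> = N x \<bullet> H x (?T x)" using H_symmetric[of x "N x" "?T x"] by (simp add: inner_commute)
      finally show ?thesis .
    qed
    have GTT: "norm (G x) * (T' x (?T x) \<bullet> \<omega>) = - ((\<tau> \<bullet> bend \<tau> x) * (N x \<bullet> \<omega>) + ?t x * (bend \<tau> x \<bullet> \<omega>))"
      unfolding T'_def W[symmetric] by (simp add: inner_add_left algebra_simps)
    let ?p = "?T x \<bullet> \<omega>"
    have "norm (G x) * h' x (?T x) = (slope_cutoff_deriv (?t x) * (\<tau> \<bullet> bend \<tau> x) * ?p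
        + slope_cutoff (?t x) * ((\<tau> \<bullet> bend \<tau> x) * (N x \<bullet> \<omega>) + ?t x * (bend \<tau> x \<bullet> \<omega>))) / ?p\<^sup>2"
    proof -
      have "norm (G x) * h' x (?T x) = (slope_cutoff_deriv (?t x) * (norm (G x) * (\<tau> \<bullet> dN x (?T x))) * ?p
         - slope_cutoff (?t x) * (norm (G x) * (T' x (?T x) \<bullet> \<omega>))) / (?p * ?p)"
        unfolding h'_def by (simp add: algebra_simps)
      then show ?thesis unfolding tW GTT mult_minus_right diff_minus_eq_add power2_eq_square .
    qed
    moreover have "f x * (\<Sum>b\<in>Basis. T' x b \<bullet> b) = - h x * (N x \<bullet> H x (?T x)) - h x * ?t x * \<Theta> x"
    proof -
      have "f x * (\<Sum>b\<in>Basis. T' x b \<bullet> b) = - h x * (norm (G x) * (\<tau> \<bullet> dN x (N x))) - h x * ?t x * \<Theta> x"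
        unfolding t4 f_def using ng by (simp add: algebra_simps)
      then show ?thesis unfolding NHN .
    qed
    ultimately have "f' x (?T x) + f x * (\<Sum>b\<in>Basis. T' x b \<bullet> b) = 
       (slope_cutoff_deriv (?t x) * (\<tau> \<bullet> bend \<tau> x) * ?p
        + slope_cutoff (?t x) * ((\<tau> \<bullet> bend \<tau> x) * (N x \<bullet> \<omega>) + ?t x * (bend \<tau> x \<bullet> \<omega>))) / ?p\<^sup>2
        - slope_cutoff (?t x) / ?p * ?t x * \<Theta> x"
      unfolding f'_def by (simp add: h_def algebra_simps)
    also have "slope_cutoff (?t x) / ?p * ?t x * \<Theta> x = (slope_cutoff (?t x) * ?t x * \<Theta> x * ?p) / ?p\<^sup>2"
      using p by (simp add: power2_eq_square)
    also have "(slope_cutoff_deriv (?t x) * (\<tau> \<bullet> bend \<tau> x) * ?p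
        + slope_cutoff (?t x) * ((\<tau> \<bullet> bend \<tau> x) * (N x \<bullet> \<omega>) + ?t x * (bend \<tau> x \<bullet> \<omega>))) / ?p\<^sup>2
         - (slope_cutoff (?t x) * ?t x * \<Theta> x * ?p) / ?p\<^sup>2 = (steep_density \<tau> x \<bullet> \<omega>) / ?p\<^sup>2"
      unfolding steep_density_def diff_divide_distrib[symmetric] by (simp add: inner_add_left inner_diff_left algebra_simps)
    finally have trZ: "(\<Sum>b\<in>Basis. Z' x b \<bullet> b) = (steep_density \<tau> x \<bullet> \<omega>) / ?p\<^sup>2"
      unfolding Z'_def inner_add_left inner_scaleR_left sum.distrib t1 by (simp add: sum_distrib_left add.commute)
    have "G x \<bullet> Z x = 0" using GT by (simp add: Z_def)
    then show ?thesis
      unfolding Y'_def inner_add_left inner_scaleR_left sum.distrib t3 trZ[symmetric] by (simp add: sum_distrib_left)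
  qed
  have z: "(LINT x|lborel. indicator K x *\<^sub>R (- \<i> * of_real (R * (Y x \<bullet> \<omega>)) * wave R \<omega> x
      + wave R \<omega> x * of_real (\<Sum>b\<in>Basis. Y' x b \<bullet> b))) = 0"
    by (rule integral_divergence_eq_0[OF U K KU zero dY cY wave_derivative]) (auto intro!: continuous_intros)
  have i1: "integrable lborel (\<lambda>x. indicator K x *\<^sub>R (of_real (\<beta> x * norm (G x) * slope_cutoff (?t x)) * wave R \<omega> x))"
    by (intro borel_integrable_compact K continuous_intros) (auto simp: K_def layerD)
  have i2: "integrable lborel (\<lambda>x. indicator K x *\<^sub>R (of_real (\<Sum>b\<in>Basis. Y' x b \<bullet> b) * wave R \<omega> x))"
    by (intro borel_integrable_compact K continuous_intros continuous_on_subset[OF cY KU])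
  have e1: "(LINT x|lborel. of_real (\<beta> x * norm (G x) * slope_cutoff (?t x)) * wave R \<omega> x)
     = (LINT x|lborel. indicator K x *\<^sub>R (of_real (\<beta> x * norm (G x) * slope_cutoff (?t x)) * wave R \<omega> x))"
  proof (intro Bochner_Integration.integral_cong refl)
    fix x
    have "x \<notin> K \<Longrightarrow> \<beta> x * norm (G x) * slope_cutoff (?t x) = 0"
      using \<beta>_outside[of x] Kout[of x] by (cases "x \<in> layer") auto
    then show "of_real (\<beta> x * norm (G x) * slope_cutoff (?t x)) * wave R \<omega> x =
       indicator K x *\<^sub>R (of_real (\<beta> x * norm (G x) * slope_cutoff (?t x)) * wave R \<omega> x)"
      by (cases "x \<in> K") simp_all
  qed
  have e2: "(LINT x|lborel. of_real (\<beta> x * ((steep_density \<tau> x \<bullet> \<omega>) / (?T x \<bullet> \<omega>)\<^sup>2)) * wave R \<omega> x)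
     = (LINT x|lborel. indicator K x *\<^sub>R (of_real (\<Sum>b\<in>Basis. Y' x b \<bullet> b) * wave R \<omega> x))"
  proof (intro Bochner_Integration.integral_cong refl)
    fix x
    have "x \<notin> K \<Longrightarrow> \<beta> x * ((steep_density \<tau> x \<bullet> \<omega>) / (?T x \<bullet> \<omega>)\<^sup>2) = 0"
      using \<beta>_outside[of x] Kout[of x] by (cases "x \<in> layer") auto
    then show "of_real (\<beta> x * ((steep_density \<tau> x \<bullet> \<omega>) / (?T x \<bullet> \<omega>)\<^sup>2)) * wave R \<omega> x =
       indicator K x *\<^sub>R (of_real (\<Sum>b\<in>Basis. Y' x b \<bullet> b) * wave R \<omega> x)"
      using tr[of x] by (cases "x \<in> K") (simp_all, blast)
  qed
  have "Y x \<bullet> \<omega> = \<beta> x * norm (G x) * slope_cutoff (?t x)" if "x \<in> K" for x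
    using Ud(2)[of x] KU that by (auto simp: Y_def Z_def f_def h_def)
  then have "(LINT x|lborel. indicator K x *\<^sub>R (- \<i> * of_real (R * (Y x \<bullet> \<omega>)) * wave R \<omega> x
      + wave R \<omega> x * of_real (\<Sum>b\<in>Basis. Y' x b \<bullet> b)))
    = (LINT x|lborel. indicator K x *\<^sub>R (of_real (\<Sum>b\<in>Basis. Y' x b \<bullet> b) * wave R \<omega> x) -
       (\<i> * of_real R) * (indicator K x *\<^sub>R (of_real (\<beta> x * norm (G x) * slope_cutoff (?t x)) * wave R \<omega> x)))"
    by (intro Bochner_Integration.integral_cong refl) (simp split: split_indicator)
  also have "\<dots> = (LINT x|lborel. indicator K x *\<^sub>R (of_real (\<Sum>b\<in>Basis. Y' x b \<bullet> b) * wave R \<omega> x)) -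
       (\<i> * of_real R) * (LINT x|lborel. indicator K x *\<^sub>R (of_real (\<beta> x * norm (G x) * slope_cutoff (?t x)) * wave R \<omega> x))"
    by (simp only: Bochner_Integration.integral_diff[OF i2 integrable_mult_right[OF i1]] integral_mult_right_zero)
  finally show ?thesis using z unfolding e1 e2 by simp
qed

end

section \<open>Surface and curvature mass at scale 1/R\<close>

text \<open>With \<open>k\<close> the integer part of \<open>R * norm (x - x0)\<close>, the single
  term of index \<open>k\<close> already dominates.\<close>

lemma decay_le_sum_balls:
  fixes z :: "'a::euclidean_space"
  assumes R: "0 < R"
  shows "ennreal (decay n R (x - x0)) \<le> (\<Sum>k. ennreal (1 / (1 + (real k)\<^sup>2) ^ n) * indicator (ball x0 ((real k + 1) / R)) x)"
proof -
  define k where "k = nat \<lfloor>R * norm (x - x0)\<rfloor>"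
  have k: "real k \<le> R * norm (x - x0)" "R * norm (x - x0) < real k + 1"
    using R unfolding k_def by (auto simp: of_nat_nat)
  have "(1 + (real k)\<^sup>2) ^ n \<le> (1 + (R * norm (x - x0))\<^sup>2) ^ n"
    using k by (intro power_mono add_mono) auto
  then have "decay n R (x - x0) \<le> 1 / (1 + (real k)\<^sup>2) ^ n"
    unfolding decay_def by (intro divide_left_mono mult_pos_pos zero_less_power) (auto simp: add_pos_nonneg)
  moreover have "x \<in> ball x0 ((real k + 1) / R)"
    using k R by (simp add: dist_norm norm_minus_commute field_simps)
  ultimately have "ennreal (decay n R (x - x0)) \<le> ennreal (1 / (1 + (real k)\<^sup>2) ^ n) * indicator (ball x0 ((real k + 1) / R)) x"
    by (simp add: ennreal_leI)
  also have "\<dots> \<le> (\<Sum>i. ennreal (1 / (1 + (real i)\<^sup>2) ^ n) * indicator (ball x0 ((real i + 1) / R)) x)"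
    using sum_le_suminf[of "\<lambda>i. ennreal (1 / (1 + (real i)\<^sup>2) ^ n) * indicator (ball x0 ((real i + 1) / R)) x" "{k}"]
    by (simp only: sum.insert finite.intros empty_iff not_False_eq_True sum.empty add_0_right) simp
  finally show ?thesis .
qed

text \<open>The ball of radius \<open>(k + 1) / R\<close> has volume proportional to
  \<open>((k + 1) / R) ^ d\<close>. As \<open>k + 1 \<le> 2 * (1 + k\<^sup>2)\<close>, this uses up
  \<open>d\<close> of the \<open>d + 1\<close> powers in the denominator and leaves the convergent
  series of \<open>1 / (1 + k\<^sup>2)\<close>.\<close>

lemma decay_integral_bound:
  obtains C where "0 \<le> C"
    and "\<And>R x0. 0 < R \<Longrightarrow> integrable lborel (\<lambda>x::'a::euclidean_space. decay (DIM('a) + 1) R (x - x0))"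
    and "\<And>R x0. 0 < R \<Longrightarrow> (LINT x|lborel. decay (DIM('a) + 1) R (x - x0 :: 'a)) \<le> C / R ^ DIM('a)"
proof -
  define d where "d = DIM('a)"
  define V where "V = unit_ball_vol (real d)"
  have V: "0 \<le> V" unfolding V_def by (rule unit_ball_vol_nonneg) simp
  define t where "t k = 2 ^ d * V * (1 / (1 + (real k)\<^sup>2))" for k :: nat
  have "summable (\<lambda>k::nat. 1 / (1 + (real k)\<^sup>2))"
  proof (rule summable_comparison_test'[where N = 1])
    show "summable (\<lambda>k::nat. 1 / (real k)\<^sup>2)" using inverse_power_summable[of 2, where 'a = real] by (simp add: inverse_eq_divide)
    show "norm (1 / (1 + (real k)\<^sup>2)) \<le> 1 / (real k)\<^sup>2" if "1 \<le> k" for k :: nat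
      using that by (simp add: frac_le)
  qed
  then have st: "summable t" unfolding t_def by (rule summable_mult)
  have t0: "0 \<le> t k" for k using V by (simp add: t_def)
  define C where "C = suminf t"
  have main: "(\<integral>\<^sup>+ x. ennreal (decay (d + 1) R (x - x0)) \<partial>(lborel :: 'a measure)) \<le> ennreal (C / R ^ d)" if R: "0 < R" for R x0
  proof -
    have "(\<integral>\<^sup>+ x. ennreal (decay (d + 1) R (x - x0)) \<partial>(lborel :: 'a measure))
       \<le> (\<integral>\<^sup>+ x. (\<Sum>k. ennreal (1 / (1 + (real k)\<^sup>2) ^ (d + 1)) * indicator (ball x0 ((real k + 1) / R)) x) \<partial>lborel)"
      by (intro nn_integral_mono decay_le_sum_balls R)
    also have "\<dots> = (\<Sum>k. \<integral>\<^sup>+ x. ennreal (1 / (1 + (real k)\<^sup>2) ^ (d + 1)) * indicator (ball x0 ((real k + 1) / R)) x \<partial>lborel)"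
      by (intro nn_integral_suminf borel_measurable_times_ennreal borel_measurable_const borel_measurable_indicator) simp
    also have "\<dots> \<le> (\<Sum>k. ennreal (t k / R ^ d))"
    proof (intro suminf_le summableI)
      fix k :: nat
      have em: "emeasure lborel (ball x0 ((real k + 1) / R)) = ennreal (V * ((real k + 1) / R) ^ d)"
        using R by (subst emeasure_ball) (auto simp: V_def d_def)
      have "(\<integral>\<^sup>+ x. ennreal (1 / (1 + (real k)\<^sup>2) ^ (d + 1)) * indicator (ball x0 ((real k + 1) / R)) x \<partial>lborel)
         = ennreal (1 / (1 + (real k)\<^sup>2) ^ (d + 1)) * emeasure lborel (ball x0 ((real k + 1) / R))"
        by (rule nn_integral_cmult_indicator) simp
      also have "\<dots> = ennreal (1 / (1 + (real k)\<^sup>2) ^ (d + 1) * (V * ((real k + 1) / R) ^ d))"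
        unfolding em using V R by (intro ennreal_mult[symmetric]) auto
      also have "\<dots> \<le> ennreal (t k / R ^ d)"
      proof (rule ennreal_leI)
        let ?q = "1 + (real k)\<^sup>2"
        have q: "0 < ?q" by (simp add: add_pos_nonneg)
        have "real k + 1 \<le> 2 * ?q"
        proof -
          have "0 \<le> (real k - 1)\<^sup>2" by simp
          also have "(real k - 1)\<^sup>2 = (real k)\<^sup>2 - 2 * real k + 1" by (simp add: power2_diff)
          finally have "2 * real k \<le> (real k)\<^sup>2 + 1" by simp
          then show ?thesis by (smt (verit) zero_le_power2)
        qed
        then have "(real k + 1) ^ d \<le> (2 * ?q) ^ d" by (intro power_mono) auto
        then have "V * (real k + 1) ^ d / ?q ^ (d + 1) \<le> V * (2 * ?q) ^ d / ?q ^ (d + 1)"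
          using V q by (intro divide_right_mono mult_left_mono) auto
        also have "V * (2 * u) ^ d / u ^ (d + 1) = 2 ^ d * V * (1 / u)" if "0 < u" for u :: real
          using that by (simp add: power_mult_distrib field_simps)
        then have "V * (2 * ?q) ^ d / ?q ^ (d + 1) = t k" unfolding t_def using q by blast
        finally have "V * (real k + 1) ^ d / ?q ^ (d + 1) / R ^ d \<le> t k / R ^ d"
          using R by (intro divide_right_mono) auto
        moreover have "1 / u * (V * (v / R) ^ d) = V * v ^ d / u / R ^ d" for u v
          by (simp add: power_divide)
        ultimately show "1 / ?q ^ (d + 1) * (V * ((real k + 1) / R) ^ d) \<le> t k / R ^ d" by metis
      qed
      finally show "(\<integral>\<^sup>+ x. ennreal (1 / (1 + (real k)\<^sup>2) ^ (d + 1)) * indicator (ball x0 ((real k + 1) / R)) x \<partial>lborel) \<le> ennreal (t k / R ^ d)" .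
    qed
    also have "\<dots> = ennreal (\<Sum>k. t k / R ^ d)"
      using st t0 R by (intro suminf_ennreal2 summable_divide) auto
    also have "(\<Sum>k. t k / R ^ d) = C / R ^ d" unfolding C_def using st by (rule suminf_divide)
    finally show ?thesis .
  qed
  have C0: "0 \<le> C" unfolding C_def using st t0 by (rule suminf_nonneg)
  have m: "(\<lambda>x::'a. decay (d + 1) R (x - x0)) \<in> borel_measurable lborel" for R x0 by measurable
  have nn: "0 \<le> decay (d + 1) R (x - x0 :: 'a)" for R x0 x by (rule less_imp_le[OF decay_bounds(1)])
  have i: "integrable lborel (\<lambda>x::'a. decay (d + 1) R (x - x0))" if "0 < R" for R x0
    using main[OF that, of x0] nn by (intro integrableI_nonneg m) (auto simp: le_less_trans)
  show ?thesis
  proof (rule that[OF C0])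
    fix R :: real and x0 :: 'a assume R: "0 < R"
    show "integrable lborel (\<lambda>x. decay (DIM('a) + 1) R (x - x0))" using i[OF R] by (simp add: d_def)
    have "ennreal (LINT x|lborel. decay (d + 1) R (x - x0)) \<le> ennreal (C / R ^ d)"
      using main[OF R, of x0] nn_integral_eq_integral[OF i[OF R]] nn by simp
    then show "(LINT x|lborel. decay (DIM('a) + 1) R (x - x0)) \<le> C / R ^ DIM('a)"
      using C0 R by (simp add: ennreal_le_iff d_def)
  qed
qed

definition decay_gradient :: "nat \<Rightarrow> real \<Rightarrow> 'a::euclidean_space \<Rightarrow> 'a" where
  "decay_gradient n R z = (- (2 * real n * R\<^sup>2 / (1 + (R * norm z)\<^sup>2) ^ Suc n)) *\<^sub>R z"

lemma decay_derivative:
  "((\<lambda>x. decay n R (x - x0)) has_derivative (\<lambda>v. decay_gradient n R (x - x0) \<bullet> v)) (at x)"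
proof -
  define w where "w x = 1 + R\<^sup>2 * ((x - x0) \<bullet> (x - x0))" for x
  have w0: "0 < w x" for x by (simp add: w_def add_pos_nonneg)
  have we: "1 + (R * norm (x - x0))\<^sup>2 = w x" for x
    by (simp add: w_def power_mult_distrib power2_norm_eq_inner)
  have "(w has_derivative (\<lambda>v. 2 * R\<^sup>2 * ((x - x0) \<bullet> v))) (at x)"
    unfolding w_def[abs_def] by (auto intro!: derivative_eq_intros simp: fun_eq_iff inner_commute algebra_simps)
  moreover have "((\<lambda>u. 1 / u ^ n) has_derivative (*) (- (real n / w x ^ Suc n))) (at (w x))"
  proof -
    have "((\<lambda>u. inverse (u ^ n)) has_real_derivative - (real n * w x ^ (n - Suc 0) * inverse ((w x ^ n)\<^sup>2))) (at (w x))"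
      by (rule derivative_eq_intros DERIV_pow refl)+ (use w0[of x] in \<open>auto simp: power2_eq_square field_simps\<close>)
    moreover have "real n * w x ^ (n - Suc 0) * inverse ((w x ^ n)\<^sup>2) = real n / w x ^ Suc n"
      using w0[of x] by (cases n) (auto simp: field_simps power2_eq_square)
    ultimately have "((\<lambda>u. inverse (u ^ n)) has_real_derivative - (real n / w x ^ Suc n)) (at (w x))" by simp
    then show ?thesis unfolding has_field_derivative_def inverse_eq_divide .
  qed
  ultimately have "((\<lambda>x. 1 / w x ^ n) has_derivative (\<lambda>v. - (real n / w x ^ Suc n) * (2 * R\<^sup>2 * ((x - x0) \<bullet> v)))) (at x)"
    by (rule has_derivative_compose)
  then show ?thesis unfolding decay_def decay_gradient_def we
    by (rule has_derivative_eq_rhs) (simp add: fun_eq_iff)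
qed

text \<open>From \<open>2 * t \<le> 1 + t\<^sup>2\<close> with \<open>t = R * norm z\<close>. This
  is the hypothesis on \<open>\<gamma>\<close> in the mass bounds, with
  \<open>\<Lambda> = n * R\<close>.\<close>

lemma norm_decay_gradient:
  assumes "0 \<le> R"
  shows "norm (decay_gradient n R z) \<le> (real n * R) * decay n R z"
proof -
  let ?w = "1 + (R * norm z)\<^sup>2"
  have w: "0 < ?w" by (simp add: add_pos_nonneg)
  have "0 \<le> (R * norm z - 1)\<^sup>2" by simp
  then have "2 * (R * norm z) \<le> ?w" unfolding power2_diff by simp
  then have "real n * R * (2 * (R * norm z)) / ?w ^ Suc n \<le> real n * R * ?w / ?w ^ Suc n"
    using assms w by (intro divide_right_mono mult_left_mono) auto
  also have "\<dots> = (real n * R) * decay n R z" using w by (simp add: decay_def)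
  also have "real n * R * (2 * (R * norm z)) / ?w ^ Suc n = norm (decay_gradient n R z)"
    using w assms by (simp add: decay_gradient_def power2_eq_square abs_mult mult_ac)
  finally show ?thesis .
qed

lemma continuous_on_decay_gradient: "continuous_on A (\<lambda>x. decay_gradient n R (x - x0))"
proof -
  have "(1 + (R * norm (x - x0))\<^sup>2) ^ Suc n \<noteq> 0" for x
    by (metis add_pos_nonneg less_numeral_extra(1,3) power_not_zero zero_le_power2)
  then show ?thesis unfolding decay_gradient_def by (intro continuous_intros) auto
qed

context layered_body
begin

lemma integrable_\<phi>: "continuous_on UNIV \<gamma> \<Longrightarrow> integrable lborel (\<lambda>x. \<phi> x * \<gamma> x :: real)"
proof -
  assume "continuous_on UNIV \<gamma>"
  then have "continuous_on body \<gamma>" using continuous_on_subset by blast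
  then have "integrable lborel (\<lambda>x. indicator body x *\<^sub>R (\<phi> x * \<gamma> x))"
    by (intro borel_integrable_compact compact_body continuous_intros)
  moreover have "(\<lambda>x. indicator body x *\<^sub>R (\<phi> x * \<gamma> x)) = (\<lambda>x. \<phi> x * \<gamma> x)"
    using \<phi>_outside by (auto simp: fun_eq_iff split: split_indicator)
  ultimately show ?thesis by (simp only:)
qed

text \<open>The test function \<open>\<gamma> = 1\<close> with \<open>\<Lambda> = 0\<close>: area is
  bounded by volume, and total curvature by area.\<close>

lemma total_masses:
  shows "(LINT x|lborel. \<beta> x * norm (G x)) \<le> real DIM('a) / c * measure lborel (cball (0::'a) L)" (is ?A)
    and "(LINT x|lborel. \<beta> x * \<Theta> x) \<le> (1 + real DIM('a)) / c * (real DIM('a) / c * measure lborel (cball (0::'a) L))" (is ?B)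
proof -
  have d: "((\<lambda>_. 1) has_derivative (\<lambda>v. (0::'a) \<bullet> v)) (at x)" for x :: 'a by simp
  have "(LINT x|lborel. \<phi> x * 1) \<le> (LINT x|lborel. indicator (cball (0::'a) L) x)"
  proof (rule Bochner_Integration.integral_mono)
    show "integrable lborel (\<lambda>x. \<phi> x * 1)" by (intro integrable_\<phi> continuous_intros)
    show "integrable lborel (indicator (cball (0::'a) L) :: _ \<Rightarrow> real)"
      by (intro integrable_real_indicator) (use emeasure_bounded_finite[OF bounded_cball] in auto)
    show "\<phi> x * 1 \<le> indicator (cball 0 L) x" for x
      using \<phi>_outside[of x] \<phi>_bounds(2)[of x] bounded[of x] by (cases "x \<in> body") (auto simp: body_def split: split_indicator)
  qed
  then have p: "(LINT x|lborel. \<phi> x * 1) \<le> measure lborel (cball (0::'a) L)" by simp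
  have "c * (LINT x|lborel. \<beta> x * norm (G x) * 1) \<le> (real DIM('a) + L * 0) * (LINT x|lborel. \<phi> x * 1)"
    by (rule surface_mass_bound[OF d]) auto
  also have "\<dots> \<le> real DIM('a) * measure lborel (cball (0::'a) L)" using p by (simp add: mult_left_mono)
  also have "\<dots> = c * (real DIM('a) / c * measure lborel (cball (0::'a) L))" using c by simp
  finally have "c * (LINT x|lborel. \<beta> x * norm (G x)) \<le> c * (real DIM('a) / c * measure lborel (cball (0::'a) L))" by simp
  then show A: ?A using c by (simp only: mult_le_cancel_left_pos)
  have "c * (LINT x|lborel. \<beta> x * \<Theta> x * 1) \<le> (1 + real DIM('a) + 2 * L * 0) * (LINT x|lborel. \<beta> x * norm (G x) * 1)"
    by (rule curvature_mass_bound[OF d]) auto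
  also have "\<dots> = (1 + real DIM('a)) * (LINT x|lborel. \<beta> x * norm (G x))" by simp
  also have "\<dots> \<le> (1 + real DIM('a)) * (real DIM('a) / c * measure lborel (cball (0::'a) L))" by (intro mult_left_mono A) simp
  also have "\<dots> = c * ((1 + real DIM('a)) / c * (real DIM('a) / c * measure lborel (cball (0::'a) L)))" using c by simp
  finally have "c * (LINT x|lborel. \<beta> x * \<Theta> x) \<le> c * ((1 + real DIM('a)) / c * (real DIM('a) / c * measure lborel (cball (0::'a) L)))" by simp
  then show ?B using c by (simp only: mult_le_cancel_left_pos)
qed

text \<open>The test function is \<open>decay\<close>, with \<open>\<Lambda> = n * R\<close>. Its
  own integral is at most \<open>Cd / R ^ DIM('a)\<close>; the passage from volume to area and that
  from area to curvature cost a factor \<open>R\<close> each. \<open>1 \<le> R\<close> merges the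
  purely dimensional terms into those with \<open>R\<close>.\<close>

lemma local_masses:
  assumes R: "1 \<le> R" and Cd: "\<And>x0. (LINT x|lborel. decay (DIM('a) + 1) R (x - x0 :: 'a)) \<le> Cd / R ^ DIM('a)"
    and int: "\<And>x0. integrable lborel (\<lambda>x::'a. decay (DIM('a) + 1) R (x - x0))"
  defines "n \<equiv> DIM('a) + 1"
  defines "C1 \<equiv> (real DIM('a) + L * real n) / c * Cd"
  shows "(LINT x|lborel. \<beta> x * norm (G x) * decay n R (x - x0)) \<le> C1 * R / R ^ DIM('a)" (is ?A)
    and "(LINT x|lborel. \<beta> x * \<Theta> x * decay n R (x - x0)) \<le> (1 + real DIM('a) + 2 * L * real n) / c * C1 * R\<^sup>2 / R ^ DIM('a)" (is ?B)
proof -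
  have nn: "0 \<le> decay n R z" for z :: 'a by (rule less_imp_le[OF decay_bounds(1)])
  have cd: "continuous_on UNIV (\<lambda>x. decay n R (x - x0))"
    using decay_derivative has_derivative_continuous by (blast intro: continuous_at_imp_continuous_on)
  have "(LINT x|lborel. \<phi> x * decay n R (x - x0)) \<le> (LINT x|lborel. decay n R (x - x0))"
  proof (rule Bochner_Integration.integral_mono)
    show "integrable lborel (\<lambda>x. \<phi> x * decay n R (x - x0))" by (rule integrable_\<phi>[OF cd])
    show "integrable lborel (\<lambda>x. decay n R (x - x0))" using int by (simp add: n_def)
    show "\<phi> x * decay n R (x - x0) \<le> decay n R (x - x0)" for x
      using \<phi>_bounds[of x] nn[of "x - x0"] by (simp add: mult_left_le_one_le)
  qed
  then have p: "(LINT x|lborel. \<phi> x * decay n R (x - x0)) \<le> Cd / R ^ DIM('a)" using Cd[of x0] by (simp add: n_def)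
  have p0: "0 \<le> (LINT x|lborel. \<phi> x * decay n R (x - x0))" using \<phi>_bounds nn by (intro integral_nonneg_AE) auto
  have "c * (LINT x|lborel. \<beta> x * norm (G x) * decay n R (x - x0)) \<le> (real DIM('a) + L * (real n * R)) * (LINT x|lborel. \<phi> x * decay n R (x - x0))"
    by (rule surface_mass_bound[OF decay_derivative continuous_on_decay_gradient nn norm_decay_gradient]) (use R in simp)
  also have "\<dots> \<le> ((real DIM('a) + L * real n) * R) * (Cd / R ^ DIM('a))"
  proof (rule mult_mono)
    have "real DIM('a) \<le> real DIM('a) * R" using R by simp
    then show "real DIM('a) + L * (real n * R) \<le> (real DIM('a) + L * real n) * R" by (simp add: algebra_simps)
  qed (use p p0 L R in auto)
  finally have "c * (LINT x|lborel. \<beta> x * norm (G x) * decay n R (x - x0)) \<le> c * (C1 * R / R ^ DIM('a))"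
    using c by (simp add: C1_def mult_ac)
  then show A: ?A using c by (simp only: mult_le_cancel_left_pos)
  have B0: "0 \<le> (LINT x|lborel. \<beta> x * norm (G x) * decay n R (x - x0))" using \<beta>_bounds nn by (intro integral_nonneg_AE) auto
  have "c * (LINT x|lborel. \<beta> x * \<Theta> x * decay n R (x - x0)) \<le> (1 + real DIM('a) + 2 * L * (real n * R)) * (LINT x|lborel. \<beta> x * norm (G x) * decay n R (x - x0))"
    by (rule curvature_mass_bound[OF decay_derivative continuous_on_decay_gradient nn norm_decay_gradient]) (use R in simp)
  also have "\<dots> \<le> ((1 + real DIM('a) + 2 * L * real n) * R) * (C1 * R / R ^ DIM('a))"
  proof (rule mult_mono)
    have "(1 + real DIM('a)) * 1 \<le> (1 + real DIM('a)) * R" using R by (intro mult_left_mono) auto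
    then show "1 + real DIM('a) + 2 * L * (real n * R) \<le> (1 + real DIM('a) + 2 * L * real n) * R" by (simp add: algebra_simps)
  qed (use A B0 L R in auto)
  finally have "c * (LINT x|lborel. \<beta> x * \<Theta> x * decay n R (x - x0)) \<le> c * ((1 + real DIM('a) + 2 * L * real n) / c * C1 * R\<^sup>2 / R ^ DIM('a))"
    using c by (simp add: power2_eq_square mult_ac)
  then show ?B using c by (simp only: mult_le_cancel_left_pos)
qed

end

section \<open>Energy of the flat part\<close>

definition kernel_const :: "'a::euclidean_space itself \<Rightarrow> nat \<Rightarrow> real" where
  "kernel_const _ n = measure lborel (cball (0::'a) 3) * (101 ^ n + 2 * fact (2*n) * 3200 ^ n)"

lemma kernel_const_nonneg: "0 \<le> kernel_const TYPE('a::euclidean_space) n"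
  by (simp add: kernel_const_def)

lemma sgn_borel_measurable: "sgn \<in> borel_measurable (borel :: 'a::euclidean_space measure)"
  unfolding sgn_div_norm by measurable

text \<open>\<open>\<nu>\<close> majorises the amplitude, and products of its values the continued
  amplitudes. The kernel bound for each pair, put into the \<open>T T\<^sup>*\<close> expansion,
  leaves a double integral of \<open>\<nu>\<close> against \<open>decay\<close>. The amplitude may
  depend on the frequency, as it does in the steep part.\<close>

lemma cap_energy_bound:
  fixes a :: "'a::euclidean_space \<Rightarrow> 'a \<Rightarrow> real" and \<nu> :: "'a \<Rightarrow> real"
  assumes n: "0 < n" and \<tau>: "norm \<tau> = 1" and R: "0 < R"
    and a: "case_prod a \<in> borel_measurable borel"
    and \<nu>[measurable]: "\<nu> \<in> borel_measurable borel"
    and \<nu>_bounds: "\<And>x. 0 \<le> \<nu> x" "\<And>x. \<nu> x \<le> C" "\<And>x. L < norm x \<Longrightarrow> \<nu> x = 0"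
    and zero: "\<And>x y. \<nu> x = 0 \<Longrightarrow> a x y = 0"
    and bound: "\<And>x y. cap_weight n \<tau> y \<noteq> 0 \<Longrightarrow> \<bar>a x y\<bar> \<le> \<nu> x"
    and line: "\<And>x x'. line_amplitude \<tau> (\<nu> x * \<nu> x') (\<lambda>y. of_real (a x y * a x' y))"
    and pairs: "\<And>x x'. \<nu> x \<noteq> 0 \<Longrightarrow> \<nu> x' \<noteq> 0 \<Longrightarrow> \<bar>(x - x') \<bullet> \<tau>\<bar> \<le> 8 * norm (perp \<tau> (x - x')) + 1 / R"
  shows "(LINT y|lborel. cap_weight n \<tau> y * (cmod (LINT x|lborel. of_real (a x y) * wave R (sgn y) x))\<^sup>2)
    \<le> kernel_const TYPE('a) n * (LINT x|lborel. LINT x'|lborel. \<nu> x * \<nu> x' * decay n R (x - x'))"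
proof -
  note [measurable] = sgn_borel_measurable
  have am[measurable]: "case_prod a \<in> borel_measurable (borel \<Otimes>\<^sub>M borel)" using a by (simp add: borel_prod)
  have ax[measurable]: "a x \<in> borel_measurable borel" for x
    using measurable_compose[of "\<lambda>y. (x, y)" borel "borel \<Otimes>\<^sub>M borel" "case_prod a" borel] by simp
  have C: "0 \<le> C" using \<nu>_bounds(1,2) order_trans by blast
  \<comment> \<open>Off the cap nothing bounds \<open>a\<close>, so it is replaced by zero there;
    the weight does not see the change.\<close>
  define u where "u x y = (if cap_weight n \<tau> y = 0 then 0 else of_real (a x y) * wave R (sgn y) x)" for x y
  define k where "k x x' = kernel_const TYPE('a) n * (\<nu> x * \<nu> x' * decay n R (x - x'))" for x x' :: 'a
  have ub: "cmod (u x y) \<le> \<nu> x" for x y using bound[of y x] \<nu>_bounds(1) by (simp add: u_def norm_mult)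
  have um: "case_prod u \<in> borel_measurable borel"
    unfolding u_def wave_def borel_prod[symmetric] by measurable
  have km: "case_prod k \<in> borel_measurable borel"
    unfolding k_def borel_prod[symmetric] by measurable
  have ki: "integrable (lborel \<Otimes>\<^sub>M lborel) (case_prod k)"
  proof (rule integrable_bounded_support_pair[OF km, where L = L and M = L and C = "kernel_const TYPE('a) n * (C * C * 1)"])
    fix x x' :: 'a
    have "0 \<le> k x x'" unfolding k_def using \<nu>_bounds kernel_const_nonneg less_imp_le[OF decay_bounds(1)] by (intro mult_nonneg_nonneg) auto
    moreover have "k x x' \<le> kernel_const TYPE('a) n * (C * C * 1)"
      unfolding k_def using \<nu>_bounds C kernel_const_nonneg decay_bounds(2) less_imp_le[OF decay_bounds(1)]
      by (intro mult_mono mult_nonneg_nonneg) auto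
    ultimately show "norm (k x x') \<le> kernel_const TYPE('a) n * (C * C * 1)" by simp
  qed (auto simp: k_def \<nu>_bounds(3))
  have "(LINT y|lborel. cap_weight n \<tau> y * (cmod (LINT x|lborel. of_real (a x y) * wave R (sgn y) x))\<^sup>2)
     = (LINT y|lborel. cap_weight n \<tau> y * (cmod (LINT x|lborel. u x y))\<^sup>2)"
  proof (intro Bochner_Integration.integral_cong refl)
    show "cap_weight n \<tau> y * (cmod (LINT x|lborel. of_real (a x y) * wave R (sgn y) x))\<^sup>2
        = cap_weight n \<tau> y * (cmod (LINT x|lborel. u x y))\<^sup>2" for y
      by (cases "cap_weight n \<tau> y = 0") (simp_all add: u_def)
  qed
  also have "\<dots> \<le> (LINT x|lborel. LINT x'|lborel. k x x')"
  proof (rule integral_squared_norm_le_kernel[OF um, where C = C and L = L and D = 1 and M = 2])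
    fix x x' y :: 'a
    show "cmod (u x y) \<le> C" using ub[of x y] \<nu>_bounds(2)[of x] by linarith
    show "u x y = 0" if "L < norm x" using ub[of x y] \<nu>_bounds(3)[OF that] by simp
    show "\<bar>cap_weight n \<tau> y\<bar> \<le> 1" using cap_weight_bounds[of n \<tau> y] by simp
    show "cap_weight n \<tau> y = 0" if "2 < norm y" using cap_weight_support(4)[OF \<tau> n, of y] that by force
    show "cmod (LINT y|lborel. of_real (cap_weight n \<tau> y) * (u x y * cnj (u x' y))) \<le> k x x'"
    proof (cases "\<nu> x = 0 \<or> \<nu> x' = 0")
      case True
      have "u x y * cnj (u x' y) = 0" for y using True zero by (cases "\<nu> x = 0") (auto simp: u_def)
      then have "(LINT y|lborel. of_real (cap_weight n \<tau> y) * (u x y * cnj (u x' y))) = 0" by (simp only: mult_zero_right) simp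
      then show ?thesis using True by (auto simp: k_def)
    next
      case False
      have "of_real (cap_weight n \<tau> y) * (u x y * cnj (u x' y)) =
         of_real (cap_weight n \<tau> y) * of_real (a x y * a x' y) * exp (- \<i> * of_real (R * ((x - x') \<bullet> sgn y)))" for y
      proof -
        have "wave R (sgn y) x * cnj (wave R (sgn y) x') = exp (- \<i> * of_real (R * ((x - x') \<bullet> sgn y)))"
          unfolding wave_def exp_cnj exp_add[symmetric] by (simp add: inner_diff_left right_diff_distrib algebra_simps)
        then show ?thesis by (simp add: u_def mult_ac)
      qed
      then have "(LINT y|lborel. of_real (cap_weight n \<tau> y) * (u x y * cnj (u x' y)))
         = (LINT y|lborel. of_real (cap_weight n \<tau> y) * of_real (a x y * a x' y) * exp (- \<i> * of_real (R * ((x - x') \<bullet> sgn y))))" by (simp only:)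
      also have "cmod \<dots> \<le> (measure lborel (cball (0::'a) 3) * (101 ^ n + 2 * fact (2*n) * 3200 ^ n)) * (\<nu> x * \<nu> x') * decay n R (x - x')"
      proof (rule cap_kernel_bound[OF line n \<tau> R])
        show "cmod (of_real (a x y * a x' y)) \<le> \<nu> x * \<nu> x'" if "cap_weight n \<tau> y \<noteq> 0" for y
          using bound[OF that] \<nu>_bounds(1) by (simp add: norm_mult abs_mult mult_mono)
      qed (use False pairs \<nu>_bounds(1) in auto)
      finally show ?thesis by (simp add: k_def kernel_const_def mult_ac)
    qed
  qed (use ki in auto)
  also have "\<dots> = kernel_const TYPE('a) n * (LINT x|lborel. LINT x'|lborel. \<nu> x * \<nu> x' * decay n R (x - x'))"
    by (simp add: k_def)
  finally show ?thesis .
qed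

text \<open>Schur's test: a uniform bound for the inner integral times the total mass.\<close>

lemma double_integral_le:
  fixes \<nu> :: "'a::euclidean_space \<Rightarrow> real"
  assumes \<nu>[measurable]: "\<nu> \<in> borel_measurable borel"
    and \<nu>_bounds: "\<And>x. 0 \<le> \<nu> x" "\<And>x. \<nu> x \<le> C" "\<And>x. L < norm x \<Longrightarrow> \<nu> x = 0"
    and P: "\<And>x. (LINT x'|lborel. \<nu> x' * decay n R (x' - x)) \<le> P"
  shows "(LINT x|lborel. LINT x'|lborel. \<nu> x * \<nu> x' * decay n R (x - x')) \<le> P * (LINT x|lborel. \<nu> x)"
proof -
  have C: "0 \<le> C" using \<nu>_bounds(1,2) order_trans by blast
  have "case_prod (\<lambda>x x'. \<nu> x * \<nu> x' * decay n R (x - x')) \<in> borel_measurable borel"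
    unfolding borel_prod[symmetric] by measurable
  then have i: "integrable (lborel \<Otimes>\<^sub>M lborel) (case_prod (\<lambda>x x'. \<nu> x * \<nu> x' * decay n R (x - x')))"
  proof (rule integrable_bounded_support_pair[where L = L and M = L and C = "C * C * 1"])
    fix x x' :: 'a
    have "\<bar>decay n R (x - x')\<bar> \<le> 1" using decay_bounds[of n R "x - x'"] by simp
    then show "norm (\<nu> x * \<nu> x' * decay n R (x - x')) \<le> C * C * 1"
      unfolding norm_mult using \<nu>_bounds C by (intro mult_mono mult_nonneg_nonneg) auto
  qed (auto simp: \<nu>_bounds(3))
  have i2: "integrable lborel \<nu>"
    by (rule integrable_bounded_support[where C = C and L = L]) (use \<nu>_bounds in auto)
  have "(LINT x|lborel. LINT x'|lborel. \<nu> x * \<nu> x' * decay n R (x - x')) \<le> (LINT x|lborel. P * \<nu> x)"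
  proof (rule Bochner_Integration.integral_mono)
    show "integrable lborel (\<lambda>x. LINT x'|lborel. \<nu> x * \<nu> x' * decay n R (x - x'))"
      using lborel_pair.integrable_fst[OF i] .
    show "integrable lborel (\<lambda>x. P * \<nu> x)" using i2 by simp
    fix x :: 'a
    have sym: "decay n R (x - x') = decay n R (x' - x)" for x x' :: 'a by (simp add: decay_def norm_minus_commute)
    have "(LINT x'|lborel. \<nu> x * \<nu> x' * decay n R (x - x')) = \<nu> x * (LINT x'|lborel. \<nu> x' * decay n R (x' - x))"
      by (simp add: mult.assoc sym[of x])
    also have "\<dots> \<le> \<nu> x * P" using P \<nu>_bounds by (intro mult_left_mono) auto
    finally show "(LINT x'|lborel. \<nu> x * \<nu> x' * decay n R (x - x')) \<le> P * \<nu> x" by (simp add: mult.commute)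
  qed
  then show ?thesis by simp
qed

lemma line_amplitude_const: "cmod z \<le> Q \<Longrightarrow> line_amplitude \<tau> Q (\<lambda>_. z)"
  unfolding line_amplitude_def by (intro allI impI exI[of _ "\<lambda>_. z"]) auto

lemma cap_point_norm:
  assumes \<tau>: "norm \<tau> = 1" and y: "y \<bullet> \<tau> \<le> 1" "1/2 \<le> y \<bullet> \<tau>" "norm (perp \<tau> y) < 1/1000"
  shows "norm y \<le> 1001/1000"
proof -
  have "y = (y \<bullet> \<tau>) *\<^sub>R \<tau> + perp \<tau> y" by (simp add: perp_def)
  then have "norm y \<le> norm ((y \<bullet> \<tau>) *\<^sub>R \<tau>) + norm (perp \<tau> y)" by (metis norm_triangle_ineq)
  then show ?thesis using y \<tau> by simp
qed

context layered_body
begin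

lemma measurable_N [measurable]: "S \<in> borel_measurable borel" "G \<in> borel_measurable borel"
  "N \<in> borel_measurable borel" "\<Theta> \<in> borel_measurable borel" "\<beta> \<in> borel_measurable borel"
  "bend \<tau> \<in> borel_measurable borel" "tang \<tau> \<in> borel_measurable borel" "slope_cutoff \<in> borel_measurable borel"
  "slope_cutoff_deriv \<in> borel_measurable borel" "steep_density \<tau> \<in> borel_measurable borel"
proof -
  show S[measurable]: "S \<in> borel_measurable borel" and G[measurable]: "G \<in> borel_measurable borel"
    and b[measurable]: "\<beta> \<in> borel_measurable borel"
    by (auto intro!: borel_measurable_continuous_onI continuous_intros)
  show N[measurable]: "N \<in> borel_measurable borel" unfolding N_def[abs_def] sgn_div_norm by measurable
  have [measurable]: "E a \<in> borel_measurable borel" for a by (auto intro!: borel_measurable_continuous_onI continuous_intros)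
  show [measurable]: "\<Theta> \<in> borel_measurable borel" unfolding \<Theta>_def[abs_def] by measurable
  show [measurable]: "slope_cutoff \<in> borel_measurable borel" "slope_cutoff_deriv \<in> borel_measurable borel"
    by (auto intro!: borel_measurable_continuous_onI continuous_intros)
  show [measurable]: "tang \<tau> \<in> borel_measurable borel" unfolding tang_def[abs_def] by measurable
  show [measurable]: "bend \<tau> \<in> borel_measurable borel" unfolding bend_def[abs_def] H_def by measurable
  show "steep_density \<tau> \<in> borel_measurable borel" unfolding steep_density_def[abs_def] by measurable
qed

text \<open>The bound comes from compactness and depends on \<open>J\<close> and
  \<open>\<kappa>\<close>; it serves integrability only and enters no final constant.\<close>

lemma \<beta>_G_bounded: "\<exists>C. \<forall>x. \<beta> x * norm (G x) \<le> C \<and> \<beta> x * \<Theta> x \<le> C"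
proof -
  have "compact ((\<lambda>x. \<beta> x * norm (G x)) ` layer)" "compact ((\<lambda>x. \<beta> x * \<Theta> x) ` layer)"
    by (intro compact_continuous_image compact_body continuous_intros; simp add: layerD)+
  then obtain C1 C2 where C: "\<And>x. x \<in> layer \<Longrightarrow> \<beta> x * norm (G x) \<le> C1" "\<And>x. x \<in> layer \<Longrightarrow> \<beta> x * \<Theta> x \<le> C2"
    by (auto dest!: compact_imp_bounded simp: bounded_iff) (meson abs_le_D1)
  have "\<beta> x * norm (G x) \<le> max 0 (max C1 C2) \<and> \<beta> x * \<Theta> x \<le> max 0 (max C1 C2)" for x
    using C[of x] \<beta>_outside[of x] by (cases "x \<in> layer") (auto simp: le_max_iff_disj)
  then show ?thesis by blast
qed

lemma \<beta>_integrable: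
  shows "integrable lborel (\<lambda>x. \<beta> x * norm (G x))" "integrable lborel (\<lambda>x. \<beta> x * \<Theta> x)"
    "integrable lborel (\<lambda>x. \<beta> x * norm (G x) * decay n R (x - x0))" "integrable lborel (\<lambda>x. \<beta> x * \<Theta> x * decay n R (x - x0))"
proof -
  obtain C where C: "\<And>x. \<beta> x * norm (G x) \<le> C" "\<And>x. \<beta> x * \<Theta> x \<le> C" using \<beta>_G_bounded by blast
  have out: "\<beta> x = 0" if "L < norm x" for x using \<beta>_outside[of x] layerD(3)[of x] that by force
  have nn: "0 \<le> \<beta> x * norm (G x)" "0 \<le> \<beta> x * \<Theta> x" for x using \<beta>_bounds \<Theta>_nonneg by auto
  show "integrable lborel (\<lambda>x. \<beta> x * norm (G x))"
    by (rule integrable_bounded_support[where C = C and L = L]) (use C nn out in auto)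
  show "integrable lborel (\<lambda>x. \<beta> x * \<Theta> x)"
    by (rule integrable_bounded_support[where C = C and L = L]) (use C nn out in auto)
  have d: "t * decay n R z \<le> C" if "0 \<le> t" "t \<le> C" for t and z :: 'a
    using mult_left_le[OF decay_bounds(2)[of n R z] that(1)] that by linarith
  have dn: "0 \<le> decay n R z" for z :: 'a by (rule less_imp_le[OF decay_bounds(1)])
  show "integrable lborel (\<lambda>x. \<beta> x * norm (G x) * decay n R (x - x0))"
    by (rule integrable_bounded_support[where C = C and L = L]) (use d[OF nn(1) C(1)] \<beta>_bounds dn out in \<open>auto simp: abs_mult\<close>)
  show "integrable lborel (\<lambda>x. \<beta> x * \<Theta> x * decay n R (x - x0))"
    by (rule integrable_bounded_support[where C = C and L = L]) (use d[OF nn(2) C(2)] \<beta>_bounds \<Theta>_nonneg dn out in \<open>auto simp: abs_mult\<close>)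
qed

text \<open>On the part of the layer with \<open>\<sigma> (\<tau> \<bullet> N)\<close> bounded below, \<open>S\<close> is monotone in direction \<open>\<tau>\<close>,
  so that two of its points are never nearly aligned in direction \<open>\<tau>\<close>.\<close>
lemma flat_pairs:
  assumes \<tau>: "norm \<tau> = 1" and R: "0 < R" and big: "\<And>x. x \<in> layer \<Longrightarrow> 8 * R \<le> norm (G x)"
    and x: "x \<in> layer" "1/8 \<le> \<sigma> * (\<tau> \<bullet> N x)" and x': "x' \<in> layer" "1/8 \<le> \<sigma> * (\<tau> \<bullet> N x')" and \<sigma>: "\<bar>\<sigma>\<bar> = 1"
  shows "\<bar>(x - x') \<bullet> \<tau>\<bar> \<le> 8 * norm (perp \<tau> (x - x')) + 1 / R"
proof -
  have *: "\<sigma> * (z \<bullet> \<tau>) \<le> 8 * norm (perp \<tau> z) + 1 / R"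
    if w: "w \<in> layer" "w + z \<in> layer" "1/8 \<le> \<sigma> * (\<tau> \<bullet> N w)" for w z
  proof -
    \<comment> \<open>Values of \<open>S\<close> on the layer lie between 1 and 2, whence the 1.
      Division by \<open>norm (G w) \<ge> 8 * R\<close> leaves a normal displacement of at most
      \<open>1 / (8 * R)\<close>, and division by the slope 1/8 turns this into
      \<open>1 / R\<close>.\<close>
    have "G w \<bullet> z \<le> 1" using S_convex[of w "w + z"] w by (auto simp: layer_def)
    then have Nz: "norm (G w) * (N w \<bullet> z) \<le> 1" by (subst (asm) norm_N(3)) simp
    have g: "8 * R \<le> norm (G w)" using big w by simp
    have "N w \<bullet> z \<le> 1 / (8 * R)"
    proof (cases "N w \<bullet> z \<le> 0")
      case True
      then show ?thesis using R by (simp add: order_trans)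
    next
      case False
      then have "8 * R * (N w \<bullet> z) \<le> norm (G w) * (N w \<bullet> z)" using g by (intro mult_right_mono) auto
      then show ?thesis using Nz R by (simp add: field_simps)
    qed
    moreover have "N w \<bullet> z = (\<sigma> * (\<tau> \<bullet> N w)) * (\<sigma> * (z \<bullet> \<tau>)) + N w \<bullet> perp \<tau> z"
    proof -
      have "\<sigma> * \<sigma> = 1" using \<sigma> by (metis abs_mult_self_eq mult_1)
      then have "(\<sigma> * (\<tau> \<bullet> N w)) * (\<sigma> * (z \<bullet> \<tau>)) = (\<tau> \<bullet> N w) * (z \<bullet> \<tau>)" by (simp add: algebra_simps)
      then show ?thesis by (simp add: perp_def inner_diff_right inner_commute)
    qed
    moreover have "\<bar>N w \<bullet> perp \<tau> z\<bar> \<le> norm (perp \<tau> z)"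
      using Cauchy_Schwarz_ineq2[of "N w" "perp \<tau> z"] norm_N(1) layerD(1)[OF w(1)] by simp
    ultimately have P: "(\<sigma> * (\<tau> \<bullet> N w)) * (\<sigma> * (z \<bullet> \<tau>)) \<le> norm (perp \<tau> z) + 1 / (8 * R)" by linarith
    show ?thesis
    proof (cases "\<sigma> * (z \<bullet> \<tau>) \<le> 0")
      case True
      then show ?thesis using R by (smt (verit) norm_ge_zero zero_le_divide_1_iff)
    next
      case False
      then have "(1/8) * (\<sigma> * (z \<bullet> \<tau>)) \<le> (\<sigma> * (\<tau> \<bullet> N w)) * (\<sigma> * (z \<bullet> \<tau>))" using w by (intro mult_right_mono) auto
      then have "(1/8) * (\<sigma> * (z \<bullet> \<tau>)) \<le> norm (perp \<tau> z) + 1 / (8 * R)" using P by (rule order_trans)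
      then have "8 * ((1/8) * (\<sigma> * (z \<bullet> \<tau>))) \<le> 8 * (norm (perp \<tau> z) + 1 / (8 * R))" by (rule mult_left_mono) simp
      then show ?thesis using R by simp
    qed
  qed
  have 1: "\<sigma> * ((x - x') \<bullet> \<tau>) \<le> 8 * norm (perp \<tau> (x - x')) + 1 / R"
    using *[of x' "x - x'"] x x' by simp
  have "perp \<tau> (x' - x) = - perp \<tau> (x - x')" by (simp add: perp_def inner_diff_left algebra_simps)
  then have 2: "- (\<sigma> * ((x - x') \<bullet> \<tau>)) \<le> 8 * norm (perp \<tau> (x - x')) + 1 / R"
    using *[of x "x' - x"] x x' by (simp add: inner_diff_left algebra_simps)
  have "\<bar>(x - x') \<bullet> \<tau>\<bar> = \<bar>\<sigma> * ((x - x') \<bullet> \<tau>)\<bar>" using \<sigma> by (simp add: abs_mult)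
  then show ?thesis using 1 2 by linarith
qed

text \<open>The sign \<open>\<sigma>\<close> separates the two sides of the body as seen along
  \<open>\<tau>\<close>: a point of the front and one of the back may be exactly aligned along
  \<open>\<tau>\<close>, two points of the same side may not.\<close>

definition flat_density :: "'a \<Rightarrow> real \<Rightarrow> 'a \<Rightarrow> real" where
  "flat_density \<tau> \<sigma> x = (if 0 < \<sigma> * (\<tau> \<bullet> N x) then \<beta> x * norm (G x) * ((\<tau> \<bullet> N x) - slope_cutoff (\<tau> \<bullet> N x)) else 0)"

text \<open>The amplitude is constant in \<open>y\<close>, so its continuation along lines is
  trivial. The inner kernel integral is at most the local surface mass \<open>P\<close>, the outer
  one at most the total surface mass.\<close>

lemma flat_energy:
  assumes n: "n = DIM('a) + 1" and \<tau>: "norm \<tau> = 1" and R: "0 < R" and big: "\<And>x. x \<in> layer \<Longrightarrow> 8 * R \<le> norm (G x)"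
    and \<sigma>: "\<bar>\<sigma>\<bar> = 1" and P: "\<And>x0. (LINT x|lborel. \<beta> x * norm (G x) * decay n R (x - x0)) \<le> P"
  shows "(LINT y|lborel. cap_weight n \<tau> y * (cmod (LINT x|lborel. of_real (flat_density \<tau> \<sigma> x) * wave R (sgn y) x))\<^sup>2)
    \<le> kernel_const TYPE('a) n * (P * (LINT x|lborel. \<beta> x * norm (G x)))"
proof -
  obtain C where C: "\<And>x. \<beta> x * norm (G x) \<le> C" using \<beta>_G_bounded by blast
  have "0 \<le> (LINT x|lborel. \<beta> x * norm (G x) * decay n R (x - 0))"
    by (intro integral_nonneg_AE AE_I2 mult_nonneg_nonneg \<beta>_bounds norm_ge_zero less_imp_le[OF decay_bounds(1)])
  then have P0: "0 \<le> P" using P[of 0] by linarith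
  define \<nu> where "\<nu> x = \<bar>flat_density \<tau> \<sigma> x\<bar>" for x
  have fm[measurable]: "flat_density \<tau> \<sigma> \<in> borel_measurable borel" unfolding flat_density_def[abs_def] by measurable
  have \<nu>m[measurable]: "\<nu> \<in> borel_measurable borel" unfolding \<nu>_def[abs_def] by measurable
  have \<nu>le: "\<nu> x \<le> \<beta> x * norm (G x)" for x
  proof (cases "x \<in> layer")
    case True
    let ?t = "\<tau> \<bullet> N x"
    have "\<bar>?t - slope_cutoff ?t\<bar> \<le> 1"
      using slope_cutoff_bounds(2)[of ?t] tang_props(3)[OF \<tau> layerD(1)[OF True]] by linarith
    then have "(\<beta> x * norm (G x)) * \<bar>?t - slope_cutoff ?t\<bar> \<le> \<beta> x * norm (G x)"
      using \<beta>_bounds by (intro mult_left_le) auto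
    then show ?thesis using \<beta>_bounds by (simp add: \<nu>_def flat_density_def abs_mult)
  qed (use \<beta>_outside in \<open>simp add: \<nu>_def flat_density_def\<close>)
  have nz: "x \<in> layer \<and> 1/8 \<le> \<sigma> * (\<tau> \<bullet> N x)" if "\<nu> x \<noteq> 0" for x
  proof -
    let ?t = "\<tau> \<bullet> N x"
    have f: "0 < \<sigma> * ?t" "\<beta> x \<noteq> 0" "?t \<noteq> slope_cutoff ?t" using that by (auto simp: \<nu>_def flat_density_def split: if_splits)
    have "1/50 < ?t\<^sup>2" using f slope_cutoff_bounds(6)[of ?t] by force
    moreover have "\<sigma>\<^sup>2 = 1" using \<sigma> by (metis power2_abs power_one)
    moreover have "(1/8)\<^sup>2 = (1/64 :: real)" by (simp add: power2_eq_square)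
    ultimately have "(1/8)\<^sup>2 \<le> (\<sigma> * ?t)\<^sup>2" unfolding power_mult_distrib by simp
    then have "1/8 \<le> \<sigma> * ?t" by (rule power2_le_imp_le) (use f in auto)
    then show ?thesis using f \<beta>_outside by blast
  qed
  have \<nu>0: "0 \<le> \<nu> x" "\<nu> x \<le> C" for x using \<nu>le[of x] C[of x] by (auto simp: \<nu>_def)
  have \<nu>L: "\<nu> x = 0" if "L < norm x" for x using nz[of x] layerD(3)[of x] that by force
  have "(LINT y|lborel. cap_weight n \<tau> y * (cmod (LINT x|lborel. of_real (flat_density \<tau> \<sigma> x) * wave R (sgn y) x))\<^sup>2)
    \<le> kernel_const TYPE('a) n * (LINT x|lborel. LINT x'|lborel. \<nu> x * \<nu> x' * decay n R (x - x'))"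
  proof (rule cap_energy_bound[OF _ \<tau> R _ \<nu>m \<nu>0 \<nu>L])
    show "case_prod (\<lambda>x y::'a. flat_density \<tau> \<sigma> x) \<in> borel_measurable borel"
      unfolding borel_prod[symmetric] by measurable
    show "line_amplitude \<tau> (\<nu> x * \<nu> x') (\<lambda>y. of_real (flat_density \<tau> \<sigma> x * flat_density \<tau> \<sigma> x'))" for x x'
      by (rule line_amplitude_const) (simp add: \<nu>_def norm_mult abs_mult)
    show "\<bar>(x - x') \<bullet> \<tau>\<bar> \<le> 8 * norm (perp \<tau> (x - x')) + 1 / R" if "\<nu> x \<noteq> 0" "\<nu> x' \<noteq> 0" for x x'
      using flat_pairs[OF \<tau> R big _ _ _ _ \<sigma>] nz[OF that(1)] nz[OF that(2)] by blast
  qed (auto simp: \<nu>_def n)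
  also have "\<dots> \<le> kernel_const TYPE('a) n * (P * (LINT x|lborel. \<nu> x))"
  proof (intro mult_left_mono kernel_const_nonneg double_integral_le[OF \<nu>m \<nu>0 \<nu>L])
    fix x
    have "(LINT x'|lborel. \<nu> x' * decay n R (x' - x)) \<le> (LINT x'|lborel. \<beta> x' * norm (G x') * decay n R (x' - x))"
    proof (rule Bochner_Integration.integral_mono)
      show "integrable lborel (\<lambda>x'. \<beta> x' * norm (G x') * decay n R (x' - x))" by (rule \<beta>_integrable)
      show "integrable lborel (\<lambda>x'. \<nu> x' * decay n R (x' - x))"
        by (rule Bochner_Integration.integrable_bound[OF \<beta>_integrable(3)[of n R x]])
           (use \<nu>le \<nu>0 \<beta>_bounds less_imp_le[OF decay_bounds(1)] in \<open>auto simp: abs_mult intro!: AE_I2 mult_right_mono\<close>)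
      show "\<nu> x' * decay n R (x' - x) \<le> \<beta> x' * norm (G x') * decay n R (x' - x)" for x'
        using \<nu>le less_imp_le[OF decay_bounds(1)] by (intro mult_right_mono) auto
    qed
    then show "(LINT x'|lborel. \<nu> x' * decay n R (x' - x)) \<le> P" using P[of x] by linarith
  qed
  also have "\<dots> \<le> kernel_const TYPE('a) n * (P * (LINT x|lborel. \<beta> x * norm (G x)))"
  proof (intro mult_left_mono kernel_const_nonneg P0 Bochner_Integration.integral_mono)
    show "integrable lborel \<nu>" by (rule integrable_bounded_support[where C = C and L = L]) (use \<nu>0 \<nu>L in auto)
  qed (use \<nu>le \<beta>_integrable in auto)
  finally show ?thesis .
qed

end

section \<open>Energy of the steep part\<close>

text \<open>The kernel contains the product of the amplitudes at two points \<open>x\<close> and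
  \<open>x'\<close>.\<close>

lemma line_amplitude_mult:
  assumes "line_amplitude \<tau> Q1 A1" "line_amplitude \<tau> Q2 A2"
  shows "line_amplitude \<tau> (Q1 * Q2) (\<lambda>y. A1 y * A2 y)"
  unfolding line_amplitude_def
proof (intro allI impI)
  fix e p :: 'a
  assume h: "norm e = 1" "e \<bullet> \<tau> = 0" "p \<bullet> e = 0" "1 / 2 \<le> p \<bullet> \<tau>" "p \<bullet> \<tau> \<le> 1" "norm (perp \<tau> p) < 1 / 1000"
  obtain q1 where q1: "q1 holomorphic_on ball 0 (1/500)" "\<And>s. \<bar>s\<bar> < 1/500 \<Longrightarrow> q1 (of_real s) = A1 (p + s *\<^sub>R e)"
    "\<And>s. s \<in> ball 0 (1/500) \<Longrightarrow> cmod (q1 s) \<le> Q1"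
    using assms(1) h unfolding line_amplitude_def by blast
  obtain q2 where q2: "q2 holomorphic_on ball 0 (1/500)" "\<And>s. \<bar>s\<bar> < 1/500 \<Longrightarrow> q2 (of_real s) = A2 (p + s *\<^sub>R e)"
    "\<And>s. s \<in> ball 0 (1/500) \<Longrightarrow> cmod (q2 s) \<le> Q2"
    using assms(2) h unfolding line_amplitude_def by blast
  have "cmod (q1 s * q2 s) \<le> Q1 * Q2" if "s \<in> ball 0 (1/500)" for s
    unfolding norm_mult using q1(3)[OF that] q2(3)[OF that] order_trans[OF norm_ge_zero q1(3)[OF that]] by (intro mult_mono) auto
  then show "\<exists>q. q holomorphic_on ball 0 (1 / 500) \<and> (\<forall>s. \<bar>s\<bar> < 1 / 500 \<longrightarrow> q (of_real s) = A1 (p + s *\<^sub>R e) * A2 (p + s *\<^sub>R e)) \<and> (\<forall>s\<in>ball 0 (1 / 500). cmod (q s) \<le> Q1 * Q2)"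
    using q1 q2 by (intro exI[of _ "\<lambda>s. q1 s * q2 s"]) (auto intro!: holomorphic_intros)
qed

lemma cap_energy_integrable:
  fixes a :: "'a::euclidean_space \<Rightarrow> 'a \<Rightarrow> real" and \<nu> :: "'a \<Rightarrow> real"
  assumes n: "0 < n" and \<tau>: "norm \<tau> = 1"
    and a: "case_prod a \<in> borel_measurable borel" and \<nu>: "integrable lborel \<nu>" 
    and bound: "\<And>x y. cap_weight n \<tau> y \<noteq> 0 \<Longrightarrow> \<bar>a x y\<bar> \<le> \<nu> x"
  shows "integrable lborel (\<lambda>y. cap_weight n \<tau> y * (cmod (LINT x|lborel. of_real (a x y) * wave R (sgn y) x))\<^sup>2)"
proof -
  note [measurable] = sgn_borel_measurable
  have am[measurable]: "case_prod a \<in> borel_measurable (borel \<Otimes>\<^sub>M borel)" using a by (simp add: borel_prod)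
  have "(\<lambda>(y, x). of_real (a x y) * wave R (sgn y) x) \<in> borel_measurable (borel \<Otimes>\<^sub>M lborel)"
    unfolding wave_def by measurable
  then have [measurable]: "(\<lambda>y. LINT x|lborel. of_real (a x y) * wave R (sgn y) x) \<in> borel_measurable borel"
    by (rule lborel.borel_measurable_lebesgue_integral)
  show ?thesis
  proof (rule integrable_bounded_support[where C = "(LINT x|lborel. \<nu> x)\<^sup>2" and L = 2])
    fix y :: 'a
    show "norm (cap_weight n \<tau> y * (cmod (LINT x|lborel. of_real (a x y) * wave R (sgn y) x))\<^sup>2) \<le> (LINT x|lborel. \<nu> x)\<^sup>2"
    proof (cases "cap_weight n \<tau> y = 0")
      case False
      have "cmod (LINT x|lborel. of_real (a x y) * wave R (sgn y) x) \<le> (LINT x|lborel. \<nu> x)"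
      proof (rule Bochner_Integration.integral_norm_bound_integral)
        show "integrable lborel (\<lambda>x. of_real (a x y) * wave R (sgn y) x)"
        proof (rule Bochner_Integration.integrable_bound[OF \<nu>])
          show "(\<lambda>x. of_real (a x y) * wave R (sgn y) x) \<in> borel_measurable lborel"
            unfolding wave_def using measurable_compose[of "\<lambda>x. (x, y)" borel "borel \<Otimes>\<^sub>M borel" "case_prod a" borel] by simp
          show "AE x in lborel. cmod (of_real (a x y) * wave R (sgn y) x) \<le> norm (\<nu> x)"
            using order_trans[OF bound[OF False] abs_ge_self] by (intro AE_I2) (simp add: norm_mult)
        qed
      qed (use bound[OF False] \<nu> in \<open>auto simp: norm_mult\<close>)
      then have "(cmod (LINT x|lborel. of_real (a x y) * wave R (sgn y) x))\<^sup>2 \<le> (LINT x|lborel. \<nu> x)\<^sup>2"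
        by (intro power_mono) auto
      then show ?thesis using cap_weight_bounds[of n \<tau> y] by (simp add: abs_mult mult_le_one order_trans[OF mult_left_le_one_le])
    qed simp
    show "cap_weight n \<tau> y * (cmod (LINT x|lborel. of_real (a x y) * wave R (sgn y) x))\<^sup>2 = 0" if "2 < norm y"
      using cap_weight_support(4)[OF \<tau> n, of y] that by force
  qed measurable
qed

text \<open>\<open>C1\<close>, \<open>C2\<close> belong to the local and \<open>T1\<close>,
  \<open>T2\<close> to the total masses of surface and curvature; 13 stems from
  \<open>flux_decomposition\<close>, and 40000000 is 2 * 5 * 2000 * 2000. Neither \<open>J\<close>
  nor \<open>\<kappa>\<close> occurs.\<close>

definition cap_bound_const :: "'a::euclidean_space itself \<Rightarrow> real \<Rightarrow> real \<Rightarrow> real \<Rightarrow> real" where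
  "cap_bound_const T c L Cd =
    (let d = real DIM('a); n = DIM('a) + 1; C1 = (d + L * real n) / c * Cd; C2 = (1 + d + 2 * L * real n) / c * C1;
         T1 = d / c * measure lborel (cball (0::'a) L); T2 = (1 + d) / c * T1
     in 13 * kernel_const T n * (2 * (C1 * T1) + 40000000 * L * (C2 * T2)))"

context layered_body
begin

text \<open>\<open>y \<bullet> \<tau>\<close> is at least 1/2, and removing the normal part costs at
  most \<open>(1/5) * (1001/1000)\<close>.\<close>

lemma tang_cap_ge:
  assumes \<tau>: "norm \<tau> = 1" and x: "x \<in> layer" "(\<tau> \<bullet> N x)\<^sup>2 \<le> 1/25"
    and y: "y \<bullet> \<tau> \<le> 1" "1/2 \<le> y \<bullet> \<tau>" "norm (perp \<tau> y) < 1/1000"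
  shows "29/100 \<le> tang \<tau> x \<bullet> y"
proof -
  have "\<bar>\<tau> \<bullet> N x\<bar> \<le> 1/5"
  proof -
    have "(\<tau> \<bullet> N x)\<^sup>2 \<le> (1/5)\<^sup>2" using x by (simp add: power2_eq_square)
    then show ?thesis by (metis abs_le_square_iff abs_of_nonneg zero_le_divide_1_iff zero_le_numeral)
  qed
  moreover have "\<bar>N x \<bullet> y\<bar> \<le> 1001/1000"
    using Cauchy_Schwarz_ineq2[of "N x" y] norm_N(1)[OF layerD(1)[OF x(1)]] cap_point_norm[OF \<tau> y] by simp
  ultimately have "\<bar>(\<tau> \<bullet> N x) * (N x \<bullet> y)\<bar> \<le> (1/5) * (1001/1000)" unfolding abs_mult by (intro mult_mono) auto
  moreover have "tang \<tau> x \<bullet> y = y \<bullet> \<tau> - (\<tau> \<bullet> N x) * (N x \<bullet> y)"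
    by (simp add: tang_def inner_diff_left inner_commute[of y \<tau>])
  ultimately show ?thesis using y by linarith
qed

text \<open>On the line \<open>p + s *\<^sub>R e\<close> the two inner products are affine in
  \<open>s\<close>, so \<open>s\<close> may be complex. For \<open>cmod s < 1/500\<close> the
  denominator stays above 1/4 before squaring and the numerator below
  \<open>80 * \<Theta> x\<close>, and 80 * 16 is less than 2000.\<close>

lemma steep_amplitude:
  assumes \<tau>: "norm \<tau> = 1" and x: "x \<in> layer" "(\<tau> \<bullet> N x)\<^sup>2 \<le> 1/25"
  shows "line_amplitude \<tau> (2000 * \<Theta> x) (\<lambda>y. of_real ((steep_density \<tau> x \<bullet> y) / (tang \<tau> x \<bullet> y)\<^sup>2))"
    and "cap_weight n \<tau> y \<noteq> 0 \<Longrightarrow> 0 < n \<Longrightarrow> \<bar>(steep_density \<tau> x \<bullet> y) / (tang \<tau> x \<bullet> y)\<^sup>2\<bar> \<le> 2000 * \<Theta> x"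
proof -
  let ?M = "steep_density \<tau> x" and ?T = "tang \<tau> x"
  have M: "norm ?M \<le> 40 * \<Theta> x" using norm_steep_density[OF \<tau> layerD(1)[OF x(1)]] .
  have T: "norm ?T \<le> 1" using tang_props(2)[OF \<tau> layerD(1)[OF x(1)]] .
  have quot: "a / b\<^sup>2 \<le> 2000 * \<Theta> x" if "0 \<le> a" "a \<le> 80 * \<Theta> x" "1/4 \<le> b" for a b :: real
  proof -
    have "(1/4)\<^sup>2 \<le> b\<^sup>2" using that by (intro power_mono) auto
    then have "a / b\<^sup>2 \<le> (80 * \<Theta> x) / (1/4)\<^sup>2" using that by (intro frac_le) auto
    then show ?thesis using \<Theta>_nonneg[of x] by (simp add: power2_eq_square)
  qed
  show "line_amplitude \<tau> (2000 * \<Theta> x) (\<lambda>y. of_real ((?M \<bullet> y) / (?T \<bullet> y)\<^sup>2))"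
    unfolding line_amplitude_def
  proof (intro allI impI)
    fix e p :: 'a
    assume h: "norm e = 1" "e \<bullet> \<tau> = 0" "p \<bullet> e = 0" "1 / 2 \<le> p \<bullet> \<tau>" "p \<bullet> \<tau> \<le> 1" "norm (perp \<tau> p) < 1 / 1000"
    have Tp: "29/100 \<le> ?T \<bullet> p" using tang_cap_ge[OF \<tau> x] h by blast
    have np: "norm p \<le> 1001/1000" using cap_point_norm[OF \<tau>] h by blast
    define q where "q s = (of_real (?M \<bullet> p) + s * of_real (?M \<bullet> e)) / (of_real (?T \<bullet> p) + s * of_real (?T \<bullet> e))\<^sup>2" for s :: complex
    have den: "1/4 \<le> cmod (of_real (?T \<bullet> p) + s * of_real (?T \<bullet> e))" if "s \<in> ball 0 (1/500)" for s
    proof -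
      have "\<bar>?T \<bullet> e\<bar> \<le> 1" using Cauchy_Schwarz_ineq2[of ?T e] h T by simp
      then have "cmod (s * of_real (?T \<bullet> e)) \<le> (1/500) * 1"
        unfolding norm_mult using that by (intro mult_mono) auto
      moreover have "cmod (of_real (?T \<bullet> p)) - cmod (s * of_real (?T \<bullet> e)) \<le> cmod (of_real (?T \<bullet> p) + s * of_real (?T \<bullet> e))"
        by (rule norm_diff_ineq)
      ultimately show ?thesis using Tp by simp
    qed
    have num: "cmod (of_real (?M \<bullet> p) + s * of_real (?M \<bullet> e)) \<le> 80 * \<Theta> x" if "s \<in> ball 0 (1/500)" for s
    proof -
      have "\<bar>?M \<bullet> p\<bar> \<le> (40 * \<Theta> x) * (1001/1000)"
        using Cauchy_Schwarz_ineq2[of ?M p] mult_mono[OF M np] \<Theta>_nonneg[of x] by simp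
      moreover have "\<bar>?M \<bullet> e\<bar> \<le> 40 * \<Theta> x" using Cauchy_Schwarz_ineq2[of ?M e] h M by simp
      then have "cmod (s * of_real (?M \<bullet> e)) \<le> (1/500) * (40 * \<Theta> x)"
        unfolding norm_mult using that by (intro mult_mono) auto
      ultimately show ?thesis
        using norm_triangle_ineq[of "of_real (?M \<bullet> p)" "s * of_real (?M \<bullet> e)"] \<Theta>_nonneg[of x] by simp
    qed
    have "q holomorphic_on ball 0 (1/500)"
      unfolding q_def using den by (intro holomorphic_intros) fastforce
    moreover have "q (of_real s) = of_real ((?M \<bullet> (p + s *\<^sub>R e)) / (?T \<bullet> (p + s *\<^sub>R e))\<^sup>2)" for s
      by (simp add: q_def inner_add_right)
    moreover have "cmod (q s) \<le> 2000 * \<Theta> x" if "s \<in> ball 0 (1/500)" for s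
      unfolding q_def norm_divide norm_power using num[OF that] den[OF that] by (intro quot) auto
    ultimately show "\<exists>q. q holomorphic_on ball 0 (1 / 500) \<and> (\<forall>s. \<bar>s\<bar> < 1 / 500 \<longrightarrow> q (of_real s) = of_real ((?M \<bullet> (p + s *\<^sub>R e)) / (?T \<bullet> (p + s *\<^sub>R e))\<^sup>2)) \<and> (\<forall>s\<in>ball 0 (1 / 500). cmod (q s) \<le> 2000 * \<Theta> x)"
      by blast
  qed
  show "\<bar>(?M \<bullet> y) / (?T \<bullet> y)\<^sup>2\<bar> \<le> 2000 * \<Theta> x" if w: "cap_weight n \<tau> y \<noteq> 0" and n: "0 < n"
  proof -
    note y = cap_weight_support[OF \<tau> n w]
    have Ty: "29/100 \<le> ?T \<bullet> y" using tang_cap_ge[OF \<tau> x] y by blast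
    have ny: "norm y \<le> 1001/1000" using cap_point_norm[OF \<tau>] y by blast
    have "\<bar>?M \<bullet> y\<bar> \<le> (40 * \<Theta> x) * (1001/1000)"
      using Cauchy_Schwarz_ineq2[of ?M y] mult_mono[OF M ny] \<Theta>_nonneg[of x] by simp
    then show ?thesis using quot[of "\<bar>?M \<bullet> y\<bar>" "?T \<bullet> y"] Ty \<Theta>_nonneg[of x] by (simp add: abs_divide)
  qed
qed

text \<open>Evaluated at \<open>y\<close> in place of \<open>sgn y\<close>: by homogeneity of degree
  -1 this changes the value by a factor \<open>norm y\<close> only, and it makes the amplitude
  rational along lines.\<close>

definition steep_field :: "'a \<Rightarrow> 'a \<Rightarrow> 'a \<Rightarrow> real" where
  "steep_field \<tau> x y = \<beta> x * ((steep_density \<tau> x \<bullet> y) / (tang \<tau> x \<bullet> y)\<^sup>2)"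

text \<open>Restricted to the support of the cutoff, because elsewhere
  \<open>tang \<tau> x \<bullet> y\<close> has no lower bound; the density is zero there.\<close>

definition steep_majorant :: "'a \<Rightarrow> 'a \<Rightarrow> real" where
  "steep_majorant \<tau> x = (if (\<tau> \<bullet> N x)\<^sup>2 \<le> 1/25 then 2000 * (\<beta> x * \<Theta> x) else 0)"

lemma steep_field_measurable: "case_prod (steep_field \<tau>) \<in> borel_measurable borel"
  unfolding steep_field_def[abs_def] borel_prod[symmetric] by measurable

lemma steep_majorant_props:
  shows "steep_majorant \<tau> \<in> borel_measurable borel" "0 \<le> steep_majorant \<tau> x" "steep_majorant \<tau> x \<le> 2000 * (\<beta> x * \<Theta> x)"
    and "L < norm x \<Longrightarrow> steep_majorant \<tau> x = 0"
    and "norm \<tau> = 1 \<Longrightarrow> steep_majorant \<tau> x = 0 \<Longrightarrow> steep_field \<tau> x y = 0"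
    and "norm \<tau> = 1 \<Longrightarrow> cap_weight n \<tau> y \<noteq> 0 \<Longrightarrow> 0 < n \<Longrightarrow> \<bar>steep_field \<tau> x y\<bar> \<le> steep_majorant \<tau> x"
    and "norm \<tau> = 1 \<Longrightarrow> line_amplitude \<tau> (steep_majorant \<tau> x) (\<lambda>y. of_real (steep_field \<tau> x y))"
proof -
  show "steep_majorant \<tau> \<in> borel_measurable borel" unfolding steep_majorant_def[abs_def] by measurable
  show "0 \<le> steep_majorant \<tau> x" "steep_majorant \<tau> x \<le> 2000 * (\<beta> x * \<Theta> x)"
    using \<beta>_bounds \<Theta>_nonneg by (auto simp: steep_majorant_def)
  show "steep_majorant \<tau> x = 0" if "L < norm x"
    using \<beta>_outside[of x] layerD(3)[of x] that by (force simp: steep_majorant_def)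
  show z: "steep_field \<tau> x y = 0" if \<tau>: "norm \<tau> = 1" and "steep_majorant \<tau> x = 0" for y
  proof (cases "x \<in> layer \<and> \<beta> x \<noteq> 0")
    case True
    have "steep_density \<tau> x = 0"
    proof (cases "(\<tau> \<bullet> N x)\<^sup>2 \<le> 1/25")
      case t: True
      then have "\<Theta> x = 0" using that True by (simp add: steep_majorant_def)
      then show ?thesis using norm_steep_density[OF \<tau> layerD(1)[of x]] True by simp
    next
      case False
      then show ?thesis using steep_density_support[of \<tau> x] by simp
    qed
    then show ?thesis by (simp add: steep_field_def)
  next
    case False
    then show ?thesis using \<beta>_outside[of x] by (auto simp: steep_field_def)
  qed
  have cs: "steep_majorant \<tau> x = 0 \<or> (x \<in> layer \<and> (\<tau> \<bullet> N x)\<^sup>2 \<le> 1/25 \<and> steep_majorant \<tau> x = \<beta> x * (2000 * \<Theta> x))"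
    using \<beta>_outside[of x] by (auto simp: steep_majorant_def)
  show "\<bar>steep_field \<tau> x y\<bar> \<le> steep_majorant \<tau> x" if "norm \<tau> = 1" "cap_weight n \<tau> y \<noteq> 0" "0 < n"
    using cs
  proof
    assume "steep_majorant \<tau> x = 0" then show ?thesis using z[OF that(1)] by simp
  next
    assume a: "x \<in> layer \<and> (\<tau> \<bullet> N x)\<^sup>2 \<le> 1/25 \<and> steep_majorant \<tau> x = \<beta> x * (2000 * \<Theta> x)"
    then have "\<bar>(steep_density \<tau> x \<bullet> y) / (tang \<tau> x \<bullet> y)\<^sup>2\<bar> \<le> 2000 * \<Theta> x"
      using steep_amplitude(2)[OF that(1) _ _ that(2,3)] by blast
    from mult_left_mono[OF this \<beta>_bounds(1)[of x]] show ?thesis using a \<beta>_bounds(1)[of x]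
      by (simp add: steep_field_def abs_mult)
  qed
  show "line_amplitude \<tau> (steep_majorant \<tau> x) (\<lambda>y. of_real (steep_field \<tau> x y))" if "norm \<tau> = 1"
    using cs
  proof
    assume "steep_majorant \<tau> x = 0"
    then show ?thesis using z[OF that] line_amplitude_const[of 0 0 \<tau>] by simp
  next
    assume a: "x \<in> layer \<and> (\<tau> \<bullet> N x)\<^sup>2 \<le> 1/25 \<and> steep_majorant \<tau> x = \<beta> x * (2000 * \<Theta> x)"
    have "line_amplitude \<tau> (\<beta> x * (2000 * \<Theta> x)) (\<lambda>y. of_real (\<beta> x) * of_real ((steep_density \<tau> x \<bullet> y) / (tang \<tau> x \<bullet> y)\<^sup>2))"
      by (rule line_amplitude_mult[OF line_amplitude_const steep_amplitude(1)[OF that]]) (use a \<beta>_bounds in auto)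
    then show ?thesis using a by (simp add: steep_field_def)
  qed
qed

text \<open>The frequencies in the cap are almost parallel to \<open>\<tau>\<close>, so nothing is lost by treating slabs
  of width \<open>1/R\<close> orthogonal to \<open>\<tau>\<close> separately and summing with Cauchy--Schwarz; within a slab
  the kernel decays.\<close>
lemma steep_energy:
  assumes n: "n = DIM('a) + 1" and \<tau>: "norm \<tau> = 1" and R: "1 \<le> R"
    and P: "\<And>x0. (LINT x|lborel. \<beta> x * \<Theta> x * decay n R (x - x0)) \<le> P"
  shows "(LINT y|lborel. cap_weight n \<tau> y * (cmod (LINT x|lborel. of_real (steep_field \<tau> x y) * wave R (sgn y) x))\<^sup>2)
    \<le> 5 * L * R * (kernel_const TYPE('a) n * (2000 * P * (2000 * (LINT x|lborel. \<beta> x * \<Theta> x))))"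
    and "integrable lborel (\<lambda>y. cap_weight n \<tau> y * (cmod (LINT x|lborel. of_real (steep_field \<tau> x y) * wave R (sgn y) x))\<^sup>2)"
proof -
  have n0: "0 < n" using n by simp
  have R0: "0 < R" using R by simp
  obtain C where C: "\<And>x. \<beta> x * \<Theta> x \<le> C" using \<beta>_G_bounded by blast
  have "0 \<le> (LINT x|lborel. \<beta> x * \<Theta> x * decay n R (x - 0))"
    by (intro integral_nonneg_AE AE_I2 mult_nonneg_nonneg \<beta>_bounds \<Theta>_nonneg less_imp_le[OF decay_bounds(1)])
  then have P0: "0 \<le> P" using P[of 0] by linarith
  let ?\<nu> = "steep_majorant \<tau>" and ?a = "steep_field \<tau>"
  note sm = steep_majorant_props[where \<tau> = \<tau>]
  note [measurable] = sm(1) steep_field_measurable[of \<tau>]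
  define slab where "slab x = \<lfloor>R * (x \<bullet> \<tau>)\<rfloor>" for x :: 'a
  have [measurable]: "Measurable.pred borel (\<lambda>x. slab x = j)" for j
    unfolding slab_def by measurable
  define \<nu> where "\<nu> j x = (if slab x = j then ?\<nu> x else 0)" for j x
  define a where "a j x y = (if slab x = j then ?a x y else 0)" for j x y
  have \<nu>m[measurable]: "\<nu> j \<in> borel_measurable borel" for j unfolding \<nu>_def[abs_def] by measurable
  have am: "case_prod (a j) \<in> borel_measurable borel" for j
  proof -
    have [measurable]: "case_prod ?a \<in> borel_measurable (borel \<Otimes>\<^sub>M borel)"
      using steep_field_measurable[of \<tau>] by (simp add: borel_prod)
    show ?thesis unfolding a_def[abs_def] borel_prod[symmetric] by measurable
  qed
  have \<nu>b: "0 \<le> \<nu> j x" "\<nu> j x \<le> 2000 * C" "L < norm x \<Longrightarrow> \<nu> j x = 0" "\<nu> j x \<le> ?\<nu> x" for j x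
    using sm(2,3,4)[of x] C[of x] by (auto simp: \<nu>_def)
  have \<nu>i: "integrable lborel (\<nu> j)" for j
    by (rule integrable_bounded_support[where C = "2000 * C" and L = L]) (use \<nu>b in auto)
  have ab: "\<bar>a j x y\<bar> \<le> \<nu> j x" if "cap_weight n \<tau> y \<noteq> 0" for j x y
    using sm(6)[OF \<tau> that n0] by (simp add: a_def \<nu>_def)
  have e: "(LINT y|lborel. cap_weight n \<tau> y * (cmod (LINT x|lborel. of_real (a j x y) * wave R (sgn y) x))\<^sup>2)
     \<le> kernel_const TYPE('a) n * (2000 * P * (LINT x|lborel. \<nu> j x))" for j
  proof -
    have "(LINT y|lborel. cap_weight n \<tau> y * (cmod (LINT x|lborel. of_real (a j x y) * wave R (sgn y) x))\<^sup>2)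
      \<le> kernel_const TYPE('a) n * (LINT x|lborel. LINT x'|lborel. \<nu> j x * \<nu> j x' * decay n R (x - x'))"
    proof (rule cap_energy_bound[where L = L, OF n0 \<tau> R0 am \<nu>m \<nu>b(1,2,3)])
      show "a j x y = 0" if "\<nu> j x = 0" for x y using that sm(5)[OF \<tau>] by (auto simp: a_def \<nu>_def split: if_splits)
      show "line_amplitude \<tau> (\<nu> j x * \<nu> j x') (\<lambda>y. of_real (a j x y * a j x' y))" for x x'
      proof -
        have "line_amplitude \<tau> (\<nu> j x) (\<lambda>y. of_real (a j x y))" for x
          using sm(7)[OF \<tau>] line_amplitude_const[of 0 0 \<tau>] by (simp add: a_def \<nu>_def)
        from line_amplitude_mult[OF this this] show ?thesis by simp
      qed
      show "\<bar>(x - x') \<bullet> \<tau>\<bar> \<le> 8 * norm (perp \<tau> (x - x')) + 1 / R" if "\<nu> j x \<noteq> 0" "\<nu> j x' \<noteq> 0" for x x'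
      proof -
        have "slab x = j" "slab x' = j" using that by (auto simp: \<nu>_def split: if_splits)
        then have "\<bar>R * (x \<bullet> \<tau>) - R * (x' \<bullet> \<tau>)\<bar> \<le> 1" unfolding slab_def by linarith
        then have "R * \<bar>(x - x') \<bullet> \<tau>\<bar> \<le> 1"
          using R0 by (simp add: inner_diff_left right_diff_distrib[symmetric] abs_mult)
        then have "\<bar>(x - x') \<bullet> \<tau>\<bar> \<le> 1 / R" using R0 by (simp add: field_simps)
        then show ?thesis by (simp add: add_increasing)
      qed
    qed (use ab in auto)
    also have "\<dots> \<le> kernel_const TYPE('a) n * (2000 * P * (LINT x|lborel. \<nu> j x))"
    proof (intro mult_left_mono kernel_const_nonneg double_integral_le[where L = L, OF \<nu>m \<nu>b(1,2,3)])
      fix x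
      have "(LINT x'|lborel. \<nu> j x' * decay n R (x' - x)) \<le> (LINT x'|lborel. 2000 * (\<beta> x' * \<Theta> x' * decay n R (x' - x)))"
      proof (rule Bochner_Integration.integral_mono)
        have le: "\<nu> j x' * decay n R (x' - x) \<le> 2000 * (\<beta> x' * \<Theta> x' * decay n R (x' - x))" for x'
          using mult_right_mono[OF order_trans[OF \<nu>b(4)[of j x'] sm(3)[of x']] less_imp_le[OF decay_bounds(1)[of n R "x' - x"]]]
          by (simp add: mult.assoc)
        show i: "integrable lborel (\<lambda>x'. 2000 * (\<beta> x' * \<Theta> x' * decay n R (x' - x)))" using \<beta>_integrable(4) by simp
        show "integrable lborel (\<lambda>x'. \<nu> j x' * decay n R (x' - x))"
        proof (rule Bochner_Integration.integrable_bound[OF i])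
          show "AE x' in lborel. norm (\<nu> j x' * decay n R (x' - x)) \<le> norm (2000 * (\<beta> x' * \<Theta> x' * decay n R (x' - x)))"
          proof (rule AE_I2)
            fix x'
            have "0 \<le> \<nu> j x' * decay n R (x' - x)" using \<nu>b(1) less_imp_le[OF decay_bounds(1)] by (intro mult_nonneg_nonneg) auto
            then show "norm (\<nu> j x' * decay n R (x' - x)) \<le> norm (2000 * (\<beta> x' * \<Theta> x' * decay n R (x' - x)))"
              using le[of x'] by (simp only: real_norm_def abs_of_nonneg)
          qed
        qed measurable
      qed (use mult_right_mono[OF order_trans[OF \<nu>b(4) sm(3)] less_imp_le[OF decay_bounds(1)]] in \<open>simp add: mult.assoc\<close>)
      also have "\<dots> = 2000 * (LINT x'|lborel. \<beta> x' * \<Theta> x' * decay n R (x' - x))" by simp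
      also have "\<dots> \<le> 2000 * P" using P[of x] by simp
      finally show "(LINT x'|lborel. \<nu> j x' * decay n R (x' - x)) \<le> 2000 * P" .
    qed
    finally show ?thesis .
  qed
  have ei: "integrable lborel (\<lambda>y. cap_weight n \<tau> y * (cmod (LINT x|lborel. of_real (a j x y) * wave R (sgn y) x))\<^sup>2)" for j
    by (rule cap_energy_integrable[OF n0 \<tau> am \<nu>i ab])
  have \<nu>le: "?\<nu> x \<le> 2000 * C" for x using sm(3)[of x] C[of x] by linarith
  have \<nu>ti: "integrable lborel ?\<nu>"
    by (rule integrable_bounded_support[where C = "2000 * C" and L = L]) (use sm(2,4) \<nu>le in auto)
  show total_int: "integrable lborel (\<lambda>y. cap_weight n \<tau> y * (cmod (LINT x|lborel. of_real (?a x y) * wave R (sgn y) x))\<^sup>2)"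
    by (rule cap_energy_integrable[OF n0 \<tau> steep_field_measurable \<nu>ti sm(6)[OF \<tau> _ n0]])
  \<comment> \<open>Only slabs of index between \<open>- m\<close> and \<open>m\<close> meet the
    ball of radius \<open>L\<close>. As \<open>1 \<le> L * R\<close>, their number is at most
    \<open>2 * (L * R + 1) + 1 \<le> 5 * L * R\<close>.\<close>
  define m where "m = \<lceil>L * R\<rceil>"
  define I where "I = {-m..m}"
  have fI: "finite I" by (simp add: I_def)
  have slabI: "slab x \<in> I" if "norm x \<le> L" for x
  proof -
    have "\<bar>x \<bullet> \<tau>\<bar> \<le> L" using Cauchy_Schwarz_ineq2[of x \<tau>] \<tau> that by simp
    then have "R * \<bar>x \<bullet> \<tau>\<bar> \<le> R * L" using R0 by (intro mult_left_mono) auto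
    then have "\<bar>R * (x \<bullet> \<tau>)\<bar> \<le> L * R" using R0 by (simp add: abs_mult mult.commute)
    then show ?thesis unfolding slab_def I_def m_def by simp linarith
  qed
  have cardI: "real (card I) \<le> 5 * L * R"
  proof -
    define t where "t = L * R"
    have t: "1 \<le> t" unfolding t_def using mult_mono[of 1 L 1 R] L R by simp
    then have "0 \<le> m" unfolding m_def t_def[symmetric] by simp
    then have "real (card I) = 2 * real_of_int m + 1" by (simp add: I_def)
    moreover have "real_of_int m \<le> t + 1" unfolding m_def t_def by (rule of_int_ceiling_le_add_one)
    ultimately have "real (card I) \<le> 5 * t" using t by linarith
    then show ?thesis by (simp add: t_def)
  qed
  have split_sum: "(LINT x|lborel. of_real (?a x y) * wave R (sgn y) x) = (\<Sum>j\<in>I. LINT x|lborel. of_real (a j x y) * wave R (sgn y) x)"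
    if y: "cap_weight n \<tau> y \<noteq> 0" for y
  proof -
    have "integrable lborel (\<lambda>x. of_real (a j x y) * wave R (sgn y) x)" for j
    proof (rule Bochner_Integration.integrable_bound[OF \<nu>i])
      have [measurable]: "case_prod (a j) \<in> borel_measurable (borel \<Otimes>\<^sub>M borel)" using am by (simp add: borel_prod)
      show "(\<lambda>x. of_real (a j x y) * wave R (sgn y) x) \<in> borel_measurable lborel"
        unfolding wave_def using measurable_compose[of "\<lambda>x. (x, y)" borel "borel \<Otimes>\<^sub>M borel" "case_prod (a j)" borel] by simp
    qed (use ab[OF y] \<nu>b in \<open>auto simp: norm_mult\<close>)
    then have "(\<Sum>j\<in>I. LINT x|lborel. of_real (a j x y) * wave R (sgn y) x) = (LINT x|lborel. (\<Sum>j\<in>I. of_real (a j x y) * wave R (sgn y) x))"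
      by (subst Bochner_Integration.integral_sum) auto
    also have "\<dots> = (LINT x|lborel. of_real (?a x y) * wave R (sgn y) x)"
    proof (intro Bochner_Integration.integral_cong refl)
      fix x
      show "(\<Sum>j\<in>I. of_real (a j x y) * wave R (sgn y) x) = of_real (?a x y) * wave R (sgn y) x"
      proof (cases "norm x \<le> L")
        case True
        then show ?thesis using slabI[OF True] fI
          by (simp add: a_def if_distrib[of of_real] if_distrib[of "\<lambda>t. t * _"] cong: if_cong)
      next
        case False
        then have z: "?a x y = 0" using sm(4,5)[of x] \<tau> by simp
        then have "a j x y = 0" for j by (simp add: a_def)
        then show ?thesis using z by simp
      qed
    qed
    finally show ?thesis by simp
  qed
  \<comment> \<open>Cauchy-Schwarz over the slabs. The factor \<open>R\<close> is affordable: the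
    second integration by parts gains \<open>1/R\<^sup>2\<close> in the square, and the local
    curvature mass exceeds the local surface mass by one factor \<open>R\<close> only.\<close>
  have cs: "cap_weight n \<tau> y * (cmod (LINT x|lborel. of_real (?a x y) * wave R (sgn y) x))\<^sup>2
     \<le> (\<Sum>j\<in>I. 5 * L * R * (cap_weight n \<tau> y * (cmod (LINT x|lborel. of_real (a j x y) * wave R (sgn y) x))\<^sup>2))" for y
  proof (cases "cap_weight n \<tau> y = 0")
    case False
    let ?F = "\<lambda>j. LINT x|lborel. of_real (a j x y) * wave R (sgn y) x"
    have "(cmod (\<Sum>j\<in>I. ?F j))\<^sup>2 \<le> (\<Sum>j\<in>I. cmod (?F j))\<^sup>2" by (intro power_mono norm_sum) auto
    also have "\<dots> \<le> (\<Sum>j\<in>I. (cmod (?F j))\<^sup>2) * real (card I)" by (rule sum_squared_le_sum_of_squares)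
    also have "\<dots> \<le> (\<Sum>j\<in>I. (cmod (?F j))\<^sup>2) * (5 * L * R)" by (intro mult_left_mono cardI sum_nonneg) auto
    finally have "cap_weight n \<tau> y * (cmod (\<Sum>j\<in>I. ?F j))\<^sup>2 \<le> cap_weight n \<tau> y * ((\<Sum>j\<in>I. (cmod (?F j))\<^sup>2) * (5 * L * R))"
      using cap_weight_bounds by (intro mult_left_mono) auto
    then show ?thesis unfolding split_sum[OF False] by (simp add: sum_distrib_left sum_distrib_right mult_ac)
  qed simp
  have "(LINT y|lborel. cap_weight n \<tau> y * (cmod (LINT x|lborel. of_real (?a x y) * wave R (sgn y) x))\<^sup>2)
    \<le> (LINT y|lborel. (\<Sum>j\<in>I. 5 * L * R * (cap_weight n \<tau> y * (cmod (LINT x|lborel. of_real (a j x y) * wave R (sgn y) x))\<^sup>2)))"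
    by (rule Bochner_Integration.integral_mono[OF total_int _ cs]) (intro Bochner_Integration.integrable_sum integrable_mult_right ei)
  also have "\<dots> = (\<Sum>j\<in>I. 5 * L * R * (LINT y|lborel. cap_weight n \<tau> y * (cmod (LINT x|lborel. of_real (a j x y) * wave R (sgn y) x))\<^sup>2))"
    by (subst Bochner_Integration.integral_sum) (use ei in \<open>auto intro!: integrable_mult_right\<close>)
  also have "\<dots> \<le> (\<Sum>j\<in>I. 5 * L * R * (kernel_const TYPE('a) n * (2000 * P * (LINT x|lborel. \<nu> j x))))"
    using L R by (intro sum_mono mult_left_mono e) auto
  also have "\<dots> = 5 * L * R * (kernel_const TYPE('a) n * (2000 * P * (\<Sum>j\<in>I. LINT x|lborel. \<nu> j x)))"
    by (simp only: sum_distrib_left)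
  also have "(\<Sum>j\<in>I. LINT x|lborel. \<nu> j x) = (LINT x|lborel. (\<Sum>j\<in>I. \<nu> j x))"
    by (subst Bochner_Integration.integral_sum) (use \<nu>i in auto)
  also have "5 * L * R * (kernel_const TYPE('a) n * (2000 * P * (LINT x|lborel. (\<Sum>j\<in>I. \<nu> j x))))
    \<le> 5 * L * R * (kernel_const TYPE('a) n * (2000 * P * (2000 * (LINT x|lborel. \<beta> x * \<Theta> x))))"
  proof -
    have "(LINT x|lborel. (\<Sum>j\<in>I. \<nu> j x)) \<le> (LINT x|lborel. 2000 * (\<beta> x * \<Theta> x))"
    proof (rule Bochner_Integration.integral_mono)
      show "integrable lborel (\<lambda>x. \<Sum>j\<in>I. \<nu> j x)" by (intro Bochner_Integration.integrable_sum \<nu>i)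
      show "integrable lborel (\<lambda>x. 2000 * (\<beta> x * \<Theta> x))" using \<beta>_integrable(2) by simp
      have "(\<Sum>j\<in>I. \<nu> j x) \<le> ?\<nu> x" for x using fI sm(2)[of x] by (simp add: \<nu>_def)
      then show "(\<Sum>j\<in>I. \<nu> j x) \<le> 2000 * (\<beta> x * \<Theta> x)" for x using sm(3) order_trans by blast
    qed
    then show ?thesis using L R P0 kernel_const_nonneg[where 'a = 'a]
      by (intro mult_left_mono) auto
  qed
  finally show "(LINT y|lborel. cap_weight n \<tau> y * (cmod (LINT x|lborel. of_real (?a x y) * wave R (sgn y) x))\<^sup>2)
    \<le> 5 * L * R * (kernel_const TYPE('a) n * (2000 * P * (2000 * (LINT x|lborel. \<beta> x * \<Theta> x))))" .
qed

end

section \<open>Energy on a cap\<close>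

lemma sum3_squared_le: "(a + b + c)\<^sup>2 \<le> 3 * (a\<^sup>2 + b\<^sup>2 + c\<^sup>2)" for a b c :: real
proof -
  have "0 \<le> (a - b)\<^sup>2 + (b - c)\<^sup>2 + (a - c)\<^sup>2" by simp
  then show ?thesis by (simp add: power2_eq_square algebra_simps)
qed

context layered_body
begin

text \<open>The slope \<open>\<tau> \<bullet> N x\<close> is split into two flat parts, by sign, and
  \<open>slope_cutoff\<close>; only the last is integrated by parts again. In the cap
  \<open>(\<omega> \<bullet> \<tau>)\<^sup>2 \<ge> 24/100\<close>, so squaring a sum of three terms
  costs 3 / (24/100), less than 13. The factor 2 bounds \<open>(norm y)\<^sup>2\<close>, which comes
  from the homogeneity of \<open>steep_field\<close>.\<close>

lemma flux_decomposition:
  assumes n: "0 < n" and \<tau>: "norm \<tau> = 1" and R: "1 \<le> R" and y: "cap_weight n \<tau> y \<noteq> 0"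
  shows "(cmod (LINT x|lborel. of_real (\<phi> x) * wave R (sgn y) x))\<^sup>2
    \<le> 13 / R\<^sup>2 * ((cmod (LINT x|lborel. of_real (flat_density \<tau> 1 x) * wave R (sgn y) x))\<^sup>2
        + (cmod (LINT x|lborel. of_real (flat_density \<tau> (- 1) x) * wave R (sgn y) x))\<^sup>2
        + 2 / R\<^sup>2 * (cmod (LINT x|lborel. of_real (steep_field \<tau> x y) * wave R (sgn y) x))\<^sup>2)"
proof -
  note cy = cap_weight_support[OF \<tau> n y]
  define s where "s = norm y"
  define \<omega> where "\<omega> = sgn y"
  have ny: "s \<le> 1001/1000" unfolding s_def using cap_point_norm[OF \<tau>] cy by blast
  have "\<bar>y \<bullet> \<tau>\<bar> \<le> s" unfolding s_def using Cauchy_Schwarz_ineq2[of y \<tau>] \<tau> by simp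
  then have s0: "1/2 \<le> s" using cy by linarith
  have \<omega>y: "\<omega> = (1/s) *\<^sub>R y" by (simp add: \<omega>_def s_def sgn_div_norm divide_inverse)
  have "y \<noteq> 0" using s0 by (auto simp: s_def)
  then have n\<omega>: "norm \<omega> = 1" by (simp add: \<omega>_def norm_sgn)
  have "(1/2) / (1001/1000) \<le> (y \<bullet> \<tau>) / s" using cy ny s0 by (intro frac_le) auto
  then have \<omega>\<tau>: "49/100 \<le> \<omega> \<bullet> \<tau>" by (simp add: \<omega>y)
  define \<Phi> where "\<Phi> = (LINT x|lborel. of_real (\<phi> x) * wave R \<omega> x)"
  define F where "F \<sigma> = (LINT x|lborel. of_real (flat_density \<tau> \<sigma> x) * wave R \<omega> x)" for \<sigma>
  define E where "E = (LINT x|lborel. of_real (\<beta> x * norm (G x) * slope_cutoff (\<tau> \<bullet> N x)) * wave R \<omega> x)"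
  define St where "St = (LINT x|lborel. of_real (steep_field \<tau> x y) * wave R \<omega> x)"
  have wm[measurable]: "wave R \<omega> \<in> borel_measurable borel" unfolding wave_def[abs_def] by measurable
  have t1: "\<beta> x * norm (G x) * \<bar>\<tau> \<bullet> N x\<bar> \<le> \<beta> x * norm (G x)" for x
  proof (cases "x \<in> layer")
    case True
    then show ?thesis using tang_props(3)[OF \<tau> layerD(1)[OF True]] \<beta>_bounds by (intro mult_left_le) auto
  qed (simp add: \<beta>_outside)
  have fm[measurable]: "flat_density \<tau> \<sigma> \<in> borel_measurable borel" for \<sigma> unfolding flat_density_def[abs_def] by measurable
  have fi: "integrable lborel (\<lambda>x. of_real (flat_density \<tau> \<sigma> x) * wave R \<omega> x)" for \<sigma>
  proof (rule Bochner_Integration.integrable_bound[OF \<beta>_integrable(1)])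
    have "\<bar>flat_density \<tau> \<sigma> x\<bar> \<le> \<beta> x * norm (G x)" for x
    proof -
      have "\<bar>flat_density \<tau> \<sigma> x\<bar> \<le> \<beta> x * norm (G x) * \<bar>\<tau> \<bullet> N x\<bar>"
        unfolding flat_density_def using slope_cutoff_bounds(2)[of "\<tau> \<bullet> N x"] \<beta>_bounds(1)[of x]
        by (auto simp: abs_mult intro!: mult_left_mono)
      then show ?thesis using t1[of x] by linarith
    qed
    then show "AE x in lborel. cmod (of_real (flat_density \<tau> \<sigma> x) * wave R \<omega> x) \<le> norm (\<beta> x * norm (G x))"
      using \<beta>_bounds by (intro AE_I2) (simp add: norm_mult abs_mult)
  qed measurable
  have ei: "integrable lborel (\<lambda>x. of_real (\<beta> x * norm (G x) * slope_cutoff (\<tau> \<bullet> N x)) * wave R \<omega> x)"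
  proof (rule Bochner_Integration.integrable_bound[OF \<beta>_integrable(1)])
    have "\<bar>\<beta> x * norm (G x) * slope_cutoff (\<tau> \<bullet> N x)\<bar> \<le> \<beta> x * norm (G x)" for x
    proof -
      have "\<bar>\<beta> x * norm (G x) * slope_cutoff (\<tau> \<bullet> N x)\<bar> \<le> \<beta> x * norm (G x) * \<bar>\<tau> \<bullet> N x\<bar>"
        using slope_cutoff_bounds(1)[of "\<tau> \<bullet> N x"] \<beta>_bounds(1)[of x]
        by (auto simp: abs_mult intro!: mult_left_mono)
      then show ?thesis using t1[of x] by linarith
    qed
    then show "AE x in lborel. cmod (of_real (\<beta> x * norm (G x) * slope_cutoff (\<tau> \<bullet> N x)) * wave R \<omega> x) \<le> norm (\<beta> x * norm (G x))"
      using \<beta>_bounds by (intro AE_I2) (simp add: norm_mult abs_mult)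
  qed measurable
  have "(LINT x|lborel. of_real (\<beta> x * (G x \<bullet> \<tau>)) * wave R \<omega> x)
    = (LINT x|lborel. of_real (flat_density \<tau> 1 x) * wave R \<omega> x + of_real (flat_density \<tau> (- 1) x) * wave R \<omega> x
        + of_real (\<beta> x * norm (G x) * slope_cutoff (\<tau> \<bullet> N x)) * wave R \<omega> x)"
  proof (intro Bochner_Integration.integral_cong refl)
    fix x
    have "G x \<bullet> \<tau> = norm (G x) * (\<tau> \<bullet> N x)" by (subst norm_N(3)) (simp add: inner_commute)
    then have "\<beta> x * (G x \<bullet> \<tau>) = flat_density \<tau> 1 x + flat_density \<tau> (- 1) x + \<beta> x * norm (G x) * slope_cutoff (\<tau> \<bullet> N x)"
      by (cases "\<tau> \<bullet> N x" "0::real" rule: linorder_cases) (simp_all add: flat_density_def algebra_simps slope_cutoff_def)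
    then show "of_real (\<beta> x * (G x \<bullet> \<tau>)) * wave R \<omega> x = of_real (flat_density \<tau> 1 x) * wave R \<omega> x + of_real (flat_density \<tau> (- 1) x) * wave R \<omega> x
        + of_real (\<beta> x * norm (G x) * slope_cutoff (\<tau> \<bullet> N x)) * wave R \<omega> x"
      by (simp only: of_real_add distrib_right)
  qed
  also have "\<dots> = F 1 + F (- 1) + E"
    unfolding F_def E_def
    by (simp only: Bochner_Integration.integral_add[OF Bochner_Integration.integrable_add[OF fi fi] ei] Bochner_Integration.integral_add[OF fi fi])
  finally have split: "\<i> * of_real (R * (\<omega> \<bullet> \<tau>)) * \<Phi> = - (F 1 + F (- 1) + E)"
    using fourier_body_flux[of R \<omega> \<tau>] by (simp only: \<Phi>_def)
  have "1/5 < \<tau> \<bullet> \<omega>" using \<omega>\<tau> by (simp add: inner_commute)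
  from steep_flux[OF \<tau> n\<omega> this, of R]
  have "\<i> * of_real R * E = (LINT x|lborel. of_real (\<beta> x * ((steep_density \<tau> x \<bullet> \<omega>) / (tang \<tau> x \<bullet> \<omega>)\<^sup>2)) * wave R \<omega> x)"
    by (simp only: E_def)
  also have "\<dots> = (LINT x|lborel. of_real s * (of_real (steep_field \<tau> x y) * wave R \<omega> x))"
  proof (intro Bochner_Integration.integral_cong refl)
    fix x
    have "\<beta> x * ((steep_density \<tau> x \<bullet> \<omega>) / (tang \<tau> x \<bullet> \<omega>)\<^sup>2) = s * steep_field \<tau> x y"
      using s0 by (simp add: \<omega>y steep_field_def power2_eq_square field_simps)
    then show "of_real (\<beta> x * ((steep_density \<tau> x \<bullet> \<omega>) / (tang \<tau> x \<bullet> \<omega>)\<^sup>2)) * wave R \<omega> x = of_real s * (of_real (steep_field \<tau> x y) * wave R \<omega> x)"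
      by simp
  qed
  also have "\<dots> = of_real s * St" by (simp only: St_def integral_mult_right_zero)
  finally have E: "\<i> * of_real R * E = of_real s * St" .
  have nE: "R * cmod E = s * cmod St"
    using arg_cong[OF E, of cmod] R s0 by (simp add: norm_mult)
  have "R * (\<omega> \<bullet> \<tau>) * cmod \<Phi> = cmod (F 1 + F (- 1) + E)"
    using arg_cong[OF split, of cmod] R \<omega>\<tau> by (simp add: norm_mult norm_minus_cancel abs_mult del: of_real_mult minus_add_distrib)
  also have "\<dots> \<le> cmod (F 1) + cmod (F (- 1)) + cmod E"
    using norm_triangle_ineq[of "F 1 + F (- 1)" E] norm_triangle_ineq[of "F 1" "F (- 1)"] by linarith
  finally have "(R * (\<omega> \<bullet> \<tau>) * cmod \<Phi>)\<^sup>2 \<le> (cmod (F 1) + cmod (F (- 1)) + cmod E)\<^sup>2"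
    using R \<omega>\<tau> by (intro power_mono) auto
  also have "\<dots> \<le> 3 * ((cmod (F 1))\<^sup>2 + (cmod (F (- 1)))\<^sup>2 + (cmod E)\<^sup>2)" by (rule sum3_squared_le)
  finally have 1: "(R * (\<omega> \<bullet> \<tau>) * cmod \<Phi>)\<^sup>2 \<le> 3 * ((cmod (F 1))\<^sup>2 + (cmod (F (- 1)))\<^sup>2 + (cmod E)\<^sup>2)" .
  have E2: "(cmod E)\<^sup>2 \<le> 2 / R\<^sup>2 * (cmod St)\<^sup>2"
  proof -
    have "cmod E = s / R * cmod St" using nE R by (simp add: field_simps)
    then have "(cmod E)\<^sup>2 = s\<^sup>2 / R\<^sup>2 * (cmod St)\<^sup>2" by (simp only: power_mult_distrib power_divide)
    also have "\<dots> \<le> 2 / R\<^sup>2 * (cmod St)\<^sup>2"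
    proof -
      have "s\<^sup>2 \<le> (1001/1000)\<^sup>2" using ny s0 by (intro power_mono) auto
      then have "s\<^sup>2 \<le> 2" by (simp add: power2_eq_square)
      then show ?thesis by (intro mult_right_mono divide_right_mono) auto
    qed
    finally show ?thesis .
  qed
  have "(49/100)\<^sup>2 \<le> (\<omega> \<bullet> \<tau>)\<^sup>2" using \<omega>\<tau> by (intro power_mono) auto
  then have "24/100 \<le> (\<omega> \<bullet> \<tau>)\<^sup>2" by (simp add: power2_eq_square)
  then have "(24/100) * (R\<^sup>2 * (cmod \<Phi>)\<^sup>2) \<le> (\<omega> \<bullet> \<tau>)\<^sup>2 * (R\<^sup>2 * (cmod \<Phi>)\<^sup>2)" by (intro mult_right_mono) auto
  also have "\<dots> = (R * (\<omega> \<bullet> \<tau>) * cmod \<Phi>)\<^sup>2" by (simp add: power_mult_distrib)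
  also note 1
  also have "3 * ((cmod (F 1))\<^sup>2 + (cmod (F (- 1)))\<^sup>2 + (cmod E)\<^sup>2)
      \<le> 3 * ((cmod (F 1))\<^sup>2 + (cmod (F (- 1)))\<^sup>2 + 2 / R\<^sup>2 * (cmod St)\<^sup>2)"
    using E2 by (intro mult_left_mono add_left_mono) auto
  finally have "(24/100) * (R\<^sup>2 * (cmod \<Phi>)\<^sup>2) \<le> 3 * ((cmod (F 1))\<^sup>2 + (cmod (F (- 1)))\<^sup>2 + 2 / R\<^sup>2 * (cmod St)\<^sup>2)" .
  moreover have "0 \<le> (cmod (F 1))\<^sup>2 + (cmod (F (- 1)))\<^sup>2 + 2 / R\<^sup>2 * (cmod St)\<^sup>2" by simp
  moreover have "(24/100) * X \<le> 3 * Y \<Longrightarrow> 0 \<le> Y \<Longrightarrow> X \<le> 13 * Y" for X Y :: real by linarith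
  ultimately have "R\<^sup>2 * (cmod \<Phi>)\<^sup>2 \<le> 13 * ((cmod (F 1))\<^sup>2 + (cmod (F (- 1)))\<^sup>2 + 2 / R\<^sup>2 * (cmod St)\<^sup>2)" by blast
  then have "(cmod \<Phi>)\<^sup>2 \<le> 13 / R\<^sup>2 * ((cmod (F 1))\<^sup>2 + (cmod (F (- 1)))\<^sup>2 + 2 / R\<^sup>2 * (cmod St)\<^sup>2)"
    using R by (simp add: pos_le_divide_eq mult.commute)
  then show ?thesis unfolding \<Phi>_def F_def St_def \<omega>_def .
qed

lemma cap_fourier_bound:
  assumes \<tau>: "norm \<tau> = 1" and R: "1 \<le> R" and big: "\<And>x. x \<in> layer \<Longrightarrow> 8 * R \<le> norm (G x)"
    and Cd0: "0 \<le> Cd" and Cd: "\<And>x0. (LINT x|lborel. decay (DIM('a) + 1) R (x - x0 :: 'a)) \<le> Cd / R ^ DIM('a)"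
    and int: "\<And>x0. integrable lborel (\<lambda>x::'a. decay (DIM('a) + 1) R (x - x0))"
  shows "integrable lborel (\<lambda>y. cap_weight (DIM('a) + 1) \<tau> y * (cmod (LINT x|lborel. of_real (\<phi> x) * wave R (sgn y) x))\<^sup>2)"
    and "(LINT y|lborel. cap_weight (DIM('a) + 1) \<tau> y * (cmod (LINT x|lborel. of_real (\<phi> x) * wave R (sgn y) x))\<^sup>2)
      \<le> cap_bound_const TYPE('a) c L Cd / R ^ (DIM('a) + 1)"
proof -
  define n where "n = DIM('a) + 1"
  define d where "d = real DIM('a)"
  define C1 where "C1 = (d + L * real n) / c * Cd"
  define C2 where "C2 = (1 + d + 2 * L * real n) / c * C1"
  define T1 where "T1 = d / c * measure lborel (cball (0::'a) L)"
  define T2 where "T2 = (1 + d) / c * T1"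
  define K where "K = kernel_const TYPE('a) n"
  have K0: "0 \<le> K" unfolding K_def by (rule kernel_const_nonneg)
  have n0: "0 < n" by (simp add: n_def)
  have R0: "0 < R" using R by simp
  have pos: "0 \<le> C1" "0 \<le> C2" "0 \<le> T1" "0 \<le> T2" using c L Cd0 by (auto simp: C1_def C2_def T1_def T2_def d_def)
  define P1 where "P1 = C1 * R / R ^ DIM('a)"
  define P2 where "P2 = C2 * R\<^sup>2 / R ^ DIM('a)"
  have m1: "(LINT x|lborel. \<beta> x * norm (G x) * decay n R (x - x0)) \<le> P1" for x0
    using local_masses(1)[OF R Cd int] by (simp add: n_def P1_def C1_def d_def)
  have m2: "(LINT x|lborel. \<beta> x * \<Theta> x * decay n R (x - x0)) \<le> P2" for x0
    using local_masses(2)[OF R Cd int] by (simp add: n_def P2_def C2_def C1_def d_def)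
  have tm: "(LINT x|lborel. \<beta> x * norm (G x)) \<le> T1" "(LINT x|lborel. \<beta> x * \<Theta> x) \<le> T2"
    using total_masses by (simp_all add: T1_def T2_def d_def)
  have P0: "0 \<le> P1" "0 \<le> P2" using pos R0 by (auto simp: P1_def P2_def)
  define Q where "Q \<sigma> y = cap_weight n \<tau> y * (cmod (LINT x|lborel. of_real (flat_density \<tau> \<sigma> x) * wave R (sgn y) x))\<^sup>2" for \<sigma> y
  define Z where "Z y = cap_weight n \<tau> y * (cmod (LINT x|lborel. of_real (steep_field \<tau> x y) * wave R (sgn y) x))\<^sup>2" for y
  define W where "W y = cap_weight n \<tau> y * (cmod (LINT x|lborel. of_real (\<phi> x) * wave R (sgn y) x))\<^sup>2" for y
  have Q: "(LINT y|lborel. Q \<sigma> y) \<le> K * (P1 * T1)" if "\<bar>\<sigma>\<bar> = 1" for \<sigma>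
  proof -
    have "(LINT y|lborel. Q \<sigma> y) \<le> K * (P1 * (LINT x|lborel. \<beta> x * norm (G x)))"
      unfolding Q_def K_def by (rule flat_energy[OF n_def \<tau> R0 big that m1])
    also have "\<dots> \<le> K * (P1 * T1)" using tm(1) K0 P0 by (intro mult_left_mono) auto
    finally show ?thesis .
  qed
  have Z: "(LINT y|lborel. Z y) \<le> 5 * L * R * (K * (2000 * P2 * (2000 * T2)))"
  proof -
    have "(LINT y|lborel. Z y) \<le> 5 * L * R * (K * (2000 * P2 * (2000 * (LINT x|lborel. \<beta> x * \<Theta> x))))"
      unfolding Z_def K_def by (rule steep_energy(1)[OF n_def \<tau> R m2])
    also have "\<dots> \<le> 5 * L * R * (K * (2000 * P2 * (2000 * T2)))" using tm(2) K0 P0 L R by (intro mult_left_mono) auto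
    finally show ?thesis .
  qed
  have Zi: "integrable lborel Z" unfolding Z_def by (rule steep_energy(2)[OF n_def \<tau> R m2])
  have [measurable]: "flat_density \<tau> \<sigma> \<in> borel_measurable borel" for \<sigma> unfolding flat_density_def[abs_def] by measurable
  have Qi: "integrable lborel (Q \<sigma>)" for \<sigma>
    unfolding Q_def
  proof (rule cap_energy_integrable[OF n0 \<tau> _ \<beta>_integrable(1)])
    show "case_prod (\<lambda>x y::'a. flat_density \<tau> \<sigma> x) \<in> borel_measurable borel"
      unfolding borel_prod[symmetric] by measurable
    show "\<bar>flat_density \<tau> \<sigma> x\<bar> \<le> \<beta> x * norm (G x)" for x
    proof (cases "x \<in> layer")
      case True
      have "\<bar>\<tau> \<bullet> N x - slope_cutoff (\<tau> \<bullet> N x)\<bar> \<le> 1"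
        using slope_cutoff_bounds(2)[of "\<tau> \<bullet> N x"] tang_props(3)[OF \<tau> layerD(1)[OF True]] by linarith
      then have "(\<beta> x * norm (G x)) * \<bar>\<tau> \<bullet> N x - slope_cutoff (\<tau> \<bullet> N x)\<bar> \<le> \<beta> x * norm (G x)"
        using \<beta>_bounds by (intro mult_left_le) auto
      then show ?thesis using \<beta>_bounds by (simp add: flat_density_def abs_mult)
    qed (use \<beta>_outside in \<open>simp add: flat_density_def\<close>)
  qed
  have [measurable]: "\<phi> \<in> borel_measurable borel" by (auto intro!: borel_measurable_continuous_onI continuous_intros)
  have \<phi>i: "integrable lborel \<phi>" using integrable_\<phi>[of "\<lambda>_. 1"] by simp
  have Wi: "integrable lborel W"
    unfolding W_def
  proof (rule cap_energy_integrable[OF n0 \<tau> _ \<phi>i])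
    show "case_prod (\<lambda>x y::'a. \<phi> x) \<in> borel_measurable borel"
      unfolding borel_prod[symmetric] by measurable
  qed (use \<phi>_bounds in auto)
  then show "integrable lborel (\<lambda>y. cap_weight (DIM('a) + 1) \<tau> y * (cmod (LINT x|lborel. of_real (\<phi> x) * wave R (sgn y) x))\<^sup>2)"
    by (simp add: W_def[abs_def] n_def)
  have le: "W y \<le> 13 / R\<^sup>2 * (Q 1 y + Q (- 1) y + 2 / R\<^sup>2 * Z y)" for y
  proof (cases "cap_weight n \<tau> y = 0")
    case False
    from mult_left_mono[OF flux_decomposition[OF n0 \<tau> R False] cap_weight_bounds(1)[of n \<tau> y]]
    show ?thesis unfolding W_def Q_def Z_def by (simp only: distrib_left mult_ac)
  qed (simp add: W_def Q_def Z_def)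
  have rhs_i: "integrable lborel (\<lambda>y. Q 1 y + Q (- 1) y + 2 / R\<^sup>2 * Z y)"
    by (intro Bochner_Integration.integrable_add Qi integrable_mult_right Zi)
  have "(LINT y|lborel. W y) \<le> (LINT y|lborel. 13 / R\<^sup>2 * (Q 1 y + Q (- 1) y + 2 / R\<^sup>2 * Z y))"
    by (rule Bochner_Integration.integral_mono[OF Wi integrable_mult_right[OF rhs_i] le])
  also have "\<dots> = 13 / R\<^sup>2 * ((LINT y|lborel. Q 1 y) + (LINT y|lborel. Q (- 1) y) + 2 / R\<^sup>2 * (LINT y|lborel. Z y))"
    by (simp only: integral_mult_right_zero
       Bochner_Integration.integral_add[OF Bochner_Integration.integrable_add[OF Qi Qi] integrable_mult_right[OF Zi]] Bochner_Integration.integral_add[OF Qi Qi])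
  also have "\<dots> \<le> 13 / R\<^sup>2 * (K * (P1 * T1) + K * (P1 * T1) + 2 / R\<^sup>2 * (5 * L * R * (K * (2000 * P2 * (2000 * T2)))))"
    using Q[of 1] Q[of "- 1"] Z R0 by (intro mult_left_mono add_mono) auto
  \<comment> \<open>Both groups carry the power \<open>R / R ^ DIM('a) / R\<^sup>2\<close>: in the
    steep one \<open>2 / R\<^sup>2\<close> cancels the slab factor \<open>R\<close> and the extra
    \<open>R\<close> in \<open>P2\<close>.\<close>
  also have "\<dots> = 13 * K * (2 * (C1 * T1) + 40000000 * L * (C2 * T2)) / R ^ (DIM('a) + 1)"
  proof -
    have r1: "P1 = C1 * (R / R ^ DIM('a))" "2 / R\<^sup>2 * (5 * L * R * (K * (2000 * P2 * (2000 * T2)))) = 40000000 * L * K * C2 * T2 * (R / R ^ DIM('a))"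
      using R0 by (simp_all add: P1_def P2_def power2_eq_square field_simps)
    have r2: "R / R ^ DIM('a) / R\<^sup>2 = 1 / R ^ (DIM('a) + 1)"
      using R0 by (simp add: power2_eq_square field_simps)
    have "13 / R\<^sup>2 * (K * (P1 * T1) + K * (P1 * T1) + 2 / R\<^sup>2 * (5 * L * R * (K * (2000 * P2 * (2000 * T2)))))
       = 13 * K * (2 * (C1 * T1) + 40000000 * L * (C2 * T2)) * (R / R ^ DIM('a) / R\<^sup>2)"
      unfolding r1 by (simp add: algebra_simps add_divide_distrib)
    then show ?thesis unfolding r2 by simp
  qed
  also have "\<dots> = cap_bound_const TYPE('a) c L Cd / R ^ (DIM('a) + 1)"
    by (simp add: cap_bound_const_def Let_def K_def C1_def C2_def T1_def T2_def n_def d_def)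
  finally show "(LINT y|lborel. cap_weight (DIM('a) + 1) \<tau> y * (cmod (LINT x|lborel. of_real (\<phi> x) * wave R (sgn y) x))\<^sup>2)
      \<le> cap_bound_const TYPE('a) c L Cd / R ^ (DIM('a) + 1)"
    by (simp add: W_def n_def)
qed

end

section \<open>Covering the sphere by caps\<close>

text \<open>The cone formula behind \<open>sphere_measure\<close>, for functions. Both sides are
  read off from the same nonnegative integral, which makes the identity independent of
  integrability.\<close>

lemma integral_sphere_measure:
  fixes h :: "'a::euclidean_space \<Rightarrow> real"
  assumes [measurable]: "h \<in> borel_measurable borel" and pos: "\<And>x. 0 \<le> h x"
  shows "(LINT \<omega>|sphere_measure. h \<omega>) = real DIM('a) * (LINT x|lborel. indicator (ball 0 1 - {0}) x * h (sgn x))"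
proof -
  have [measurable]: "sgn \<in> borel_measurable (borel :: 'a measure)" by (rule sgn_borel_measurable)
  have hm: "h \<in> borel_measurable (restrict_space borel (sphere 0 1))"
    by (intro measurable_restrict_space1) simp
  have "(\<integral>\<^sup>+ \<omega>. ennreal (h \<omega>) \<partial>sphere_measure) = of_nat DIM('a) *
      (\<integral>\<^sup>+ \<omega>. ennreal (h \<omega>) \<partial>distr (restrict_space lborel (ball 0 1 - {0 :: 'a})) (restrict_space borel (sphere 0 1)) sgn)"
    unfolding sphere_measure_def using hm by (intro nn_integral_scale_measure) simp
  also have "(\<integral>\<^sup>+ \<omega>. ennreal (h \<omega>) \<partial>distr (restrict_space lborel (ball 0 1 - {0 :: 'a})) (restrict_space borel (sphere 0 1)) sgn)
      = (\<integral>\<^sup>+ x. ennreal (h (sgn x)) \<partial>restrict_space lborel (ball 0 1 - {0 :: 'a}))"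
    using hm by (intro nn_integral_distr measurable_sgn_sphere) simp
  also have "\<dots> = (\<integral>\<^sup>+ x. ennreal (h (sgn x)) * indicator (ball 0 1 - {0}) x \<partial>lborel)"
    by (rule nn_integral_restrict_space) simp
  also have "\<dots> = (\<integral>\<^sup>+ x. ennreal (indicator (ball 0 1 - {0}) x * h (sgn x)) \<partial>lborel)"
    by (intro nn_integral_cong) (simp split: split_indicator)
  finally have eq: "(\<integral>\<^sup>+ \<omega>. ennreal (h \<omega>) \<partial>sphere_measure)
     = of_nat DIM('a) * (\<integral>\<^sup>+ x. ennreal (indicator (ball 0 1 - {0}) x * h (sgn x)) \<partial>(lborel :: 'a measure))" .
  have hm': "h \<in> borel_measurable (sphere_measure :: 'a measure)"
    using hm by (simp cong: measurable_cong_sets)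
  have mm: "(\<lambda>x. indicator (ball 0 1 - {0}) x * h (sgn x)) \<in> borel_measurable (lborel :: 'a measure)"
    by (intro borel_measurable_times borel_measurable_indicator) (simp, measurable)
  have "(LINT \<omega>|sphere_measure. h \<omega>) = enn2real (\<integral>\<^sup>+ \<omega>. ennreal (h \<omega>) \<partial>sphere_measure)"
    using hm' pos by (intro integral_eq_nn_integral) auto
  moreover have "(LINT x|lborel. indicator (ball 0 1 - {0}) x * h (sgn x)) = enn2real (\<integral>\<^sup>+ x. ennreal (indicator (ball 0 1 - {0}) x * h (sgn x)) \<partial>(lborel :: 'a measure))"
    using mm pos by (intro integral_eq_nn_integral) auto
  ultimately show ?thesis by (simp add: eq enn2real_mult)
qed

lemma integral_lborel_scaling:
  fixes f :: "'a::euclidean_space \<Rightarrow> real"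
  assumes [measurable]: "f \<in> borel_measurable borel" and r: "0 < r"
  shows "(LINT x|lborel. f x) = r ^ DIM('a) * (LINT x|lborel. f (r *\<^sub>R x))"
proof -
  have eq: "(lborel :: 'a measure) = density (distr lborel borel (\<lambda>x. r *\<^sub>R x)) (\<lambda>_. ennreal (r ^ DIM('a)))"
    using lborel_affine[of r "0::'a"] r by simp
  have "(LINT x|lborel. f x) = (LINT x|density (distr lborel borel (\<lambda>x. r *\<^sub>R x)) (\<lambda>_. ennreal (r ^ DIM('a))). f x)"
    by (subst eq) simp
  also have "\<dots> = (LINT x|distr lborel borel (\<lambda>x. r *\<^sub>R x). r ^ DIM('a) * f x)"
    using r by (subst integral_density) auto
  also have "\<dots> = (LINT x|lborel. r ^ DIM('a) * f (r *\<^sub>R x))"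
    by (subst integral_distr) auto
  finally show ?thesis by simp
qed

text \<open>The integrand depends on \<open>sgn x\<close> only, so by scaling the part within radius
  6/10 has the share \<open>(6/10) ^ DIM('a) \<le> 6/10\<close> of the whole, and the annulus at
  least 4/10. The small radii are removed because a cap weight vanishes for
  \<open>y \<bullet> \<tau> < 1/2\<close>.\<close>

lemma sphere_integral_le_annulus:
  fixes h :: "'a::euclidean_space \<Rightarrow> real"
  assumes [measurable]: "h \<in> borel_measurable borel" and pos: "\<And>x. 0 \<le> h x" and B: "\<And>x. h x \<le> B"
  shows "(LINT \<omega>|sphere_measure. h \<omega>) \<le> 3 * real DIM('a) * (LINT x|lborel. indicator (ball 0 1 - ball 0 (6/10)) x * h (sgn x))"
proof -
  have [measurable]: "sgn \<in> borel_measurable (borel :: 'a measure)" by (rule sgn_borel_measurable)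
  define f where "f A x = indicator A x * h (sgn x)" for A :: "'a set" and x
  have fm: "f A \<in> borel_measurable borel" if "A \<in> sets borel" for A
    unfolding f_def using that by (intro borel_measurable_times borel_measurable_indicator) (simp, measurable)
  have fi: "integrable lborel (f A)" if "A \<in> sets borel" "A \<subseteq> ball 0 1" for A
    by (rule integrable_bounded_support[OF fm[OF that(1)], where C = "\<bar>B\<bar>" and L = 1])
       (use pos B that in \<open>auto simp: f_def split: split_indicator intro: order_trans[OF _ abs_ge_self]\<close>)
  define A1 A2 A3 where "A1 = ball 0 1 - {0::'a}" and "A2 = ball 0 (6/10) - {0::'a}" and "A3 = ball 0 1 - ball (0::'a) (6/10)"
  have sets: "A1 \<in> sets borel" "A2 \<in> sets borel" "A3 \<in> sets borel" by (auto simp: A1_def A2_def A3_def)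
  have sub: "A1 \<subseteq> ball 0 1" "A2 \<subseteq> ball 0 1" "A3 \<subseteq> ball 0 1" by (auto simp: A1_def A2_def A3_def)
  have "f A1 x = f A2 x + f A3 x" for x by (auto simp: f_def A1_def A2_def A3_def split: split_indicator)
  then have sum: "(LINT x|lborel. f A1 x) = (LINT x|lborel. f A2 x) + (LINT x|lborel. f A3 x)"
    using fi[OF sets(2) sub(2)] fi[OF sets(3) sub(3)] by (simp add: Bochner_Integration.integral_add)
  have "(LINT x|lborel. f A2 x) = (6/10) ^ DIM('a) * (LINT x|lborel. f A2 ((6/10) *\<^sub>R x))"
    by (rule integral_lborel_scaling[OF fm[OF sets(2)]]) simp
  also have "(LINT x|lborel. f A2 ((6/10) *\<^sub>R x)) = (LINT x|lborel. f A1 x)"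
  proof (intro Bochner_Integration.integral_cong refl)
    fix x :: 'a
    have "sgn ((6/10) *\<^sub>R x) = sgn x" by (simp add: sgn_scaleR)
    then show "f A2 ((6/10) *\<^sub>R x) = f A1 x" by (simp add: f_def A1_def A2_def split: split_indicator)
  qed
  finally have sc: "(LINT x|lborel. f A2 x) = (6/10) ^ DIM('a) * (LINT x|lborel. f A1 x)" .
  have f0: "0 \<le> (LINT x|lborel. f A1 x)" using pos by (intro integral_nonneg_AE) (auto simp: f_def)
  have "(6/10 :: real) ^ DIM('a) \<le> (6/10) ^ 1" using DIM_positive[where 'a = 'a] by (intro power_decreasing) auto
  then have "(6/10 :: real) ^ DIM('a) * (LINT x|lborel. f A1 x) \<le> 6/10 * (LINT x|lborel. f A1 x)"
    using f0 by (intro mult_right_mono) auto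
  then have "(LINT x|lborel. f A1 x) \<le> 3 * (LINT x|lborel. f A3 x)" using sum sc f0 by linarith
  then have "real DIM('a) * (LINT x|lborel. f A1 x) \<le> real DIM('a) * (3 * (LINT x|lborel. f A3 x))"
    by (intro mult_left_mono) auto
  then show ?thesis unfolding integral_sphere_measure[OF assms(1) pos] by (simp add: f_def A1_def A3_def)
qed

text \<open>3/4000000 is \<open>(1/1000)\<^sup>2 - (1/2000)\<^sup>2\<close>: directions within half
  the cap radius have a weight bounded below.\<close>

lemma cap_weight_ge:
  fixes \<tau> y :: "'a::euclidean_space"
  assumes \<tau>: "norm \<tau> = 1" and y: "6/10 \<le> norm y" "norm y < 1" "dist \<tau> (sgn y) < 1/2000"
  shows "(3/4000000) ^ (2 * n) \<le> cap_weight n \<tau> y"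
proof -
  define \<omega> where "\<omega> = sgn y"
  have "y \<noteq> 0" using y by auto
  then have yy: "y = norm y *\<^sub>R \<omega>" and \<omega>: "norm \<omega> = 1"
    unfolding \<omega>_def norm_sgn by (simp_all add: sgn_div_norm)
  have d: "norm (\<tau> - \<omega>) < 1/2000" using y(3) by (simp add: \<omega>_def dist_norm)
  have "(norm (\<tau> - \<omega>))\<^sup>2 = 2 - 2 * (\<omega> \<bullet> \<tau>)"
    unfolding power2_norm_eq_inner using \<tau> \<omega> by (simp add: inner_diff_left inner_diff_right inner_commute norm_eq_1)
  moreover have "(norm (\<tau> - \<omega>))\<^sup>2 \<le> (1/2000)\<^sup>2" using d by (intro power_mono) auto
  ultimately have ip: "99/100 \<le> \<omega> \<bullet> \<tau>" by (simp add: power2_eq_square)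
  have ip1: "\<omega> \<bullet> \<tau> \<le> 1" using norm_cauchy_schwarz[of \<omega> \<tau>] \<tau> \<omega> by simp
  have yt: "y \<bullet> \<tau> = norm y * (\<omega> \<bullet> \<tau>)" by (subst yy) simp
  have "(6/10) * (99/100) \<le> norm y * (\<omega> \<bullet> \<tau>)" using y ip by (intro mult_mono) auto
  then have 1: "1/2 \<le> y \<bullet> \<tau>" by (simp add: yt)
  have "norm y * (\<omega> \<bullet> \<tau>) \<le> 1 * 1" using y ip ip1 by (intro mult_mono) auto
  then have 2: "y \<bullet> \<tau> \<le> 1" by (simp add: yt)
  have "perp \<tau> (\<omega> - \<tau>) = perp \<tau> \<omega>"
    using \<tau> by (simp add: perp_def inner_diff_left norm_eq_1 scaleR_diff_left)
  moreover have "perp \<tau> (norm y *\<^sub>R \<omega>) = norm y *\<^sub>R perp \<tau> \<omega>" by (simp add: perp_def scaleR_diff_right)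
  ultimately have "perp \<tau> y = norm y *\<^sub>R perp \<tau> (\<omega> - \<tau>)" using yy by metis
  moreover have "norm (perp \<tau> (\<omega> - \<tau>)) \<le> norm (\<omega> - \<tau>)"
    by (rule power2_le_imp_le) (simp_all add: norm_perp_Pythagoras(1)[OF \<tau>, of "\<omega> - \<tau>"])
  ultimately have "norm (perp \<tau> y) \<le> 1 * (1/2000)"
    using d y by (simp only: norm_scaleR) (intro mult_mono; simp add: norm_minus_commute)
  then have "(norm (perp \<tau> y))\<^sup>2 \<le> (1/2000)\<^sup>2" by (intro power_mono) auto
  then have "3/4000000 \<le> max 0 ((1/1000)\<^sup>2 - (norm (perp \<tau> y))\<^sup>2)" by (simp add: power2_eq_square)
  then have "(3/4000000) ^ (2 * n) \<le> (max 0 ((1/1000)\<^sup>2 - (norm (perp \<tau> y))\<^sup>2)) ^ (2 * n)"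
    by (intro power_mono) auto
  then show ?thesis using 1 2 by (simp add: cap_weight_def)
qed

text \<open>By compactness finitely many centres come within 1/2000 of every direction, so the sum
  of their weights is bounded below on the annulus. Caps and constant are fixed before the
  integrand, hence do not depend on the frequency \<open>R\<close>.\<close>

lemma sphere_integral_le_caps:
  fixes n :: nat
  obtains T :: "'a::euclidean_space set" and C :: real where "finite T" "\<And>\<tau>. \<tau> \<in> T \<Longrightarrow> norm \<tau> = 1" "0 \<le> C"
    and "\<And>h B. h \<in> borel_measurable borel \<Longrightarrow> (\<And>x. 0 \<le> h x) \<Longrightarrow> (\<And>x. h x \<le> B) \<Longrightarrow> 0 < n \<Longrightarrow>
      (LINT \<omega>|sphere_measure. h \<omega>) \<le> C * (\<Sum>\<tau>\<in>T. LINT y|lborel. cap_weight n \<tau> y * h (sgn y))"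
proof -
  have "sphere (0::'a) 1 \<subseteq> (\<Union>\<tau>\<in>sphere 0 1. ball \<tau> (1/2000))" by (auto intro!: bexI)
  then obtain T where T: "T \<subseteq> sphere (0::'a) 1" "finite T" "sphere (0::'a) 1 \<subseteq> (\<Union>\<tau>\<in>T. ball \<tau> (1/2000))"
    using compactE_image[OF compact_sphere, of "sphere 0 1" "\<lambda>\<tau>. ball \<tau> (1/2000)" 0 1] by auto
  define w where "w = (3/4000000 :: real) ^ (2 * n)"
  have w: "0 < w" by (simp add: w_def)
  show ?thesis
  proof (rule that[of T "3 * real DIM('a) / w"])
    show "finite T" "\<And>\<tau>. \<tau> \<in> T \<Longrightarrow> norm \<tau> = 1" "0 \<le> 3 * real DIM('a) / w" using T w by auto
    fix h :: "'a \<Rightarrow> real" and B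
    assume h[measurable]: "h \<in> borel_measurable borel" and pos: "\<And>x. 0 \<le> h x" and B: "\<And>x. h x \<le> B" and n: "0 < n"
    have [measurable]: "sgn \<in> borel_measurable (borel :: 'a measure)" by (rule sgn_borel_measurable)
    have ci: "integrable lborel (\<lambda>y. cap_weight n \<tau> y * h (sgn y))" if "\<tau> \<in> T" for \<tau>
    proof (rule integrable_bounded_support[where C = B and L = 2])
      have \<tau>: "norm \<tau> = 1" using T that by auto
      fix y :: 'a
      have "cap_weight n \<tau> y * h (sgn y) \<le> h (sgn y)" using cap_weight_bounds[of n \<tau> y] pos by (intro mult_left_le_one_le) auto
      then show "norm (cap_weight n \<tau> y * h (sgn y)) \<le> B" using B[of "sgn y"] cap_weight_bounds[of n \<tau> y] pos[of "sgn y"] by (simp add: abs_mult)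
      show "cap_weight n \<tau> y * h (sgn y) = 0" if "2 < norm y" using cap_weight_support(4)[OF \<tau> n, of y] that by force
    qed measurable
    define A where "A = ball 0 1 - ball (0::'a) (6/10)"
    have le: "indicator A y * h (sgn y) \<le> (1 / w) * (\<Sum>\<tau>\<in>T. cap_weight n \<tau> y * h (sgn y))" for y
    proof (cases "y \<in> A")
      case True
      then have y: "6/10 \<le> norm y" "norm y < 1" by (auto simp: A_def)
      then have "sgn y \<in> sphere 0 1" by (auto simp: norm_sgn)
      then obtain \<tau> where \<tau>: "\<tau> \<in> T" "dist \<tau> (sgn y) < 1/2000" using T(3) by auto
      then have "w \<le> cap_weight n \<tau> y" unfolding w_def using T(1) y by (intro cap_weight_ge) auto
      also have "\<dots> \<le> (\<Sum>\<tau>\<in>T. cap_weight n \<tau> y)" using \<tau> T(2) cap_weight_bounds by (intro member_le_sum) auto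
      finally have "w * h (sgn y) \<le> (\<Sum>\<tau>\<in>T. cap_weight n \<tau> y) * h (sgn y)" using pos by (intro mult_right_mono) auto
      then have "h (sgn y) * w \<le> (\<Sum>\<tau>\<in>T. cap_weight n \<tau> y * h (sgn y))"
        by (simp only: sum_distrib_right mult.commute[of w])
      then show ?thesis using True w by (simp add: pos_le_divide_eq)
    next
      case False
      have "0 \<le> (\<Sum>\<tau>\<in>T. cap_weight n \<tau> y * h (sgn y))"
        by (intro sum_nonneg mult_nonneg_nonneg cap_weight_bounds pos)
      then show ?thesis using False w by simp
    qed
    have ai: "integrable lborel (\<lambda>y. indicator A y * h (sgn y))"
    proof (rule integrable_bounded_support[where C = B and L = 1])
      show "(\<lambda>y. indicator A y * h (sgn y)) \<in> borel_measurable borel"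
        unfolding A_def by (intro borel_measurable_times borel_measurable_indicator) (simp, measurable)
    qed (use pos B order_trans[OF pos B] in \<open>auto simp: A_def split: split_indicator\<close>)
    have "(LINT \<omega>|sphere_measure. h \<omega>) \<le> 3 * real DIM('a) * (LINT y|lborel. indicator A y * h (sgn y))"
      unfolding A_def by (rule sphere_integral_le_annulus[OF h pos B])
    also have "\<dots> \<le> 3 * real DIM('a) * (LINT y|lborel. (1 / w) * (\<Sum>\<tau>\<in>T. cap_weight n \<tau> y * h (sgn y)))"
      by (intro mult_left_mono Bochner_Integration.integral_mono ai le integrable_mult_right Bochner_Integration.integrable_sum ci) auto
    also have "\<dots> = 3 * real DIM('a) / w * (\<Sum>\<tau>\<in>T. LINT y|lborel. cap_weight n \<tau> y * h (sgn y))"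
      by (subst integral_mult_right_zero, subst Bochner_Integration.integral_sum) (use ci in auto)
    finally show "(LINT \<omega>|sphere_measure. h \<omega>) \<le> 3 * real DIM('a) / w * (\<Sum>\<tau>\<in>T. LINT y|lborel. cap_weight n \<tau> y * h (sgn y))" .
  qed
qed

section \<open>Approximation of convex domains\<close>

text \<open>The minimum over \<open>t\<close> is \<open>- exp (c - 1)\<close>. Used with
  \<open>c = - \<kappa> / 2\<close>, it says that each single functional can pull
  \<open>x \<bullet> G x\<close> below \<open>\<kappa> / 2 * S x\<close> by at most 1.\<close>

lemma shifted_times_exp_ge:
  fixes t c :: real
  assumes "c \<le> 0"
  shows "- 1 \<le> (t - c) * exp t"
proof (cases "c \<le> t")
  case True
  then have "0 \<le> (t - c) * exp t" by simp
  then show ?thesis by linarith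
next
  case False
  define s where "s = c - t"
  have s: "0 < s" using False by (simp add: s_def)
  have "s * exp t \<le> s * exp (- s)" using s assms by (intro mult_left_mono) (auto simp: s_def)
  also have "\<dots> \<le> 1"
  proof -
    have "s \<le> exp s" using exp_ge_add_one_self[of s] by linarith
    then show ?thesis by (simp add: exp_minus field_simps)
  qed
  finally show ?thesis by (simp add: s_def algebra_simps)
qed

text \<open>These cut out the cube of half side \<open>r\<close>. Included in every
  \<open>J\<close>, they keep the sets \<open>S \<le> 2\<close> uniformly bounded.\<close>

definition box_functionals :: "real \<Rightarrow> 'a::euclidean_space set" where
  "box_functionals r = (\<lambda>b. (1/r) *\<^sub>R b) ` Basis \<union> (\<lambda>b. (- 1/r) *\<^sub>R b) ` Basis"

lemma finite_box_functionals: "finite (box_functionals r)"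
  by (simp add: box_functionals_def)

text \<open>\<open>S x \<le> 2\<close> forces \<open>a \<bullet> x \<le> 2\<close> for every
  functional, and the box functionals turn this into \<open>norm x \<le> L\<close>. On the layer
  \<open>x \<bullet> G x \<ge> \<kappa> / 2 - card J \<ge> \<kappa> / 4\<close>; the error of 1 per
  functional is why \<open>\<kappa>\<close> has to dominate \<open>card J\<close>. Together with
  \<open>norm (G x) \<le> 2 * \<kappa> * A\<close> this gives \<open>c = 1 / (8 * A)\<close>, free
  of \<open>\<kappa>\<close>, whereas the lower bound for \<open>norm (G x)\<close> grows with
  \<open>\<kappa>\<close> and makes the layer thin.\<close>

lemma layered_body_exp:
  fixes J :: "'a::euclidean_space set"
  assumes J: "finite J" "box_functionals L0 \<subseteq> J" "\<And>a. a \<in> J \<Longrightarrow> norm a \<le> A" and A: "0 < A" and L0: "1 \<le> L0"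
    and \<kappa>: "1 \<le> \<kappa>" "4 * real (card J) \<le> \<kappa>"
  defines "L \<equiv> 2 * L0 * real DIM('a)"
  shows "layered_body J \<kappa> (1 / (8 * A)) L"
    and "x \<in> layered_body.layer J \<kappa> \<Longrightarrow> \<kappa> / (4 * L) \<le> norm (exp_body.G J \<kappa> x)"
proof -
  interpret exp_body J \<kappa> by unfold_locales (rule J)
  have Lge: "1 \<le> L" unfolding L_def using L0 DIM_positive[where 'a = 'a] mult_mono[of 1 "2 * L0" 1 "real DIM('a)"] by simp
  have bnd: "norm x \<le> L" if "S x \<le> 2" for x
  proof -
    have ax: "a \<bullet> x \<le> 2" if "a \<in> J" for a
    proof -
      have "E a x \<le> S x" unfolding S_def using that J(1) E_pos by (intro member_le_sum) (auto simp: less_imp_le)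
      then have "exp (\<kappa> * (a \<bullet> x - 1)) \<le> 2" using \<open>S x \<le> 2\<close> by (simp add: E_def)
      then have "1 + \<kappa> * (a \<bullet> x - 1) \<le> 2" by (rule order_trans[OF exp_ge_add_one_self])
      then have le: "\<kappa> * (a \<bullet> x - 1) \<le> \<kappa> * 1" using \<kappa> by linarith
      have "a \<bullet> x - 1 \<le> 1" by (rule mult_left_le_imp_le[OF le]) (use \<kappa> in linarith)
      then show ?thesis by linarith
    qed
    have "\<bar>x \<bullet> b\<bar> \<le> 2 * L0" if b: "b \<in> Basis" for b
    proof -
      have "(1/L0) *\<^sub>R b \<in> J" "(- 1/L0) *\<^sub>R b \<in> J" using J(2) b by (auto simp: box_functionals_def)
      from ax[OF this(1)] ax[OF this(2)] show ?thesis using L0 by (simp add: inner_commute field_simps abs_le_iff)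
    qed
    then have "(\<Sum>b\<in>Basis. \<bar>x \<bullet> b\<bar>) \<le> (\<Sum>b\<in>(Basis::'a set). 2 * L0)" by (intro sum_mono) auto
    then show ?thesis using norm_le_l1[of x] by (simp add: L_def mult_ac)
  qed
  have xG: "\<kappa> / 4 \<le> x \<bullet> G x" if "1 \<le> S x" for x
  proof -
    have "- 1 \<le> (\<kappa> * (a \<bullet> x - 1) + \<kappa> / 2) * E a x" for a
      using shifted_times_exp_ge[of "- \<kappa> / 2" "\<kappa> * (a \<bullet> x - 1)"] \<kappa> by (simp add: E_def)
    then have "(\<Sum>a\<in>J. - 1) \<le> (\<Sum>a\<in>J. (\<kappa> * (a \<bullet> x - 1) + \<kappa> / 2) * E a x)" by (intro sum_mono)
    also have "\<dots> = x \<bullet> G x - \<kappa> / 2 * S x"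
      unfolding G_def S_def inner_sum_right sum_distrib_left sum_subtractf[symmetric]
      by (intro sum.cong refl) (simp add: algebra_simps inner_commute)
    finally have "\<kappa> / 2 * S x - real (card J) \<le> x \<bullet> G x" by simp
    moreover have "\<kappa> / 2 * 1 \<le> \<kappa> / 2 * S x" using that \<kappa> by (intro mult_left_mono) auto
    ultimately show ?thesis using \<kappa> by linarith
  qed
  have nG: "norm (G x) \<le> 2 * \<kappa> * A" if "S x \<le> 2" for x
  proof -
    have "norm (G x) \<le> (\<Sum>a\<in>J. \<kappa> * E a x * A)"
      unfolding G_def using \<kappa> E_pos J(3) by (intro sum_norm_le) (auto simp: abs_mult less_imp_le intro!: mult_left_mono)
    also have "\<dots> = \<kappa> * A * S x" by (simp add: S_def sum_distrib_left mult_ac)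
    also have "\<dots> \<le> \<kappa> * A * 2" using that \<kappa> A by (intro mult_left_mono) auto
    finally show ?thesis by (simp add: mult_ac)
  qed
  have tr: "G x \<noteq> 0 \<and> 1 / (8 * A) * norm (G x) \<le> x \<bullet> G x" if "1 \<le> S x" "S x \<le> 2" for x
  proof -
    have "1 / (8 * A) * norm (G x) \<le> 1 / (8 * A) * (2 * \<kappa> * A)" using nG[OF that(2)] A by (intro mult_left_mono) auto
    also have "\<dots> = \<kappa> / 4" using A by simp
    finally show ?thesis using xG[OF that(1)] \<kappa> by (cases "G x = 0") auto
  qed
  show lb: "layered_body J \<kappa> (1 / (8 * A)) L"
    by unfold_locales (use A Lge bnd tr in auto)
  show "\<kappa> / (4 * L) \<le> norm (G x)" if "x \<in> layered_body.layer J \<kappa>"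
  proof -
    have S: "1 \<le> S x" "S x \<le> 2" using that unfolding layered_body.layer_def[OF lb] by auto
    have "\<kappa> / 4 \<le> norm x * norm (G x)" using xG[OF S(1)] norm_cauchy_schwarz[of x "G x"] by linarith
    also have "\<dots> \<le> L * norm (G x)" using bnd[OF S(2)] by (intro mult_right_mono) auto
    finally show ?thesis using Lge by (simp add: field_simps)
  qed
qed

text \<open>A countable dense subset of the polar set is enough, because
  \<open>1 < a \<bullet> x\<close> is an open condition on \<open>a\<close>. Since 0 lies in
  \<open>B\<close>, a separating hyperplane can be normalised to level 1.\<close>

lemma countable_polar:
  fixes B :: "'a::euclidean_space set"
  assumes B: "open B" "convex B" "0 \<in> B"
  obtains D where "countable D" "D \<noteq> {}" "\<And>a x. a \<in> D \<Longrightarrow> x \<in> B \<Longrightarrow> a \<bullet> x \<le> 1"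
    and "\<And>x. x \<notin> closure B \<Longrightarrow> \<exists>a\<in>D. 1 < a \<bullet> x"
proof -
  define P where "P = {a. \<forall>x\<in>B. a \<bullet> x \<le> 1}"
  obtain D where D: "countable D" "D \<subseteq> P" "P \<subseteq> closure D" using separable by blast
  have "0 \<in> P" by (simp add: P_def)
  then have "D \<noteq> {}" using D by auto
  have sep: "\<exists>a\<in>D. 1 < a \<bullet> x" if x: "x \<notin> closure B" for x
  proof -
    have "convex (closure B)" using B by (simp add: convex_closure)
    then obtain a b where ab: "a \<bullet> x < b" "\<forall>y\<in>closure B. b < a \<bullet> y"
      using separating_hyperplane_closed_point[of "closure B" x] x by auto
    have b: "b < 0" using ab(2) B(3) closure_subset by force
    define a' where "a' = (1 / b) *\<^sub>R a"
    have "1 < a' \<bullet> x" using ab(1) b by (simp add: a'_def field_simps)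
    moreover have "a' \<in> P"
    proof -
      have "a' \<bullet> y \<le> 1" if "y \<in> B" for y
        using ab(2) b that closure_subset by (force simp: a'_def field_simps)
      then show ?thesis by (simp add: P_def)
    qed
    moreover have "open {a. 1 < a \<bullet> x}" by (intro open_Collect_less continuous_intros)
    ultimately have "{a. 1 < a \<bullet> x} \<inter> D \<noteq> {}"
      using D(3) open_Int_closure_eq_empty[of "{a. 1 < a \<bullet> x}" D] by blast
    then show ?thesis by blast
  qed
  show ?thesis using that[OF D(1) \<open>D \<noteq> {}\<close> _ sep] D(2) by (auto simp: P_def)
qed

lemma fourier_transform_indicator:
  fixes B :: "'a::euclidean_space set"
  shows "fourier_transform (indicator B) (R *\<^sub>R \<omega>) = (LINT x|lborel. of_real (indicator B x) * wave R \<omega> x)"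
  unfolding fourier_transform_def wave_def
  by (intro Bochner_Integration.integral_cong refl) (simp split: split_indicator)

text \<open>The bounds for the approximating bodies depend on \<open>A\<close> and \<open>L\<close>
  only and survive the limit. The condition \<open>8 * R \<le> norm (G x)\<close> holds from some
  index on; this index depends on \<open>R\<close>, the constant does not.\<close>

lemma cap_energy_indicator:
  fixes B :: "'a::euclidean_space set"
  assumes B: "open B" "convex B" "bounded B" "0 \<in> B"
  obtains C where "0 \<le> C" and "\<And>\<tau> R. norm \<tau> = 1 \<Longrightarrow> 1 \<le> R \<Longrightarrow>
    (LINT y|lborel. cap_weight (DIM('a) + 1) \<tau> y * (cmod (LINT x|lborel. of_real (indicator B x) * wave R (sgn y) x))\<^sup>2)
      \<le> C / R ^ (DIM('a) + 1)"
proof -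

  \<comment> \<open>The approximating bodies\<close>
  obtain r0 where r0: "0 < r0" "ball 0 r0 \<subseteq> B" using B(1,4) open_contains_ball by blast
  obtain L1 where L1: "\<And>x. x \<in> B \<Longrightarrow> norm x \<le> L1" using B(3) bounded_iff by blast
  define L0 where "L0 = max 1 L1"
  have L0: "1 \<le> L0" "\<And>x. x \<in> B \<Longrightarrow> norm x \<le> L0" using L1 by (auto simp: L0_def le_max_iff_disj)
  \<comment> \<open>The functionals are at most 1 on \<open>B\<close>, which contains
    \<open>ball 0 r0\<close>; testing them on a vector of norm \<open>r0 / 2\<close> bounds their
    norms by \<open>2 / r0\<close>.\<close>
  define A where "A = 2 / r0"
  have A: "0 < A" using r0 by (simp add: A_def)
  define L where "L = 2 * L0 * real DIM('a)"
  obtain D where D: "countable D" "D \<noteq> {}" "\<And>a x. a \<in> D \<Longrightarrow> x \<in> B \<Longrightarrow> a \<bullet> x \<le> 1"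
    "\<And>x. x \<notin> closure B \<Longrightarrow> \<exists>a\<in>D. 1 < a \<bullet> x"
    using countable_polar[OF B(1,2,4)] by metis
  define J where "J k = box_functionals L0 \<union> from_nat_into D ` {..<k}" for k
  \<comment> \<open>\<open>m k\<close> bounds the number of functionals, so
    \<open>\<kappa> k = 4 * m k\<close> is what \<open>layered_body_exp\<close> asks for. That it
    tends to infinity both sharpens the body and thins the layer.\<close>
  define m where "m k = real (2 * DIM('a) + k)" for k
  define \<kappa> where "\<kappa> k = 4 * m k" for k
  have fJ: "finite (J k)" for k by (simp add: J_def finite_box_functionals)
  have pol: "a \<bullet> x \<le> 1" if "a \<in> J k" "x \<in> B" for a x k
  proof (cases "a \<in> box_functionals L0")
    case True
    then obtain b where b: "b \<in> Basis" "a = (1/L0) *\<^sub>R b \<or> a = (- 1/L0) *\<^sub>R b" by (auto simp: box_functionals_def)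
    have "\<bar>b \<bullet> x\<bar> \<le> L0" using Basis_le_norm[OF b(1), of x] L0(2)[OF that(2)] by (simp add: inner_commute)
    then show ?thesis using b(2) L0(1) by (auto simp: field_simps abs_le_iff)
  next
    case False
    then have "a \<in> D" using that(1) from_nat_into[OF D(2)] by (auto simp: J_def)
    then show ?thesis using D(3) that(2) by blast
  qed
  have nJ: "norm a \<le> A" if "a \<in> J k" for a k
  proof (cases "a = 0")
    case False
    have "(r0 / 2) *\<^sub>R sgn a \<in> B" using r0 False by (intro subsetD[OF r0(2)]) (simp add: norm_sgn)
    moreover have "a \<bullet> sgn a = norm a"
      using False by (simp add: sgn_div_norm dot_square_norm power2_eq_square)
    ultimately have "(r0 / 2) * norm a \<le> 1" using pol[OF that] by fastforce
    then show ?thesis using r0 by (simp add: A_def field_simps)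
  qed (use A in simp)
  have cJ: "real (card (J k)) \<le> m k" for k
  proof -
    have "card (J k) \<le> card (box_functionals L0 :: 'a set) + card (from_nat_into D ` {..<k})" unfolding J_def by (rule card_Un_le)
    also have "card (box_functionals L0 :: 'a set) \<le> DIM('a) + DIM('a)"
      unfolding box_functionals_def by (intro order_trans[OF card_Un_le] add_mono card_image_le) auto
    also have "card (from_nat_into D ` {..<k}) \<le> k" using card_image_le[of "{..<k}" "from_nat_into D"] by simp
    finally have "card (J k) \<le> 2 * DIM('a) + k" by simp
    then show ?thesis unfolding m_def using of_nat_mono by blast
  qed
  have m1: "1 \<le> m k" for k 
  proof -
    have "1 \<le> 2 * DIM('a) + k" using DIM_positive[where 'a = 'a] by linarith
    then show ?thesis unfolding m_def by (metis of_nat_1 of_nat_mono)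
  qed
  have \<kappa>: "1 \<le> \<kappa> k" "4 * real (card (J k)) \<le> \<kappa> k" for k using m1[of k] cJ[of k] by (auto simp: \<kappa>_def)
  have lb: "layered_body (J k) (\<kappa> k) (1 / (8 * A)) L" for k
    unfolding L_def by (rule layered_body_exp(1)[OF fJ _ nJ A L0(1) \<kappa>]) (auto simp: J_def)
  have big: "\<kappa> k / (4 * L) \<le> norm (exp_body.G (J k) (\<kappa> k) x)" if "x \<in> layered_body.layer (J k) (\<kappa> k)" for k x
    unfolding L_def by (rule layered_body_exp(2)[OF fJ _ nJ A L0(1) \<kappa> that]) (auto simp: J_def)
  have Lge: "1 \<le> L" using layered_body.L[OF lb] .
  define \<phi> where "\<phi> k = layered_body.\<phi> (J k) (\<kappa> k)" for k
  have \<phi>_def': "\<phi> k x = step (exp_body.S (J k) (\<kappa> k) x - 1)" for k x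
    unfolding \<phi>_def layered_body.\<phi>_def[OF lb] ..
  have eb: "exp_body (J k)" for k by unfold_locales (rule fJ)
  have S_eq: "exp_body.S (J k) (\<kappa> k) x = (\<Sum>a\<in>J k. exp (\<kappa> k * (a \<bullet> x - 1)))" for k x
    unfolding exp_body.S_def[OF eb] exp_body.E_def[OF eb] ..

  \<comment> \<open>Convergence of the smoothed bodies off the frontier\<close>
  have mlim: "filterlim m at_top sequentially"
    unfolding m_def by real_asymp
  have lim: "(\<lambda>k. \<phi> k x) \<longlonglongrightarrow> indicator B x" if x: "x \<notin> frontier B" for x
  proof (cases "x \<in> B")
    case True
    obtain \<epsilon> where \<epsilon>: "0 < \<epsilon>" "(1 + \<epsilon>) *\<^sub>R x \<in> B"
    proof -
      obtain e where e: "0 < e" "ball x e \<subseteq> B" using B(1) True open_contains_ball by blast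
      define \<epsilon> where "\<epsilon> = e / (2 * (norm x + 1))"
      have p: "0 < norm x + 1" using norm_ge_zero[of x] by linarith
      have \<epsilon>0: "0 < \<epsilon>" using e p by (simp add: \<epsilon>_def)
      have "\<epsilon> * norm x \<le> \<epsilon> * (norm x + 1)" using \<epsilon>0 by (intro mult_left_mono) auto
      also have "\<dots> = e / 2" using p by (simp add: \<epsilon>_def field_simps)
      finally have "dist x ((1 + \<epsilon>) *\<^sub>R x) < e" using e \<epsilon>0 by (simp add: dist_norm scaleR_add_left)
      then show ?thesis using that[OF \<epsilon>0] e by auto
    qed
    \<comment> \<open>Inside \<open>B\<close>: as \<open>(1 + \<epsilon>) *\<^sub>R x\<close> still
      belongs to \<open>B\<close>, all functionals satisfy
      \<open>a \<bullet> x \<le> 1 - \<delta>\<close> at once. The exponential smallness beats the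
      number of summands, \<open>S\<close> falls below 1 and \<open>\<phi>\<close> becomes
      1.\<close>
    define \<delta> where "\<delta> = \<epsilon> / (1 + \<epsilon>)"
    have \<delta>: "0 < \<delta>" using \<epsilon> by (simp add: \<delta>_def)
    have ax: "a \<bullet> x - 1 \<le> - \<delta>" if "a \<in> J k" for a k
    proof -
      have "(1 + \<epsilon>) * (a \<bullet> x) \<le> 1" using pol[OF that \<epsilon>(2)] by simp
      then show ?thesis using \<epsilon>(1) by (simp add: \<delta>_def field_simps)
    qed
    have Sle: "exp_body.S (J k) (\<kappa> k) x \<le> m k * exp (- (4 * \<delta> * m k))" for k
    proof -
      have "exp_body.S (J k) (\<kappa> k) x \<le> (\<Sum>a\<in>J k. exp (- (4 * \<delta> * m k)))"
        unfolding S_eq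
      proof (intro sum_mono)
        fix a assume "a \<in> J k"
        then have "\<kappa> k * (a \<bullet> x - 1) \<le> \<kappa> k * - \<delta>" using ax \<kappa>(1)[of k] by (intro mult_left_mono) auto
        then show "exp (\<kappa> k * (a \<bullet> x - 1)) \<le> exp (- (4 * \<delta> * m k))" by (simp add: \<kappa>_def mult_ac)
      qed
      also have "\<dots> = real (card (J k)) * exp (- (4 * \<delta> * m k))" by simp
      also have "\<dots> \<le> m k * exp (- (4 * \<delta> * m k))" using cJ by (intro mult_right_mono) auto
      finally show ?thesis .
    qed
    have "((\<lambda>t. t * exp (- (4 * \<delta> * t))) \<longlongrightarrow> 0) at_top" using \<delta> by real_asymp
    from filterlim_compose[OF this mlim] have "(\<lambda>k. m k * exp (- (4 * \<delta> * m k))) \<longlonglongrightarrow> 0" .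
    then have "\<forall>\<^sub>F k in sequentially. m k * exp (- (4 * \<delta> * m k)) < 1" by (rule order_tendstoD) simp
    then have "\<forall>\<^sub>F k in sequentially. \<phi> k x = indicator B x"
    proof eventually_elim
      case (elim k)
      then have "exp_body.S (J k) (\<kappa> k) x - 1 \<le> 0" using Sle[of k] by linarith
      then show ?case using True step_bounds(3) by (simp add: \<phi>_def')
    qed
    then show ?thesis by (rule tendsto_eventually)
  next
    case False
    then have "x \<notin> closure B" using x by (simp add: frontier_def interior_open[OF B(1)])
    \<comment> \<open>Outside the closure: one functional with \<open>1 < a \<bullet> x\<close>
      belongs to \<open>J k\<close> for all large \<open>k\<close> and alone lifts \<open>S\<close>
      to at least 2, where \<open>\<phi>\<close> vanishes.\<close>
    then obtain a where a: "a \<in> D" "1 < a \<bullet> x" using D(4) by blast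
    obtain i where i: "a = from_nat_into D i" using from_nat_into_surj[OF D(1) a(1)] by metis
    have "filterlim (\<lambda>k. 4 * (a \<bullet> x - 1) * m k) at_top sequentially"
      using a(2) by (intro filterlim_tendsto_pos_mult_at_top[OF tendsto_const _ mlim]) simp
    then have "\<forall>\<^sub>F k in sequentially. 1 \<le> 4 * (a \<bullet> x - 1) * m k" by (simp add: filterlim_at_top)
    moreover have "\<forall>\<^sub>F k in sequentially. i < k" by (rule eventually_gt_at_top)
    ultimately have "\<forall>\<^sub>F k in sequentially. \<phi> k x = indicator B x"
    proof eventually_elim
      case (elim k)
      then have "a \<in> J k" using i by (auto simp: J_def)
      then have "exp (\<kappa> k * (a \<bullet> x - 1)) \<le> exp_body.S (J k) (\<kappa> k) x"
        unfolding S_eq using fJ by (intro member_le_sum) auto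
      moreover have "1 + \<kappa> k * (a \<bullet> x - 1) \<le> exp (\<kappa> k * (a \<bullet> x - 1))" by (rule exp_ge_add_one_self)
      moreover have "\<kappa> k * (a \<bullet> x - 1) = 4 * (a \<bullet> x - 1) * m k" by (simp add: \<kappa>_def)
      ultimately have "1 \<le> exp_body.S (J k) (\<kappa> k) x - 1" using elim by linarith
      then show ?case using False step_bounds(4) by (simp add: \<phi>_def')
    qed
    then show ?thesis by (rule tendsto_eventually)
  qed

  \<comment> \<open>Passage to the limit in the transforms\<close>
  have frontier_null: "AE x in lborel. x \<notin> frontier B"
  proof -
    have "frontier B \<in> null_sets lborel"
      using negligible_convex_frontier[OF B(2)] by (auto simp: null_sets_completion_iff negligible_iff_null_sets)
    then show ?thesis by (rule AE_not_in)
  qed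
  have \<phi>_le: "cmod (of_real (\<phi> k x) * wave R \<omega> x) \<le> indicator (cball 0 L) x" for k R \<omega> x
  proof (cases "norm x \<le> L")
    case True
    then show ?thesis using layered_body.\<phi>_bounds[OF lb, of k x] by (simp add: norm_mult \<phi>_def)
  next
    case False
    then have "x \<notin> layered_body.body (J k) (\<kappa> k)"
      using layered_body.bounded[OF lb, of k x] unfolding layered_body.body_def[OF lb] by auto
    then show ?thesis using layered_body.\<phi>_outside[OF lb, of x k] by (simp add: \<phi>_def)
  qed
  have \<phi>m[measurable]: "\<phi> k \<in> borel_measurable borel" for k
    unfolding \<phi>_def by (intro borel_measurable_continuous_onI layered_body.continuous_on_\<phi>[OF lb] continuous_on_id)
  have [measurable]: "B \<in> sets borel" using B(1) by simp
  have cbi: "integrable lborel (indicator (cball (0::'a) L) :: 'a \<Rightarrow> real)"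
    by (intro integrable_real_indicator) (use emeasure_bounded_finite[OF bounded_cball] in auto)
  have wm[measurable]: "wave R \<omega> \<in> borel_measurable borel" for R and \<omega> :: 'a
    unfolding wave_def[abs_def] by measurable
  define \<Phi> where "\<Phi> k R \<omega> = (LINT x|lborel. of_real (\<phi> k x) * wave R \<omega> x)" for k R \<omega>
  define F where "F R \<omega> = (LINT x|lborel. of_real (indicator B x) * wave R \<omega> x)" for R \<omega>
  have \<Phi>lim: "(\<lambda>k. \<Phi> k R \<omega>) \<longlonglongrightarrow> F R \<omega>" for R \<omega>
    unfolding \<Phi>_def F_def
  proof (rule integral_dominated_convergence[OF _ _ cbi])
    show "AE x in lborel. (\<lambda>k. of_real (\<phi> k x) * wave R \<omega> x) \<longlonglongrightarrow> of_real (indicator B x) * wave R \<omega> x"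
      using frontier_null by eventually_elim (intro tendsto_intros lim)
  qed (use \<phi>_le in auto)
  have \<Phi>b: "cmod (\<Phi> k R \<omega>) \<le> measure lborel (cball (0::'a) L)" for k R \<omega>
  proof -
    have "integrable lborel (\<lambda>x. of_real (\<phi> k x) * wave R \<omega> x)"
      by (rule Bochner_Integration.integrable_bound[OF cbi]) (use \<phi>_le in auto)
    from Bochner_Integration.integral_norm_bound_integral[OF this cbi \<phi>_le] show ?thesis by (simp add: \<Phi>_def)
  qed
  define n where "n = DIM('a) + 1"
  obtain Cd where Cd: "0 \<le> Cd" "\<And>R x0. 0 < R \<Longrightarrow> integrable lborel (\<lambda>x::'a. decay (DIM('a) + 1) R (x - x0))"
    "\<And>R x0. 0 < R \<Longrightarrow> (LINT x|lborel. decay (DIM('a) + 1) R (x - x0 :: 'a)) \<le> Cd / R ^ DIM('a)"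
    using decay_integral_bound by metis
  define C where "C = cap_bound_const TYPE('a) (1 / (8 * A)) L Cd"
  have bound: "integrable lborel (\<lambda>y. cap_weight n \<tau> y * (cmod (\<Phi> k R (sgn y)))\<^sup>2)"
      "(LINT y|lborel. cap_weight n \<tau> y * (cmod (\<Phi> k R (sgn y)))\<^sup>2) \<le> C / R ^ (DIM('a) + 1)"
    if \<tau>: "norm \<tau> = 1" and R: "1 \<le> R" and k: "8 * R * (4 * L) \<le> \<kappa> k" for \<tau> R k
  proof -
    have "8 * R \<le> norm (exp_body.G (J k) (\<kappa> k) x)" if "x \<in> layered_body.layer (J k) (\<kappa> k)" for x
    proof -
      have "8 * R \<le> \<kappa> k / (4 * L)" using k Lge by (simp add: field_simps)
      then show ?thesis using big[OF that] by linarith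
    qed
    note cb = layered_body.cap_fourier_bound[OF lb \<tau> R this Cd(1) Cd(3) Cd(2)]
    show "integrable lborel (\<lambda>y. cap_weight n \<tau> y * (cmod (\<Phi> k R (sgn y)))\<^sup>2)"
      unfolding \<Phi>_def \<phi>_def n_def by (rule cb(1)) (use R in auto)
    show "(LINT y|lborel. cap_weight n \<tau> y * (cmod (\<Phi> k R (sgn y)))\<^sup>2) \<le> C / R ^ (DIM('a) + 1)"
      unfolding \<Phi>_def \<phi>_def n_def C_def by (rule cb(2)) (use R in auto)
  qed
  have main: "(LINT y|lborel. cap_weight n \<tau> y * (cmod (F R (sgn y)))\<^sup>2) \<le> C / R ^ (DIM('a) + 1)"
    if \<tau>: "norm \<tau> = 1" and R: "1 \<le> R" for \<tau> :: 'a and R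
  proof -
    have "filterlim (\<lambda>k. 4 * m k) at_top sequentially"
      by (intro filterlim_tendsto_pos_mult_at_top[OF tendsto_const _ mlim]) simp
    then have "\<forall>\<^sub>F k in sequentially. 8 * R * (4 * L) \<le> \<kappa> k" unfolding \<kappa>_def by (metis filterlim_at_top)
    then obtain k0 where k0: "\<And>k. k0 \<le> k \<Longrightarrow> 8 * R * (4 * L) \<le> \<kappa> k" by (auto simp: eventually_sequentially)
    define V where "V = measure lborel (cball (0::'a) L)"
    have Vi: "integrable lborel (\<lambda>y. V\<^sup>2 * indicator (cball (0::'a) 2) y)"
      by (intro integrable_mult_right integrable_real_indicator) (use emeasure_bounded_finite[OF bounded_cball] in auto)
    \<comment> \<open>The shift by \<open>k0\<close> discards the bodies whose layer is still too
      thick for this \<open>R\<close>.\<close>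
    have "(\<lambda>k. LINT y|lborel. cap_weight n \<tau> y * (cmod (\<Phi> (k + k0) R (sgn y)))\<^sup>2)
        \<longlonglongrightarrow> (LINT y|lborel. cap_weight n \<tau> y * (cmod (F R (sgn y)))\<^sup>2)"
    proof (rule integral_dominated_convergence[OF _ _ Vi])
      have mk: "(\<lambda>y. cap_weight n \<tau> y * (cmod (\<Phi> (k + k0) R (sgn y)))\<^sup>2) \<in> borel_measurable lborel" for k
        using bound(1)[OF \<tau> R k0] by (rule borel_measurable_integrable) simp
      then show "(\<lambda>y. cap_weight n \<tau> y * (cmod (\<Phi> (k + k0) R (sgn y)))\<^sup>2) \<in> borel_measurable lborel" for k .
      have l: "(\<lambda>k. cap_weight n \<tau> y * (cmod (\<Phi> (k + k0) R (sgn y)))\<^sup>2) \<longlonglongrightarrow> cap_weight n \<tau> y * (cmod (F R (sgn y)))\<^sup>2" for y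
        by (intro tendsto_intros LIMSEQ_ignore_initial_segment \<Phi>lim)
      then show "(\<lambda>y. cap_weight n \<tau> y * (cmod (F R (sgn y)))\<^sup>2) \<in> borel_measurable lborel"
        using mk by (rule borel_measurable_LIMSEQ_metric[rotated])
      show "AE y in lborel. (\<lambda>k. cap_weight n \<tau> y * (cmod (\<Phi> (k + k0) R (sgn y)))\<^sup>2) \<longlonglongrightarrow> cap_weight n \<tau> y * (cmod (F R (sgn y)))\<^sup>2"
        using l by simp
      show "AE y in lborel. norm (cap_weight n \<tau> y * (cmod (\<Phi> (k + k0) R (sgn y)))\<^sup>2) \<le> V\<^sup>2 * indicator (cball 0 2) y" for k
      proof (rule AE_I2)
        fix y :: 'a
        show "norm (cap_weight n \<tau> y * (cmod (\<Phi> (k + k0) R (sgn y)))\<^sup>2) \<le> V\<^sup>2 * indicator (cball 0 2) y"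
        proof (cases "cap_weight n \<tau> y = 0")
          case False
          have "norm y \<le> 2" using cap_weight_support(4)[OF \<tau> _ False] by (simp add: n_def)
          have "(cmod (\<Phi> (k + k0) R (sgn y)))\<^sup>2 \<le> V\<^sup>2" unfolding V_def by (intro power_mono \<Phi>b) auto
          then have "cap_weight n \<tau> y * (cmod (\<Phi> (k + k0) R (sgn y)))\<^sup>2 \<le> 1 * V\<^sup>2"
            using cap_weight_bounds[of n \<tau> y] by (intro mult_mono) auto
          then show ?thesis using \<open>norm y \<le> 2\<close> cap_weight_bounds[of n \<tau> y] by (simp add: abs_mult)
        qed simp
      qed
    qed
    moreover have "(LINT y|lborel. cap_weight n \<tau> y * (cmod (\<Phi> (k + k0) R (sgn y)))\<^sup>2) \<le> C / R ^ (DIM('a) + 1)" for k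
      by (rule bound(2)[OF \<tau> R k0]) simp
    ultimately show ?thesis by (intro LIMSEQ_le_const2) auto
  qed
  have "0 \<le> max 0 C" by simp
  moreover have "(LINT y|lborel. cap_weight (DIM('a) + 1) \<tau> y * (cmod (LINT x|lborel. of_real (indicator B x) * wave R (sgn y) x))\<^sup>2)
      \<le> max 0 C / R ^ (DIM('a) + 1)" if "norm \<tau> = 1" "1 \<le> R" for \<tau> R
  proof -
    have "C / R ^ (DIM('a) + 1) \<le> max 0 C / R ^ (DIM('a) + 1)" using that(2) by (intro divide_right_mono) auto
    then show ?thesis using main[OF that] unfolding F_def n_def by linarith
  qed
  ultimately show ?thesis by (rule that)
qed

text \<open>A translation that moves a point of \<open>B\<close> to 0 multiplies the transform by a
  unimodular factor. For \<open>1 \<le> R\<close> the estimates on the finitely many caps add up;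
  for \<open>R < 1\<close> the transform is bounded by a volume and
  \<open>R powr (- (real DIM('a) + 1))\<close> is at least 1.\<close>

theorem spherical_average_decay:
  fixes B :: "'a::euclidean_space set"
  assumes "bounded B" and "open B" and "convex B"
  shows "\<exists>C>0. \<forall>R>0. (LINT \<omega>|sphere_measure. (cmod (fourier_transform (indicator B) (R *\<^sub>R \<omega>)))\<^sup>2)
             \<le> C * R powr (- (real DIM('a) + 1))"
proof (cases "B = {}")
  case True
  then have "fourier_transform (indicator B) \<xi> = 0" for \<xi> :: 'a by (simp add: fourier_transform_def)
  then show ?thesis by (intro exI[of _ 1]) simp
next
  case False
  then obtain p where p: "p \<in> B" by blast
  define B0 where "B0 = (\<lambda>x. x - p) ` B"
  have B0': "B0 = (+) (- p) ` B" by (auto simp: B0_def)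
  have B0: "open B0" "convex B0" "bounded B0" "0 \<in> B0"
  proof -
    show "open B0" unfolding B0' by (rule open_translation[OF assms(2)])
    show "convex B0" unfolding B0' by (rule convex_translation[OF assms(3)])
    show "bounded B0" unfolding B0' by (rule bounded_translation[OF assms(1)])
    show "0 \<in> B0" using p by (force simp: B0_def)
  qed
  have [measurable]: "B \<in> sets borel" "B0 \<in> sets borel" using assms B0 by auto
  have wm[measurable]: "wave R \<omega> \<in> borel_measurable borel" for R and \<omega> :: 'a
    unfolding wave_def[abs_def] by measurable
  define F where "F R \<omega> = (LINT x|lborel. of_real (indicator B0 x) * wave R \<omega> x)" for R \<omega>
  have FB: "cmod (fourier_transform (indicator B) (R *\<^sub>R \<omega>)) = cmod (F R \<omega>)" for R \<omega>
  proof -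
    have "(LINT x|lborel. of_real (indicator B x) * wave R \<omega> x) = (LINT x|lborel. of_real (indicator B (x + p)) * wave R \<omega> (x + p))"
      by (rule integral_lborel_translation[symmetric]) measurable
    also have "\<dots> = (LINT x|lborel. wave R \<omega> p * (of_real (indicator B0 x) * wave R \<omega> x))"
    proof (intro Bochner_Integration.integral_cong refl)
      fix x
      have "wave R \<omega> (x + p) = wave R \<omega> p * wave R \<omega> x"
        unfolding wave_def exp_add[symmetric] by (simp add: inner_add_left algebra_simps)
      moreover have "indicator B (x + p) = (indicator B0 x :: real)"
        by (auto simp: B0_def indicator_def image_iff algebra_simps)
      ultimately show "of_real (indicator B (x + p)) * wave R \<omega> (x + p) = wave R \<omega> p * (of_real (indicator B0 x) * wave R \<omega> x)"
        by simp
    qed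
    finally have "fourier_transform (indicator B) (R *\<^sub>R \<omega>) = wave R \<omega> p * F R \<omega>"
      unfolding fourier_transform_indicator F_def by simp
    then show ?thesis by (simp add: norm_mult)
  qed
  obtain C1 where C1: "0 \<le> C1" "\<And>\<tau> R. norm \<tau> = 1 \<Longrightarrow> 1 \<le> R \<Longrightarrow>
    (LINT y|lborel. cap_weight (DIM('a) + 1) \<tau> y * (cmod (F R (sgn y)))\<^sup>2) \<le> C1 / R ^ (DIM('a) + 1)"
    using cap_energy_indicator[OF B0] unfolding F_def by blast
  obtain T :: "'a set" and C2 where T: "finite T" "\<And>\<tau>. \<tau> \<in> T \<Longrightarrow> norm \<tau> = 1" "0 \<le> C2"
    "\<And>h B. h \<in> borel_measurable borel \<Longrightarrow> (\<And>x. 0 \<le> h x) \<Longrightarrow> (\<And>x. h x \<le> B) \<Longrightarrow>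
      (LINT \<omega>|sphere_measure. h \<omega>) \<le> C2 * (\<Sum>\<tau>\<in>T. LINT y|lborel. cap_weight (DIM('a) + 1) \<tau> y * h (sgn y))"
  proof (rule sphere_integral_le_caps[where 'a = 'a and n = "DIM('a) + 1"])
    fix T :: "'a set" and C :: real
    assume T: "finite T" "\<And>\<tau>. \<tau> \<in> T \<Longrightarrow> norm \<tau> = 1" "0 \<le> C"
      "\<And>h B. h \<in> borel_measurable borel \<Longrightarrow> (\<And>x. 0 \<le> h x) \<Longrightarrow> (\<And>x. h x \<le> B) \<Longrightarrow> 0 < DIM('a) + 1 \<Longrightarrow>
        (LINT \<omega>|sphere_measure. h \<omega>) \<le> C * (\<Sum>\<tau>\<in>T. LINT y|lborel. cap_weight (DIM('a) + 1) \<tau> y * h (sgn y))"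
    show thesis by (rule that[OF T(1-3)], assumption) (rule T(4), assumption+, simp)
  qed
  obtain L where L: "\<And>x. x \<in> B0 \<Longrightarrow> norm x \<le> L" using B0(3) bounded_iff by blast
  define V where "V = measure lborel (cball (0::'a) L)"
  have cbi: "integrable lborel (indicator (cball (0::'a) L) :: 'a \<Rightarrow> real)"
    by (intro integrable_real_indicator) (use emeasure_bounded_finite[OF bounded_cball] in auto)
  have Fb: "cmod (F R \<omega>) \<le> V" for R \<omega>
  proof -
    have le: "cmod (of_real (indicator B0 x) * wave R \<omega> x) \<le> indicator (cball 0 L) x" for x
      using L[of x] by (auto simp: norm_mult split: split_indicator)
    have "integrable lborel (\<lambda>x. of_real (indicator B0 x) * wave R \<omega> x)"
      by (rule Bochner_Integration.integrable_bound[OF cbi]) (use le in auto)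
    from Bochner_Integration.integral_norm_bound_integral[OF this cbi le] show ?thesis by (simp add: F_def V_def)
  qed
  have Fm[measurable]: "F R \<in> borel_measurable borel" for R
  proof -
    have "(\<lambda>(\<omega>, x). of_real (indicator B0 x) * wave R \<omega> x) \<in> borel_measurable (borel \<Otimes>\<^sub>M lborel)"
      unfolding wave_def by measurable
    then show ?thesis unfolding F_def[abs_def] by (rule lborel.borel_measurable_lebesgue_integral)
  qed
  have hm: "(\<lambda>\<omega>. (cmod (F R \<omega>))\<^sup>2) \<in> borel_measurable borel" for R by measurable
  have hb: "(cmod (F R \<omega>))\<^sup>2 \<le> V\<^sup>2" for R \<omega> using Fb by (intro power_mono) auto
  define M where "M = C2 * (\<Sum>\<tau>\<in>T. LINT y|lborel. cap_weight (DIM('a) + 1) \<tau> y * V\<^sup>2)"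
  \<comment> \<open>\<open>M\<close> takes care of \<open>R < 1\<close> and the last summand of
    \<open>1 \<le> R\<close>; the 1 makes \<open>C\<close> positive.\<close>
  define C where "C = 1 + \<bar>M\<bar> + C2 * (real (card T) * C1)"
  have C0: "0 < C" using T(3) C1(1) by (simp add: C_def add_pos_nonneg)
  have "(LINT \<omega>|sphere_measure. (cmod (F R \<omega>))\<^sup>2) \<le> C * R powr (- (real DIM('a) + 1))" if R: "0 < R" for R
  proof (cases "1 \<le> R")
    case True
    have "(LINT \<omega>|sphere_measure. (cmod (F R \<omega>))\<^sup>2) \<le> C2 * (\<Sum>\<tau>\<in>T. LINT y|lborel. cap_weight (DIM('a) + 1) \<tau> y * (cmod (F R (sgn y)))\<^sup>2)"
      by (rule T(4)[OF hm _ hb]) simp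
    also have "\<dots> \<le> C2 * (\<Sum>\<tau>\<in>T. C1 / R ^ (DIM('a) + 1))"
      using T(2,3) C1(2) True by (intro mult_left_mono sum_mono) auto
    also have "\<dots> = C2 * (real (card T) * C1) / R ^ (DIM('a) + 1)" by simp
    also have "\<dots> \<le> C / R ^ (DIM('a) + 1)" using R by (intro divide_right_mono) (auto simp: C_def)
    also have "\<dots> = C * R powr (- (real DIM('a) + 1))"
    proof -
      have "R powr (real DIM('a) + 1) = R ^ (DIM('a) + 1)" using R powr_realpow[OF R, of "DIM('a) + 1"] by (simp add: add.commute)
      then show ?thesis by (simp only: powr_minus divide_inverse)
    qed
    finally show ?thesis .
  next
    case False
    have "(LINT \<omega>|sphere_measure. (cmod (F R \<omega>))\<^sup>2) \<le> C2 * (\<Sum>\<tau>\<in>T. LINT y|lborel. cap_weight (DIM('a) + 1) \<tau> y * (cmod (F R (sgn y)))\<^sup>2)"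
      by (rule T(4)[OF hm _ hb]) simp
    also have "\<dots> \<le> M"
      unfolding M_def
    proof (intro mult_left_mono sum_mono T(3))
      fix \<tau> assume "\<tau> \<in> T"
      then have \<tau>: "norm \<tau> = 1" by (rule T(2))
      have s0: "cap_weight (DIM('a) + 1) \<tau> y = 0" if "2 < norm y" for y
        using cap_weight_support(4)[OF \<tau>, of "DIM('a) + 1" y] that by force
      note [measurable] = sgn_borel_measurable
      have le: "cap_weight (DIM('a) + 1) \<tau> y * (cmod (F R (sgn y)))\<^sup>2 \<le> cap_weight (DIM('a) + 1) \<tau> y * V\<^sup>2" for y
        using hb cap_weight_bounds(1) by (intro mult_left_mono) auto
      have le1: "cap_weight (DIM('a) + 1) \<tau> y * V\<^sup>2 \<le> V\<^sup>2" for y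
        using cap_weight_bounds[of "DIM('a) + 1" \<tau> y] by (intro mult_left_le_one_le) auto
      have nn: "0 \<le> cap_weight (DIM('a) + 1) \<tau> y * (cmod (F R (sgn y)))\<^sup>2" for y
        using cap_weight_bounds(1) by (intro mult_nonneg_nonneg) auto
      show "(LINT y|lborel. cap_weight (DIM('a) + 1) \<tau> y * (cmod (F R (sgn y)))\<^sup>2) \<le> (LINT y|lborel. cap_weight (DIM('a) + 1) \<tau> y * V\<^sup>2)"
      proof (rule Bochner_Integration.integral_mono[OF _ _ le])
        show "integrable lborel (\<lambda>y. cap_weight (DIM('a) + 1) \<tau> y * (cmod (F R (sgn y)))\<^sup>2)"
          by (rule integrable_bounded_support[where C = "V\<^sup>2" and L = 2])
             (use s0 nn order_trans[OF le le1] in \<open>auto simp: abs_of_nonneg\<close>)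
        show "integrable lborel (\<lambda>y. cap_weight (DIM('a) + 1) \<tau> y * V\<^sup>2)"
          by (rule integrable_bounded_support[where C = "V\<^sup>2" and L = 2])
             (use s0 le1 cap_weight_bounds(1)[of "DIM('a) + 1" \<tau>] in \<open>auto simp: abs_mult\<close>)
      qed
    qed
    also have "\<dots> \<le> C * 1" 
    proof -
      have "0 \<le> C2 * (real (card T) * C1)" using T(3) C1(1) by simp
      then show ?thesis unfolding C_def mult_1_right by linarith
    qed
    also have "\<dots> \<le> C * R powr (- (real DIM('a) + 1))"
    proof (intro mult_left_mono)
      have "R powr 0 \<le> R powr (- (real DIM('a) + 1))" using R False by (intro powr_mono') auto
      then show "1 \<le> R powr (- (real DIM('a) + 1))" using R by simp
    qed (use C0 in simp)
    finally show ?thesis .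
  qed
  then show ?thesis using C0 FB by (intro exI[of _ C]) simp
qed

theorem theorem1p1:
  fixes B :: "(real ^ 'n) set"
  assumes "CARD('n) \<ge> 2"
    and "bounded B" and "open B" and "convex B"
  shows "\<exists>C>0. \<forall>R>0.
           (LINT \<omega>|sphere_measure. (cmod (fourier_transform (indicator B) (R *\<^sub>R \<omega>)))\<^sup>2)
             \<le> C * R powr (- (real CARD('n) + 1))"
  using spherical_average_decay[OF assms(2,3,4)] by simp

end
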